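(* Let $p$ be a prime, let $K$ be a local field of characteristic $p$ with residue field $k$, and assume that $|k|=q<\infty$. Let $b \in \frac{1}{p-1}\cdot(\mathbb{N}\smallsetminus p\mathbb{N})$. Then $$|\mathcal{S}_b| = \gcd(q-1,(p-1)b).$$ Furthermore, if $b\in\mathbb{N}\smallsetminus p\mathbb{N}$ then $$|\mathcal{S}_b^g| = \gcd\left(\frac{q-1}{p-1},b\right)\quad\text{and}\quad |\mathcal{S}_b^{ng}| = (p-2)\cdot\gcd\left(\frac{q-1}{p-1},b\right).$$
   Context: A local field is a field complete with respect to a discrete valuation. $\mathbb{N}$ is the set of positive integers. $K_s$ is a separable closure of $K$. Ramification break: let $L/K$ be a separable totally ramified extension of degree $p$ inside $K_s$, let $\nu_L$ be the valuation of $K_s$ normalized so that $\nu_L(L^\times)=\mathbb{Z}$, and let $\pi_L$ be a prime element of $L$. For a $K$-embedding $\sigma: L\to K_s$ with $\sigma\ne\mathrm{id}_L$, the ramification number of $\sigma$ is $\nu_L(\sigma(\pi_L)-\pi_L)-1$ (independent of the choice of $\pi_L$). For such a degree-$p$ extension all these numbers coincide, and the common value is the (lower) ramification break of $L/K$. $k$-isomorphism: finite extensions $L_1/K$ and $L_2/K$ are $k$-isomorphic if there is a field isomorphism $\sigma: L_1\to L_2$ such that $\sigma(K)=K$ and $\sigma$ induces the identity map on $k$. $\mathcal{E}_b$ denotes the set of all totally ramified subextensions $L/K$ of $K_s/K$ of degree $p$ with ramification break $b$. $\mathcal{S}_b$ denotes the set of $k$-isomorphism classes of elements of $\mathcal{E}_b$,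 $\mathcal{S}_b^g$ the set of $k$-isomorphism classes of Galois extensions in $\mathcal{E}_b$, and $\mathcal{S}_b^{ng}$ the set of $k$-isomorphism classes of non-Galois extensions in $\mathcal{E}_b$. *)

theory Defs
  imports Complex_Main "HOL-Computational_Algebra.Computational_Algebra"
begin

text \<open>
  The base field \<open>K\<close> is a type \<open>'k\<close>, its separable closure \<open>K\<^sub>s\<close> is a type \<open>'a\<close>, and
  \<open>\<iota> :: 'k \<Rightarrow> 'a\<close> is the inclusion of \<open>K\<close> in \<open>K\<^sub>s\<close>, so that \<open>K\<close> as a subfield of \<open>K\<^sub>s\<close> is
  \<open>range \<iota>\<close>.  Subextensions of \<open>K\<^sub>s/K\<close> are sets of type \<open>'a set\<close>.

  Valuations are written additively with values in the reals; the value at \<open>0\<close>, which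
  mathematically is infinite, is left unspecified and never used.
\<close>


section \<open>Valuations and local fields\<close>

definition is_valuation :: "('f::field \<Rightarrow> real) \<Rightarrow> bool" where
  "is_valuation v \<longleftrightarrow>
     (\<forall>x y. x \<noteq> 0 \<longrightarrow> y \<noteq> 0 \<longrightarrow> v (x * y) = v x + v y) \<and>
     (\<forall>x y. x \<noteq> 0 \<longrightarrow> y \<noteq> 0 \<longrightarrow> x + y \<noteq> 0 \<longrightarrow> min (v x) (v y) \<le> v (x + y))"

definition val_ring :: "('f::field \<Rightarrow> real) \<Rightarrow> 'f set" where
  "val_ring v = {x. x = 0 \<or> v x \<ge> 0}"

definition val_max_ideal :: "('f::field \<Rightarrow> real) \<Rightarrow> 'f set" where
  "val_max_ideal v = {x. x = 0 \<or> v x > 0}"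

definition residue_field :: "('f::field \<Rightarrow> real) \<Rightarrow> 'f set set" where
  "residue_field v =
     val_ring v // {(x, y). x \<in> val_ring v \<and> y \<in> val_ring v \<and> x - y \<in> val_max_ideal v}"

definition val_Cauchy :: "('f::field \<Rightarrow> real) \<Rightarrow> (nat \<Rightarrow> 'f) \<Rightarrow> bool" where
  "val_Cauchy v s \<longleftrightarrow>
     (\<forall>C. \<exists>N. \<forall>m\<ge>N. \<forall>n\<ge>N. s m = s n \<or> v (s m - s n) \<ge> C)"

definition val_converges :: "('f::field \<Rightarrow> real) \<Rightarrow> (nat \<Rightarrow> 'f) \<Rightarrow> 'f \<Rightarrow> bool" where
  "val_converges v s l \<longleftrightarrow> (\<forall>C. \<exists>N. \<forall>n\<ge>N. s n = l \<or> v (s n - l) \<ge> C)"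

text \<open>The discrete valuation is taken normalized, i.e. with value group \<open>\<int>\<close>.\<close>

definition local_field :: "('f::field \<Rightarrow> real) \<Rightarrow> bool" where
  "local_field v \<longleftrightarrow>
     is_valuation v \<and> v ` (UNIV - {0}) = \<int> \<and>
     (\<forall>s. val_Cauchy v s \<longrightarrow> (\<exists>l. val_converges v s l))"


section \<open>Separable closures, subextensions and embeddings\<close>

definition field_hom_on :: "'a::field set \<Rightarrow> ('a \<Rightarrow> 'b::field) \<Rightarrow> bool" where
  "field_hom_on L \<sigma> \<longleftrightarrow>
     \<sigma> 1 = 1 \<and>
     (\<forall>x\<in>L. \<forall>y\<in>L. \<sigma> (x + y) = \<sigma> x + \<sigma> y \<and> \<sigma> (x * y) = \<sigma> x * \<sigma> y)"

definition separable_poly :: "'f::field poly \<Rightarrow> bool" where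
  "separable_poly f \<longleftrightarrow> coprime f (pderiv f)"

definition separable_closure :: "('k::field \<Rightarrow> 'a::field) \<Rightarrow> bool" where
  "separable_closure \<iota> \<longleftrightarrow>
     field_hom_on UNIV \<iota> \<and>
     (\<forall>x. \<exists>f. irreducible f \<and> separable_poly f \<and> poly (map_poly \<iota> f) x = 0) \<and>
     (\<forall>f :: 'a poly. degree f > 0 \<longrightarrow> separable_poly f \<longrightarrow> (\<exists>x. poly f x = 0))"

definition is_subfield :: "'a::field set \<Rightarrow> bool" where
  "is_subfield L \<longleftrightarrow>
     0 \<in> L \<and> 1 \<in> L \<and>
     (\<forall>x\<in>L. \<forall>y\<in>L. x + y \<in> L \<and> x * y \<in> L) \<and>
     (\<forall>x\<in>L. - x \<in> L \<and> inverse x \<in> L)"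

definition subextension :: "('k::field \<Rightarrow> 'a::field) \<Rightarrow> 'a set \<Rightarrow> bool" where
  "subextension \<iota> L \<longleftrightarrow> is_subfield L \<and> range \<iota> \<subseteq> L"

text \<open>As for \<^const>\<open>vector_space.dim\<close> in general, the degree of an infinite extension is \<open>0\<close>.\<close>

definition ext_degree :: "('k::field \<Rightarrow> 'a::field) \<Rightarrow> 'a set \<Rightarrow> nat" where
  "ext_degree \<iota> L = vector_space.dim (\<lambda>c x. \<iota> c * x) L"

text \<open>An embedding of \<open>L\<close> is a total function of which only the values on \<open>L\<close> matter.\<close>

definition K_embedding :: "('k::field \<Rightarrow> 'a::field) \<Rightarrow> 'a set \<Rightarrow> ('a \<Rightarrow> 'a) \<Rightarrow> bool" where
  "K_embedding \<iota> L \<sigma> \<longleftrightarrow> field_hom_on L \<sigma> \<and> (\<forall>c. \<sigma> (\<iota> c) = \<iota> c)"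

text \<open>An algebraic extension is Galois if \<open>K\<close> is the fixed field of its \<open>K\<close>-automorphisms.\<close>

definition galois_ext :: "('k::field \<Rightarrow> 'a::field) \<Rightarrow> 'a set \<Rightarrow> bool" where
  "galois_ext \<iota> L \<longleftrightarrow>
     {x \<in> L. \<forall>\<sigma>. K_embedding \<iota> L \<sigma> \<and> \<sigma> ` L = L \<longrightarrow> \<sigma> x = x} = range \<iota>"


section \<open>Ramification\<close>

text \<open>
  \<open>\<nu>\<close> is the valuation \<open>\<nu>\<^sub>L\<close> of \<open>K\<^sub>s\<close>: it extends the valuation of \<open>K\<close> up to scaling, and it
  is normalized so that its value group on \<open>L\<close> is \<open>\<int>\<close>.
\<close>

definition normalized_valuation ::
  "('k::field \<Rightarrow> 'a::field) \<Rightarrow> ('k \<Rightarrow> real) \<Rightarrow> 'a set \<Rightarrow> ('a \<Rightarrow> real) \<Rightarrow> bool" where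
  "normalized_valuation \<iota> v L \<nu> \<longleftrightarrow>
     is_valuation \<nu> \<and>
     (\<exists>c>0. \<forall>x. x \<noteq> 0 \<longrightarrow> \<nu> (\<iota> x) = c * v x) \<and>
     \<nu> ` (L - {0}) = \<int>"

text \<open>
  The ramification index \<open>(\<nu>\<^sub>L(L\<^sup>\<times>) : \<nu>\<^sub>L(K\<^sup>\<times>))\<close> equals the degree \<open>n = [L : K]\<close>,
  i.e. \<open>\<nu>\<^sub>L(K\<^sup>\<times>) = n\<int>\<close>.
\<close>

definition totally_ramified ::
  "('k::field \<Rightarrow> 'a::field) \<Rightarrow> ('k \<Rightarrow> real) \<Rightarrow> 'a set \<Rightarrow> bool" where
  "totally_ramified \<iota> v L \<longleftrightarrow>
     (\<exists>\<nu>. normalized_valuation \<iota> v L \<nu> \<and>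
          \<nu> ` (range \<iota> - {0}) = (\<lambda>z. real (ext_degree \<iota> L) * z) ` \<int>)"

definition prime_element :: "'a::field set \<Rightarrow> ('a \<Rightarrow> real) \<Rightarrow> 'a \<Rightarrow> bool" where
  "prime_element L \<nu> \<pi> \<longleftrightarrow> \<pi> \<in> L \<and> \<pi> \<noteq> 0 \<and> \<nu> \<pi> = 1"

definition ramification_number :: "('a::field \<Rightarrow> real) \<Rightarrow> 'a \<Rightarrow> ('a \<Rightarrow> 'a) \<Rightarrow> real" where
  "ramification_number \<nu> \<pi> \<sigma> = \<nu> (\<sigma> \<pi> - \<pi>) - 1"

text \<open>All ramification numbers coincide, and \<open>b\<close> is their common value.\<close>

definition has_ramification_break ::
  "('k::field \<Rightarrow> 'a::field) \<Rightarrow> ('k \<Rightarrow> real) \<Rightarrow> 'a set \<Rightarrow> real \<Rightarrow> bool" where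
  "has_ramification_break \<iota> v L b \<longleftrightarrow>
     (\<exists>\<nu>. normalized_valuation \<iota> v L \<nu> \<and>
        {ramification_number \<nu> \<pi> \<sigma> | \<pi> \<sigma>.
           prime_element L \<nu> \<pi> \<and> K_embedding \<iota> L \<sigma> \<and> (\<exists>x\<in>L. \<sigma> x \<noteq> x)} = {b})"

definition ramified_exts ::
  "('k::field \<Rightarrow> 'a::field) \<Rightarrow> ('k \<Rightarrow> real) \<Rightarrow> nat \<Rightarrow> real \<Rightarrow> 'a set set" where
  "ramified_exts \<iota> v p b =
     {L. subextension \<iota> L \<and> ext_degree \<iota> L = p \<and> totally_ramified \<iota> v L \<and>
         has_ramification_break \<iota> v L b}"


section \<open>Isomorphism classes over the residue field\<close>

text \<open>
  The last condition says that the automorphism of \<open>K\<close> given by \<open>\<sigma>\<close> induces the identity on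
  the residue field of \<open>K\<close>; it entails that valuation ring and maximal ideal are preserved.
\<close>

definition k_isomorphic ::
  "('k::field \<Rightarrow> 'a::field) \<Rightarrow> ('k \<Rightarrow> real) \<Rightarrow> 'a set \<Rightarrow> 'a set \<Rightarrow> bool" where
  "k_isomorphic \<iota> v L1 L2 \<longleftrightarrow>
     (\<exists>\<sigma>. field_hom_on L1 \<sigma> \<and> bij_betw \<sigma> L1 L2 \<and> \<sigma> ` range \<iota> = range \<iota> \<and>
          (\<forall>x\<in>val_ring v. \<exists>y. \<sigma> (\<iota> x) = \<iota> y \<and> y - x \<in> val_max_ideal v))"

definition k_iso_classes ::
  "('k::field \<Rightarrow> 'a::field) \<Rightarrow> ('k \<Rightarrow> real) \<Rightarrow> 'a set set \<Rightarrow> 'a set set set" where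
  "k_iso_classes \<iota> v E = E // {(L1, L2). L1 \<in> E \<and> L2 \<in> E \<and> k_isomorphic \<iota> v L1 L2}"

definition S_all ::
  "('k::field \<Rightarrow> 'a::field) \<Rightarrow> ('k \<Rightarrow> real) \<Rightarrow> nat \<Rightarrow> real \<Rightarrow> 'a set set set" where
  "S_all \<iota> v p b = k_iso_classes \<iota> v (ramified_exts \<iota> v p b)"

definition S_galois ::
  "('k::field \<Rightarrow> 'a::field) \<Rightarrow> ('k \<Rightarrow> real) \<Rightarrow> nat \<Rightarrow> real \<Rightarrow> 'a set set set" where
  "S_galois \<iota> v p b = k_iso_classes \<iota> v {L \<in> ramified_exts \<iota> v p b. galois_ext \<iota> L}"

definition S_nongalois ::
  "('k::field \<Rightarrow> 'a::field) \<Rightarrow> ('k \<Rightarrow> real) \<Rightarrow> nat \<Rightarrow> real \<Rightarrow> 'a set set set" where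
  "S_nongalois \<iota> v p b = k_iso_classes \<iota> v {L \<in> ramified_exts \<iota> v p b. \<not> galois_ext \<iota> L}"

end

theory Submission
  imports Defs
begin

text \<open>
  Let \<open>m = (p - 1) b\<close>.  If \<open>\<pi>\<close> is a prime element of \<open>L\<close> with Eisenstein polynomial \<open>f\<close> and
  \<open>y = \<sigma> \<pi> - \<pi>\<close> for a nontrivial embedding \<open>\<sigma>\<close>, then \<open>y\<^bsup>p - 1\<^esup>\<close> has the same leading term as
  \<open>- f' \<pi>\<close>, and the values of the terms of \<open>f' \<pi>\<close> are distinct.  Hence the break is \<open>b\<close> iff
  one particular coefficient of \<open>f\<close> dominates, and the residue \<open>w\<close> of
  \<open>y\<^bsup>p - 1\<^esup> / \<pi>\<^bsup>m + p - 1\<^esup>\<close> can be read off \<open>f\<close>.  A change of \<open>\<pi>\<close> multiplies \<open>w\<close> by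
  an \<open>m\<close>-th power.  Successive approximation brings every extension with invariant \<open>w\<close> into a
  normal form that depends on \<open>w\<close> and on a uniformizer of \<open>K\<close> only, and automorphisms of
  \<open>K = k((t))\<close> permute the uniformizers.  So the classes correspond to the cosets of the \<open>m\<close>-th
  powers in the multiplicative group of \<open>k\<close>.  If \<open>b\<close> is an integer, \<open>L\<close> is Galois iff
  \<open>w\<close> is a \<open>(p - 1)\<close>-st power: then Newton's method finds the conjugates
  \<open>\<pi> + c \<pi>\<^bsup>b + 1\<^esup> + \<dots>\<close> with \<open>c\<^bsup>p - 1\<^esup> = w\<close> in \<open>L\<close>.
\<close>

section \<open>Valuations\<close>

text \<open>The distinctness of values is arithmetic modulo p: a nonzero term a_j \<pi>^j with a_j
  in K and j < p has value congruent to j. Since p does not divide m, the term that decides the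
  break sits at an index between 1 and p - 1, so it survives in the derivative. In characteristic p
  the p-th power map is additive, so y^p appears alone when the equations of two conjugates are
  subtracted. The definitions ask only for some valuation of K_s. For a given L any choice works,
  because the Eisenstein equation forces the value of \<pi> and thereby all values on L. To produce
  an L for every residue w, however, an actual valuation of K_s is needed; it is built with Zorn's
  lemma. The numbers are indices in a group of order q - 1, where the m-th powers have index gcd(q -
  1, m). As p - 1 divides q - 1, for m = (p - 1) b with b integral this index is (p - 1) g with g =
  gcd((q - 1)/(p - 1), b). The (p - 1)-st powers make up g of the cosets, and the other (p - 2) g
  are the non-Galois classes.\<close>

text \<open>The value at \<open>0\<close> counts as infinite.\<close>

definition vge :: "('f::field \<Rightarrow> real) \<Rightarrow> real \<Rightarrow> 'f \<Rightarrow> bool" where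
  "vge \<nu> r x \<longleftrightarrow> x = 0 \<or> r \<le> \<nu> x"

definition vgt :: "('f::field \<Rightarrow> real) \<Rightarrow> real \<Rightarrow> 'f \<Rightarrow> bool" where
  "vgt \<nu> r x \<longleftrightarrow> x = 0 \<or> r < \<nu> x"

text \<open>Says that x / y is congruent to 1 modulo the maximal ideal. Leading terms are compared
  through this relation instead of in a residue field of K_s.\<close>

definition same_lead :: "('f::field \<Rightarrow> real) \<Rightarrow> 'f \<Rightarrow> 'f \<Rightarrow> bool" where
  "same_lead \<nu> x y \<longleftrightarrow> x \<noteq> 0 \<and> y \<noteq> 0 \<and> vgt \<nu> (\<nu> x) (x - y)"

lemma vge_0 [simp]: "vge \<nu> r 0" and vgt_0 [simp]: "vgt \<nu> r 0"
  by (auto simp: vge_def vgt_def)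

lemma vge_mono: "vge \<nu> r x \<Longrightarrow> s \<le> r \<Longrightarrow> vge \<nu> s x"
  and vgt_mono: "vgt \<nu> r x \<Longrightarrow> s \<le> r \<Longrightarrow> vgt \<nu> s x"
  and vgt_imp_vge: "vgt \<nu> r x \<Longrightarrow> vge \<nu> r x"
  and vge_imp_vgt: "vge \<nu> r x \<Longrightarrow> s < r \<Longrightarrow> vgt \<nu> s x"
  by (auto simp: vge_def vgt_def)

lemma vge_val [simp]: "vge \<nu> (\<nu> x) x"
  by (simp add: vge_def)

locale valuation =
  fixes \<nu> :: "'f::field \<Rightarrow> real"
  assumes valuation: "is_valuation \<nu>"
begin

lemma val_mult: "x \<noteq> 0 \<Longrightarrow> y \<noteq> 0 \<Longrightarrow> \<nu> (x * y) = \<nu> x + \<nu> y"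
  using valuation by (simp add: is_valuation_def)

lemma val_add: "x \<noteq> 0 \<Longrightarrow> y \<noteq> 0 \<Longrightarrow> x + y \<noteq> 0 \<Longrightarrow> min (\<nu> x) (\<nu> y) \<le> \<nu> (x + y)"
  using valuation by (simp add: is_valuation_def)

lemma val_1 [simp]: "\<nu> 1 = 0"
  using val_mult[of 1 1] by simp

lemma val_minus_1 [simp]: "\<nu> (-1) = 0"
  using val_mult[of "-1" "-1"] by simp

lemma val_minus [simp]: "\<nu> (- x) = \<nu> x"
proof (cases "x = 0")
  case False
  then show ?thesis using val_mult[of "-1" x] by simp
qed simp

lemma val_power: "x \<noteq> 0 \<Longrightarrow> \<nu> (x ^ n) = real n * \<nu> x"
  by (induction n) (auto simp: val_mult algebra_simps)

lemma val_inverse: "x \<noteq> 0 \<Longrightarrow> \<nu> (inverse x) = - \<nu> x"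
  using val_mult[of x "inverse x"] by simp

lemma val_divide: "x \<noteq> 0 \<Longrightarrow> y \<noteq> 0 \<Longrightarrow> \<nu> (x / y) = \<nu> x - \<nu> y"
  by (simp add: divide_inverse val_mult val_inverse)

lemma vge_minus [simp]: "vge \<nu> r (- x) \<longleftrightarrow> vge \<nu> r x"
  and vgt_minus [simp]: "vgt \<nu> r (- x) \<longleftrightarrow> vgt \<nu> r x"
  by (auto simp: vge_def vgt_def)

lemma vge_add: "vge \<nu> r x \<Longrightarrow> vge \<nu> r y \<Longrightarrow> vge \<nu> r (x + y)"
  and vgt_add: "vgt \<nu> r x \<Longrightarrow> vgt \<nu> r y \<Longrightarrow> vgt \<nu> r (x + y)"
  using val_add[of x y] by (cases "x = 0"; cases "y = 0"; force simp: vge_def vgt_def)+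

lemma vge_diff: "vge \<nu> r x \<Longrightarrow> vge \<nu> r y \<Longrightarrow> vge \<nu> r (x - y)"
  and vgt_diff: "vgt \<nu> r x \<Longrightarrow> vgt \<nu> r y \<Longrightarrow> vgt \<nu> r (x - y)"
  using vge_add[of r x "- y"] vgt_add[of r x "- y"] by simp_all

lemma vge_diff_commute: "vge \<nu> r (x - y) \<longleftrightarrow> vge \<nu> r (y - x)"
  and vgt_diff_commute: "vgt \<nu> r (x - y) \<longleftrightarrow> vgt \<nu> r (y - x)"
  using vge_minus[of r "x - y"] vgt_minus[of r "x - y"] by simp_all

lemma vge_sum: "(\<And>i. i \<in> A \<Longrightarrow> vge \<nu> r (f i)) \<Longrightarrow> vge \<nu> r (sum f A)"
  by (induction A rule: infinite_finite_induct) (auto intro: vge_add)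

lemma vgt_sum: "(\<And>i. i \<in> A \<Longrightarrow> vgt \<nu> r (f i)) \<Longrightarrow> vgt \<nu> r (sum f A)"
  by (induction A rule: infinite_finite_induct) (auto intro: vgt_add)

lemma vge_mult: "vge \<nu> r x \<Longrightarrow> vge \<nu> s y \<Longrightarrow> vge \<nu> (r + s) (x * y)"
  and vgt_vge_mult: "vgt \<nu> r x \<Longrightarrow> vge \<nu> s y \<Longrightarrow> vgt \<nu> (r + s) (x * y)"
  and vge_vgt_mult: "vge \<nu> r x \<Longrightarrow> vgt \<nu> s y \<Longrightarrow> vgt \<nu> (r + s) (x * y)"
  by (cases "x = 0"; cases "y = 0"; simp add: vge_def vgt_def val_mult)+

lemma vge_power: "vge \<nu> r x \<Longrightarrow> vge \<nu> (real n * r) (x ^ n)"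
  by (cases "x = 0"; cases n) (auto simp: vge_def val_power mult_left_mono simp del: power_Suc)

lemma vge_power_0: "vge \<nu> 0 x \<Longrightarrow> vge \<nu> 0 (x ^ n)"
  using vge_power[of 0 x n] by simp

lemma vge_mult_0: "vge \<nu> 0 x \<Longrightarrow> vge \<nu> r y \<Longrightarrow> vge \<nu> r (x * y)"
  and vge_mult_0_right: "vge \<nu> r x \<Longrightarrow> vge \<nu> 0 y \<Longrightarrow> vge \<nu> r (x * y)"
  using vge_mult[of 0 x r y] vge_mult[of r x 0 y] by simp_all

lemma vge_divide: "y \<noteq> 0 \<Longrightarrow> vge \<nu> r (x / y) \<longleftrightarrow> vge \<nu> (r + \<nu> y) x"
  and vgt_divide: "y \<noteq> 0 \<Longrightarrow> vgt \<nu> r (x / y) \<longleftrightarrow> vgt \<nu> (r + \<nu> y) x"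
  by (cases "x = 0"; auto simp: vge_def vgt_def val_divide)+

lemma val_add_eq: "x \<noteq> 0 \<Longrightarrow> vgt \<nu> (\<nu> x) y \<Longrightarrow> x + y \<noteq> 0 \<and> \<nu> (x + y) = \<nu> x"
proof -
  assume x: "x \<noteq> 0" and y: "vgt \<nu> (\<nu> x) y"
  show ?thesis
  proof (cases "y = 0")
    case False
    then have lt: "\<nu> x < \<nu> y" using y by (simp add: vgt_def)
    have nz: "x + y \<noteq> 0"
    proof
      assume "x + y = 0"
      then have "y = - x" by (simp add: eq_neg_iff_add_eq_0 add.commute)
      then show False using lt by simp
    qed
    have "min (\<nu> (x + y)) (\<nu> (- y)) \<le> \<nu> (x + y + - y)"
      using nz False x by (intro val_add) auto
    moreover have "min (\<nu> x) (\<nu> y) \<le> \<nu> (x + y)"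
      using nz False x by (intro val_add) auto
    ultimately show ?thesis using lt nz by (simp add: min_def split: if_splits)
  qed (use x in simp)
qed

lemma same_lead_refl: "x \<noteq> 0 \<Longrightarrow> same_lead \<nu> x x"
  by (simp add: same_lead_def)

lemma same_lead_val: "same_lead \<nu> x y \<Longrightarrow> \<nu> y = \<nu> x"
  using val_add_eq[of x "y - x"] by (auto simp: same_lead_def vgt_diff_commute)

lemma same_lead_sym: "same_lead \<nu> x y \<Longrightarrow> same_lead \<nu> y x"
  using same_lead_val[of x y] by (auto simp: same_lead_def vgt_diff_commute)

lemma same_lead_trans: "same_lead \<nu> x y \<Longrightarrow> same_lead \<nu> y z \<Longrightarrow> same_lead \<nu> x z"
  using same_lead_val[of x y] vgt_add[of "\<nu> x" "x - y" "y - z"] by (auto simp: same_lead_def)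

lemma same_lead_mult:
  assumes "same_lead \<nu> x y" "same_lead \<nu> z w"
  shows "same_lead \<nu> (x * z) (y * w)"
proof -
  have "x * z - y * w = (x - y) * z + y * (z - w)" by (simp add: algebra_simps)
  moreover have "vgt \<nu> (\<nu> x + \<nu> z) ((x - y) * z)"
    using assms by (intro vgt_vge_mult) (auto simp: same_lead_def)
  moreover have "vgt \<nu> (\<nu> x + \<nu> z) (y * (z - w))"
    using assms same_lead_val[OF assms(1)]
    by (intro vge_vgt_mult) (auto simp: same_lead_def vge_def)
  ultimately show ?thesis
    using assms by (auto simp: same_lead_def val_mult intro: vgt_add)
qed

lemma same_lead_inverse:
  assumes "same_lead \<nu> x y"
  shows "same_lead \<nu> (inverse x) (inverse y)"
proof -
  have nz: "x \<noteq> 0" "y \<noteq> 0" using assms by (auto simp: same_lead_def)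
  have "same_lead \<nu> (x * (inverse x * inverse y)) (y * (inverse x * inverse y))"
    using assms nz by (intro same_lead_mult same_lead_refl) auto
  then have "same_lead \<nu> (inverse y) (inverse x)" using nz by (simp add: field_simps)
  then show ?thesis by (rule same_lead_sym)
qed

lemma same_lead_divide:
  "same_lead \<nu> x y \<Longrightarrow> same_lead \<nu> z w \<Longrightarrow> same_lead \<nu> (x / z) (y / w)"
  by (simp add: divide_inverse same_lead_mult same_lead_inverse)

lemma same_lead_power: "same_lead \<nu> x y \<Longrightarrow> same_lead \<nu> (x ^ n) (y ^ n)"
  by (induction n) (auto intro: same_lead_mult same_lead_refl)

lemma same_lead_minus: "same_lead \<nu> x y \<Longrightarrow> same_lead \<nu> (- x) (- y)"
  using same_lead_mult[of x y "-1" "-1"] same_lead_refl[of "-1"] by simp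

lemma same_lead_add: "x \<noteq> 0 \<Longrightarrow> vgt \<nu> (\<nu> x) e \<Longrightarrow> same_lead \<nu> (x + e) x"
  using val_add_eq[of x e] by (auto simp: same_lead_def)

lemma same_lead_add_left:
  assumes "same_lead \<nu> x y" "vgt \<nu> (\<nu> x) e"
  shows "same_lead \<nu> (x + e) y"
  using assms same_lead_trans same_lead_add by (metis same_lead_def)

lemma same_lead_iff: "\<nu> x = r \<Longrightarrow> x \<noteq> 0 \<Longrightarrow> vgt \<nu> r (x - y) \<Longrightarrow> same_lead \<nu> x y"
  using val_add_eq[of x "y - x"] by (auto simp: same_lead_def vgt_diff_commute)

text \<open>Terms of distinct values cannot cancel, so the unique term of least value is the leading
  term of the sum. Zero terms have no value and are exempt from the injectivity condition.\<close>

lemma sum_distinct_values: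
  assumes "finite A" "i0 \<in> A" "f i0 \<noteq> 0"
    and inj: "\<And>i j. i \<in> A \<Longrightarrow> j \<in> A \<Longrightarrow> f i \<noteq> 0 \<Longrightarrow> f j \<noteq> 0 \<Longrightarrow> \<nu> (f i) = \<nu> (f j) \<Longrightarrow> i = j"
  shows "\<exists>i\<in>A. same_lead \<nu> (sum f A) (f i) \<and> (\<forall>j\<in>A. vge \<nu> (\<nu> (f i)) (f j)) \<and>
            (\<forall>j\<in>A - {i}. vgt \<nu> (\<nu> (f i)) (f j))"
proof -
  define B where "B = {i \<in> A. f i \<noteq> 0}"
  have B: "finite B" "B \<noteq> {}" using assms by (auto simp: B_def)
  then obtain i where i: "i \<in> B" and "\<forall>j\<in>B. \<not> \<nu> (f j) < \<nu> (f i)"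
    using ex_min_if_finite[of "(\<lambda>i. \<nu> (f i)) ` B"] by auto
  then have min: "\<And>j. j \<in> B \<Longrightarrow> \<nu> (f i) \<le> \<nu> (f j)" by force
  have gt: "vgt \<nu> (\<nu> (f i)) (f j)" if "j \<in> A - {i}" for j
  proof (cases "f j = 0")
    case False
    then have "j \<in> B" using that by (auto simp: B_def)
    then show ?thesis using min[of j] inj[of i j] that i False by (force simp: vgt_def B_def)
  qed simp
  have "sum f A = f i + sum f (A - {i})"
    using i assms(1) by (intro sum.remove) (auto simp: B_def)
  then have "same_lead \<nu> (sum f A) (f i)"
    using i gt by (auto intro!: same_lead_add vgt_sum simp: B_def)
  moreover have "vge \<nu> (\<nu> (f i)) (f j)" if "j \<in> A" for j
    using gt[of j] that by (cases "j = i") (auto intro: vgt_imp_vge)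
  ultimately show ?thesis using i gt by (auto simp: B_def)
qed

lemma diff_power_factor:
  "(x::'f) ^ n - y ^ n = (x - y) * (\<Sum>l<n. x ^ l * y ^ (n - Suc l))"
  by (simp add: power_diff_sumr2 mult.commute)

text \<open>Binomial coefficients are avoided: the difference of the n-th powers is d times a sum of
  n products, and each product has leading term x^(n - 1).\<close>

lemma vgt_power_diff_first_order:
  assumes x: "x \<noteq> 0" and d: "d \<noteq> 0" "\<nu> d > \<nu> x"
  shows "vgt \<nu> ((real n - 1) * \<nu> x + \<nu> d) ((x + d) ^ n - x ^ n - of_nat n * x ^ (n - 1) * d)"
proof -
  have lead: "same_lead \<nu> (x + d) x"
    using x d by (intro same_lead_add) (auto simp: vgt_def)
  have "(x + d) ^ n - x ^ n - of_nat n * x ^ (n - 1) * d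
      = (\<Sum>l<n. (x + d) ^ l * x ^ (n - Suc l) - x ^ l * x ^ (n - Suc l)) * d"
  proof -
    have "(\<Sum>l<n. x ^ l * x ^ (n - Suc l)) = (\<Sum>l<n. x ^ (n - 1))"
      by (intro sum.cong) (auto simp flip: power_add)
    then show ?thesis
      using diff_power_factor[of "x + d" n x] by (simp add: sum_subtractf algebra_simps)
  qed
  moreover have "vgt \<nu> ((real n - 1) * \<nu> x) ((x + d) ^ l * x ^ (n - Suc l) - x ^ l * x ^ (n - Suc l))"
    if "l < n" for l
  proof -
    have "same_lead \<nu> (x ^ l * x ^ (n - Suc l)) ((x + d) ^ l * x ^ (n - Suc l))"
      using x by (intro same_lead_mult same_lead_power same_lead_refl same_lead_sym[OF lead]) auto
    moreover have "\<nu> (x ^ l * x ^ (n - Suc l)) = (real n - 1) * \<nu> x"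
      using that x by (simp add: val_power of_nat_diff flip: power_add)
    ultimately show ?thesis
      by (metis same_lead_def vgt_diff_commute)
  qed
  ultimately show ?thesis
    by (auto intro!: vgt_vge_mult vgt_sum)
qed

lemma vge_power_diff:
  assumes "vge \<nu> r x" "vge \<nu> r y" "vge \<nu> s (x - y)"
  shows "vge \<nu> ((real n - 1) * r + s) (x ^ n - y ^ n)"
proof (cases "n = 0")
  case False
  have "vge \<nu> ((real n - 1) * r) (x ^ l * y ^ (n - Suc l))" if "l < n" for l
  proof -
    have "vge \<nu> (real l * r + real (n - Suc l) * r) (x ^ l * y ^ (n - Suc l))"
      by (intro vge_mult vge_power assms)
    moreover have "real l * r + real (n - Suc l) * r = (real n - 1) * r"
      using that by (simp add: of_nat_diff algebra_simps)
    ultimately show ?thesis by simp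
  qed
  then have "vge \<nu> (s + (real n - 1) * r) ((x - y) * (\<Sum>l<n. x ^ l * y ^ (n - Suc l)))"
    by (intro vge_mult assms vge_sum) auto
  then show ?thesis by (simp add: diff_power_factor add.commute)
qed simp

end

section \<open>Local fields of characteristic p\<close>

text \<open>Tests only sequences that converge at a fixed rate, which is how successive
  approximation produces them, and returns the limit with the same rate. The set \<open>L\<close>
  makes the notion applicable to a subfield of K_s.\<close>

definition val_complete :: "('f::field \<Rightarrow> real) \<Rightarrow> 'f set \<Rightarrow> bool" where
  "val_complete \<nu> L \<longleftrightarrow>
     (\<forall>s :: nat \<Rightarrow> 'f. (\<forall>n. s n \<in> L \<and> vge \<nu> (real n) (s (Suc n) - s n)) \<longrightarrow>
        (\<exists>l\<in>L. \<forall>n. vge \<nu> (real n) (s n - l)))"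

context valuation
begin

lemma vge_telescope:
  assumes "\<And>n. n \<ge> N \<Longrightarrow> vge \<nu> c (s (Suc n) - s n)" "m \<ge> N"
  shows "vge \<nu> c (s m - s N)"
  using assms(2)
proof (induction m rule: dec_induct)
  case (step m)
  then have "vge \<nu> c ((s (Suc m) - s m) + (s m - s N))"
    using assms by (intro vge_add) auto
  then show ?case by simp
qed simp

text \<open>Keeps track of the starting point of an approximation: the limit inherits the leading
  term of \<open>s 0\<close> when all steps are small enough.\<close>

lemma vge_limit:
  assumes "\<And>n. vge \<nu> c (s (Suc n) - s n)" "\<And>n. vge \<nu> (real n) (s n - l)"
  shows "vge \<nu> c (s 0 - l)"
proof -
  obtain n :: nat where n: "real n \<ge> c" using real_arch_simple by blast
  have "vge \<nu> c (s n - s 0)" by (rule vge_telescope[where s = s]) (use assms(1) in simp_all)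
  moreover have "vge \<nu> c (s n - l)" using assms(2)[of n] n by (rule vge_mono)
  ultimately have "vge \<nu> c ((s n - l) - (s n - s 0))" by (rule vge_diff[rotated])
  then show ?thesis by simp
qed

lemma zero_if_vge_all:
  assumes "\<And>n::nat. vge \<nu> (real n) x" shows "x = 0"
proof -
  obtain n :: nat where "\<nu> x < real n" using reals_Archimedean2 by blast
  then show ?thesis using assms[of n] by (simp add: vge_def)
qed

end

locale char_p_local_field = valuation v for v :: "'k::field \<Rightarrow> real" +
  fixes p :: nat
  assumes prime_p: "prime p"
    and local_field: "local_field v"
    and char_p: "CHAR('k) = p"
    and finite_residue_field: "finite (residue_field v)"
begin

lemma valuation_v: "valuation v"
  by (rule valuation_axioms)

lemma p_gt_1: "p > 1" and p_ge_2: "p \<ge> 2" and p_pos: "p > 0"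
  using prime_p prime_gt_1_nat[of p] by auto

lemma val_in_Ints: "x \<noteq> 0 \<Longrightarrow> v x \<in> \<int>"
  using local_field by (auto simp: local_field_def)

lemma uniformizer_exists: "\<exists>t. t \<noteq> 0 \<and> v t = 1"
proof -
  have "1 \<in> v ` (UNIV - {0})" using local_field by (simp add: local_field_def)
  then show ?thesis by force
qed

lemma vgt_int: "vgt v (of_int z) x \<longleftrightarrow> vge v (of_int z + 1) x"
  using val_in_Ints[of x] by (cases "x = 0") (auto simp: vge_def vgt_def elim!: Ints_cases)

lemma vgt_0_iff: "vgt v 0 x \<longleftrightarrow> vge v 1 x"
  using vgt_int[of 0 x] by simp

lemma complete: "val_complete v UNIV"
  unfolding val_complete_def
proof (intro allI impI)
  fix s :: "nat \<Rightarrow> 'k"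
  assume "\<forall>n. s n \<in> UNIV \<and> vge v (real n) (s (Suc n) - s n)"
  then have s: "vge v (real n) (s (Suc n) - s n)" for n by simp
  have tele: "vge v (real N) (s m - s N)" if "m \<ge> N" for m N
    by (rule vge_telescope[where s = s]) (use that vge_mono[OF s] in simp_all)
  have "val_Cauchy v s"
    unfolding val_Cauchy_def
  proof
    fix C
    obtain N :: nat where N: "real N \<ge> C" using real_arch_simple by blast
    have "s m = s n \<or> v (s m - s n) \<ge> C" if "m \<ge> N" "n \<ge> N" for m n
    proof -
      have "vge v (real N) ((s m - s N) - (s n - s N))" using that by (intro vge_diff tele)
      then show ?thesis using N by (auto simp: vge_def)
    qed
    then show "\<exists>N. \<forall>m\<ge>N. \<forall>n\<ge>N. s m = s n \<or> v (s m - s n) \<ge> C" by blast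
  qed
  then obtain l where l: "val_converges v s l" using local_field by (auto simp: local_field_def)
  have "vge v (real n) (s n - l)" for n
  proof -
    obtain N where N: "\<And>m. m \<ge> N \<Longrightarrow> vge v (real n) (s m - l)"
      using l[unfolded val_converges_def, rule_format, of "real n"] by (auto simp: vge_def)
    have "vge v (real n) ((s (max n N) - l) - (s (max n N) - s n))"
      by (rule vge_diff[OF N tele]) simp_all
    then show ?thesis by simp
  qed
  then show "\<exists>l\<in>UNIV. \<forall>n. vge v (real n) (s n - l)" by blast
qed

lemma frobenius_add: "((x::'k) + y) ^ (p ^ k) = x ^ (p ^ k) + y ^ (p ^ k)"
  using freshmans_dream'[of "p ^ k" k x y] prime_p by (simp add: char_p)

lemma frobenius_minus: "(- (x::'k)) ^ (p ^ k) = - (x ^ (p ^ k))"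
proof -
  have "x ^ (p ^ k) + (- x) ^ (p ^ k) = 0"
    using frobenius_add[of x "- x" k] p_pos by (simp add: power_0_left)
  then show ?thesis by (simp add: eq_neg_iff_add_eq_0 add.commute)
qed

lemma frobenius_diff: "((x::'k) - y) ^ (p ^ k) = x ^ (p ^ k) - y ^ (p ^ k)"
  using frobenius_add[of x "- y" k] by (simp add: frobenius_minus)

text \<open>
  The coefficient field (the Teichmueller representatives), described as the algebraic closure
  of the prime field in \<open>K\<close>.
\<close>

definition T :: "'k set" where
  "T = {x. \<exists>k>0. x ^ (p ^ k) = x}"

lemma T_iterate: "(x::'k) ^ (p ^ k) = x \<Longrightarrow> x ^ (p ^ (k * j)) = x"
  by (induction j) (simp_all add: power_add power_mult)

text \<open>With a common exponent both elements are fixed by one power of Frobenius, which is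
  additive and multiplicative. This makes \<open>T\<close> a field.\<close>

lemma T_common:
  assumes "x \<in> T" "y \<in> T"
  shows "\<exists>k>0. x ^ (p ^ k) = x \<and> y ^ (p ^ k) = y"
proof -
  obtain i j where "i > 0" "j > 0" "x ^ (p ^ i) = x" "y ^ (p ^ j) = y"
    using assms by (auto simp: T_def)
  then have "x ^ (p ^ (i * j)) = x" "y ^ (p ^ (i * j)) = y"
    using T_iterate[of x i j] T_iterate[of y j i] by (simp_all add: mult.commute)
  then show ?thesis using \<open>i > 0\<close> \<open>j > 0\<close> by (intro exI[of _ "i * j"]) simp
qed

lemma T_0 [simp]: "0 \<in> T" and T_1 [simp]: "1 \<in> T"
  using p_pos by (auto simp: T_def intro!: exI[of _ 1])

lemma T_add: "x \<in> T \<Longrightarrow> y \<in> T \<Longrightarrow> x + y \<in> T"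
  and T_diff: "x \<in> T \<Longrightarrow> y \<in> T \<Longrightarrow> x - y \<in> T"
  and T_mult: "x \<in> T \<Longrightarrow> y \<in> T \<Longrightarrow> x * y \<in> T"
  using T_common[of x y] by (auto simp: T_def frobenius_add frobenius_diff power_mult_distrib)

lemma T_inverse: "x \<in> T \<Longrightarrow> inverse x \<in> T"
  by (auto simp: T_def power_inverse)

lemma T_divide: "x \<in> T \<Longrightarrow> y \<in> T \<Longrightarrow> x / y \<in> T"
  by (simp add: divide_inverse T_mult T_inverse)

lemma T_power: "x \<in> T \<Longrightarrow> x ^ n \<in> T"
  by (induction n) (auto intro: T_mult)

lemma T_of_nat: "of_nat n \<in> T"
  by (induction n) (auto intro: T_add)

lemma T_sum: "(\<And>i. i \<in> A \<Longrightarrow> f i \<in> T) \<Longrightarrow> sum f A \<in> T"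
  by (induction A rule: infinite_finite_induct) (auto intro: T_add)

lemma T_val: assumes "x \<in> T" "x \<noteq> 0" shows "v x = 0"
proof -
  obtain k where k: "k > 0" "x ^ (p ^ k) = x" using assms by (auto simp: T_def)
  then have "real (p ^ k) * v x = v x" using val_power[of x "p ^ k"] assms by simp
  moreover have "real (p ^ k) \<noteq> 1"
    using one_less_power[OF p_gt_1 k(1)] by (metis of_nat_eq_1_iff less_irrefl)
  ultimately show ?thesis by (metis mult_cancel_right2)
qed

lemma T_vge_0: "x \<in> T \<Longrightarrow> vge v 0 x"
  using T_val[of x] by (cases "x = 0") (auto simp: vge_def)

lemma T_vgt_0: "x \<in> T \<Longrightarrow> vgt v 0 x \<longleftrightarrow> x = 0"
  using T_val[of x] by (cases "x = 0") (auto simp: vgt_def)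

lemma T_eq: "x \<in> T \<Longrightarrow> y \<in> T \<Longrightarrow> vgt v 0 (x - y) \<Longrightarrow> x = y"
  using T_vgt_0[of "x - y"] T_diff by auto

definition residue_class :: "'k \<Rightarrow> 'k set" where
  "residue_class x = {(x, y). x \<in> val_ring v \<and> y \<in> val_ring v \<and> x - y \<in> val_max_ideal v} `` {x}"

lemma residue_field_eq: "residue_field v = residue_class ` {x. vge v 0 x}"
  by (auto simp: residue_field_def residue_class_def quotient_def val_ring_def vge_def)

lemma residue_class_eq:
  assumes "vge v 0 x" "vge v 0 y"
  shows "residue_class x = residue_class y \<longleftrightarrow> vgt v 0 (x - y)"
proof -
  have rc: "residue_class z = {w. vge v 0 w \<and> vgt v 0 (z - w)}" if "vge v 0 z" for z
    using that by (auto simp: residue_class_def val_ring_def val_max_ideal_def vge_def vgt_def)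
  have "y \<in> residue_class y" using assms by (simp add: rc)
  moreover have "vgt v 0 (x - w) \<longleftrightarrow> vgt v 0 (y - w)" if "vgt v 0 (x - y)" for w
    using vgt_add[of 0 "x - y" "y - w"] vgt_diff[of 0 "x - w" "x - y"] that by auto
  ultimately show ?thesis using assms by (auto simp: rc)
qed

text \<open>The residue of x has a finite orbit under Frobenius, so for some d > 0 the elements x
  and x^(p^d) are congruent. Then the powers x^(p^(dn)) converge to a fixed point of the d-th power
  of Frobenius, which has the residue of x.\<close>

lemma T_approx:
  assumes x: "vge v 0 x"
  shows "\<exists>c\<in>T. vgt v 0 (x - c)"
proof -
  have "\<not> inj (\<lambda>k. residue_class (x ^ (p ^ k)))"
  proof
    assume "inj (\<lambda>k. residue_class (x ^ (p ^ k)))"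
    moreover have "range (\<lambda>k. residue_class (x ^ (p ^ k))) \<subseteq> residue_field v"
      using x by (auto simp: residue_field_eq intro!: imageI vge_power_0)
    ultimately show False
      using finite_residue_field finite_subset finite_imageD infinite_UNIV_nat by blast
  qed
  then obtain i' j' where ij': "i' \<noteq> j'"
    "residue_class (x ^ (p ^ i')) = residue_class (x ^ (p ^ j'))"
    by (auto simp: inj_def)
  obtain i j where ij: "i < j" "residue_class (x ^ (p ^ i)) = residue_class (x ^ (p ^ j))"
  proof (cases "i' < j'")
    case True
    with ij' show ?thesis by (intro that)
  next
    case False
    with ij' show ?thesis by (intro that[of j' i']) auto
  qed
  define d where "d = j - i"
  have d: "d > 0" using ij by (simp add: d_def)
  \<comment> \<open>The collision found above is between the exponents i and j, not 0 and d. Its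
    difference equals e^(p^i), so the positive value passes down to e.\<close>
  define e where "e = x ^ (p ^ d) - x"
  have e0: "vge v 0 e" unfolding e_def by (intro vge_diff vge_power_0 x)
  have "vgt v 0 (x ^ (p ^ j) - x ^ (p ^ i))"
    using ij x residue_class_eq[of "x ^ (p ^ i)" "x ^ (p ^ j)"]
    by (auto simp: vge_power_0 vgt_diff_commute)
  also have "x ^ (p ^ j) - x ^ (p ^ i) = e ^ (p ^ i)"
    using ij unfolding e_def frobenius_diff
    by (simp add: d_def flip: power_mult power_add)
  finally have "e = 0 \<or> v e \<noteq> 0" by (auto simp: vgt_def val_power)
  with e0 have e: "vge v 1 e" unfolding vgt_0_iff[symmetric] by (auto simp: vgt_def vge_def)
  \<comment> \<open>Consecutive differences are e^(p^(dn)), whose values grow at least linearly in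
    n.\<close>
  define s where "s n = x ^ (p ^ (d * n))" for n
  have diff: "s (Suc n) - s n = e ^ (p ^ (d * n))" for n
    by (simp add: s_def e_def frobenius_diff power_add flip: power_mult)
  have pn: "real n \<le> real (p ^ (d * n))" for n
  proof -
    have "n \<le> d * n" using d by simp
    also have "\<dots> < p ^ (d * n)" using p_gt_1 by (simp add: power_gt_expt)
    finally show ?thesis by simp
  qed
  have "vge v (real n) (s (Suc n) - s n)" for n
    unfolding diff using vge_power[OF e, of "p ^ (d * n)"] pn[of n] by (auto elim: vge_mono)
  then obtain l where l: "\<And>n. vge v (real n) (s n - l)"
    using complete unfolding val_complete_def by blast
  have "l ^ (p ^ d) - l = 0"
  proof (rule zero_if_vge_all)
    fix n
    have "vge v (real n) ((s n - l) ^ (p ^ d))"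
    proof (rule vge_mono[OF vge_power[OF l]])
      show "real n \<le> real (p ^ d) * real n"
        using p_pos by (simp flip: of_nat_mult of_nat_power)
    qed
    also have "(s n - l) ^ (p ^ d) = s (Suc n) - l ^ (p ^ d)"
      by (simp add: frobenius_diff s_def add.commute flip: power_mult power_add)
    finally have "vge v (real n) ((s (Suc n) - l) - (s (Suc n) - l ^ (p ^ d)))"
      using vge_mono[OF l[of "Suc n"], of "real n"] by (intro vge_diff[of _ "s (Suc n) - l"]) simp_all
    then show "vge v (real n) (l ^ (p ^ d) - l)" by simp
  qed
  then have "l \<in> T" using d by (auto simp: T_def)
  moreover have "vge v 1 ((s 1 - l) - (s 1 - s 0))"
    using l[of 1] diff[of 0] e by (intro vge_diff[of _ "s 1 - l"]) simp_all
  ultimately show ?thesis by (auto simp: s_def vgt_0_iff)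
qed

lemma residue_class_bij: "bij_betw residue_class T (residue_field v)"
  unfolding bij_betw_def
proof
  show "inj_on residue_class T"
    using T_eq by (auto intro!: inj_onI simp: residue_class_eq T_vge_0)
  have "\<exists>c\<in>T. residue_class x = residue_class c" if "vge v 0 x" for x
    using T_approx[OF that] that by (auto simp: residue_class_eq T_vge_0)
  then show "residue_class ` T = residue_field v"
    using T_vge_0 by (fastforce simp: residue_field_eq)
qed

lemma finite_T: "finite T" and card_T: "card T = card (residue_field v)"
  using bij_betw_finite[OF residue_class_bij] bij_betw_same_card[OF residue_class_bij]
    finite_residue_field by auto

definition Tx :: "'k set" where "Tx = T - {0}"

lemma finite_Tx: "finite Tx" and card_Tx: "card Tx = card T - 1"
  by (auto simp: Tx_def finite_T)

text \<open>Multiplication by x permutes \<open>Tx\<close>; comparing the products of all elements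
  before and after gives the claim.\<close>

lemma Tx_order: assumes "x \<in> Tx" shows "x ^ card Tx = 1"
proof -
  have "bij_betw ((*) x) Tx Tx"
  proof (rule bij_betw_byWitness[where f' = "\<lambda>y. y / x"])
  qed (use assms in \<open>auto simp: Tx_def T_mult T_divide\<close>)
  then have "prod id Tx = (\<Prod>y\<in>Tx. x * y)"
    by (simp add: prod.reindex_bij_betw[where g = "\<lambda>y. y", symmetric])
  also have "\<dots> = x ^ card Tx * prod id Tx"
    by (simp add: prod.distrib)
  finally show ?thesis using finite_Tx by (auto simp: Tx_def)
qed

section \<open>Laurent expansions in a uniformizer and the automorphisms of K\<close>

definition T_poly :: "'k poly \<Rightarrow> bool" where
  "T_poly P \<longleftrightarrow> (\<forall>i. coeff P i \<in> T)"

lemma T_poly_add: "T_poly P \<Longrightarrow> T_poly Q \<Longrightarrow> T_poly (P + Q)"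
  and T_poly_diff: "T_poly P \<Longrightarrow> T_poly Q \<Longrightarrow> T_poly (P - Q)"
  and T_poly_mult: "T_poly P \<Longrightarrow> T_poly Q \<Longrightarrow> T_poly (P * Q)"
  and T_poly_monom: "c \<in> T \<Longrightarrow> T_poly (monom c n)"
  by (auto simp: T_poly_def coeff_mult intro: T_add T_diff T_sum T_mult)

text \<open>A nonzero term c t^i with c in \<open>T\<close> has value i, so the value of the sum is
  the index of its lowest coefficient. The right-hand side does not mention t: this is why replacing
  t by another uniformizer preserves values.\<close>

lemma vge_T_poly:
  assumes t: "t \<noteq> 0" "v t = 1" and P: "T_poly P"
  shows "vge v (real N) (poly P t) \<longleftrightarrow> (\<forall>i<N. coeff P i = 0)"
proof
  assume low: "\<forall>i<N. coeff P i = 0"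
  have "vge v (real N) (coeff P i * t ^ i)" for i
  proof (cases "i < N")
    case False
    have "vge v (0 + real i) (coeff P i * t ^ i)"
      using P t T_vge_0 by (intro vge_mult) (auto simp: T_poly_def vge_def val_power)
    then show ?thesis using False by (auto elim: vge_mono)
  qed (use low in simp)
  then show "vge v (real N) (poly P t)"
    unfolding poly_altdef by (intro vge_sum)
next
  assume ge: "vge v (real N) (poly P t)"
  show "\<forall>i<N. coeff P i = 0"
  proof (rule ccontr)
    assume "\<not> (\<forall>i<N. coeff P i = 0)"
    then obtain i0 where i0: "i0 < N" "coeff P i0 \<noteq> 0" by auto
    have val: "v (coeff P i * t ^ i) = real i" if "coeff P i \<noteq> 0" for i
      using that t P T_val by (simp add: val_mult val_power T_poly_def)
    have "\<exists>i\<in>{..degree P}. same_lead v (poly P t) (coeff P i * t ^ i) \<and>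
        (\<forall>j\<in>{..degree P}. vge v (v (coeff P i * t ^ i)) (coeff P j * t ^ j)) \<and>
        (\<forall>j\<in>{..degree P} - {i}. vgt v (v (coeff P i * t ^ i)) (coeff P j * t ^ j))"
      unfolding poly_altdef using i0 t val
      by (intro sum_distinct_values[of _ i0]) (auto simp: le_degree)
    then obtain i where i: "same_lead v (poly P t) (coeff P i * t ^ i)"
      "vge v (v (coeff P i * t ^ i)) (coeff P i0 * t ^ i0)"
      using i0 by (auto simp: le_degree)
    then have nz: "coeff P i \<noteq> 0" "poly P t \<noteq> 0" by (auto simp: same_lead_def)
    then have "v (poly P t) = real i" using same_lead_val[OF i(1)] val by simp
    moreover have "i \<le> i0" using i(2) i0 t val nz by (simp add: vge_def)
    ultimately show False using ge i0 nz by (simp add: vge_def)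
  qed
qed

text \<open>The elements of T[t, 1/t], which are dense in K. Keeping P and M apart from t allows the
  same expression to be evaluated at another uniformizer.\<close>

definition laurent :: "'k poly \<Rightarrow> nat \<Rightarrow> 'k \<Rightarrow> 'k" where
  "laurent P M t = poly P t / t ^ M"

lemma laurent_diff:
  assumes "T_poly P" "T_poly Q"
  obtains R where "T_poly R" "\<And>t. t \<noteq> 0 \<Longrightarrow> laurent P M t - laurent Q M' t = laurent R (M + M') t"
proof (rule that)
  show "T_poly (P * monom 1 M' - Q * monom 1 M)"
    using assms by (intro T_poly_diff T_poly_mult T_poly_monom) auto
qed (simp add: laurent_def poly_monom field_simps power_add)

lemma laurent_mult:
  assumes "T_poly P" "T_poly Q"
  obtains R where "T_poly R" "\<And>t. t \<noteq> 0 \<Longrightarrow> laurent P M t * laurent Q M' t = laurent R (M + M') t"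
proof (rule that)
  show "T_poly (P * Q)" using assms by (rule T_poly_mult)
qed (simp add: laurent_def power_add)

lemma vge_laurent_transfer:
  assumes "t \<noteq> 0" "v t = 1" "t' \<noteq> 0" "v t' = 1" "T_poly P"
  shows "vge v (real N) (laurent P M t) \<longleftrightarrow> vge v (real N) (laurent P M t')"
  using vge_T_poly[of t P "N + M"] vge_T_poly[of t' P "N + M"] assms
  by (simp add: laurent_def vge_divide val_power)

lemma T_poly_dense:
  assumes t: "t \<noteq> 0" "v t = 1" and x: "vge v 0 x"
  shows "\<exists>P. T_poly P \<and> vge v (real N) (x - poly P t)"
proof (induction N)
  case 0
  show ?case using x by (intro exI[of _ 0]) (auto simp: T_poly_def)
next
  case (Suc N)
  then obtain P where P: "T_poly P" "vge v (real N) (x - poly P t)" by blast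
  then have "vge v 0 ((x - poly P t) / t ^ N)" using t by (simp add: vge_divide val_power)
  then obtain c where c: "c \<in> T" "vge v 1 ((x - poly P t) / t ^ N - c)"
    using T_approx by (auto simp: vgt_0_iff)
  have "(x - poly P t) / t ^ N - c = (x - poly (P + monom c N) t) / t ^ N"
    using t by (simp add: field_simps poly_monom)
  then have "vge v (real (Suc N)) (x - poly (P + monom c N) t)"
    using c t by (simp add: vge_divide val_power)
  then show ?case using P c by (intro exI[of _ "P + monom c N"]) (auto intro: T_poly_add T_poly_monom)
qed

lemma laurent_dense:
  assumes t: "t \<noteq> 0" "v t = 1"
  shows "\<exists>P M. T_poly P \<and> vge v (real N) (x - laurent P M t)"
proof -
  obtain M :: nat where M: "- v x \<le> real M" using real_arch_simple by blast
  then have "vge v 0 (x * t ^ M)"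
    using t by (cases "x = 0") (auto simp: vge_def val_mult val_power)
  then obtain P where P: "T_poly P" "vge v (real (N + M)) (x * t ^ M - poly P t)"
    using T_poly_dense t by blast
  have "x - laurent P M t = (x * t ^ M - poly P t) / t ^ M"
    using t by (simp add: laurent_def field_simps)
  then have "vge v (real N) (x - laurent P M t)" using P t by (simp add: vge_divide val_power)
  then show ?thesis using P by blast
qed

text \<open>The graph of the continuous automorphism over \<open>T\<close> that maps \<open>t\<close> to \<open>t'\<close>.\<close>

definition subst_rel :: "'k \<Rightarrow> 'k \<Rightarrow> 'k \<Rightarrow> 'k \<Rightarrow> bool" where
  "subst_rel t t' x y \<longleftrightarrow>
     (\<forall>N::nat. \<exists>P M. T_poly P \<and> vge v (real N) (x - laurent P M t) \<and> vge v (real N) (y - laurent P M t'))"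

lemma subst_rel_sym: "subst_rel t t' x y \<Longrightarrow> subst_rel t' t y x"
  unfolding subst_rel_def by blast

context
  fixes t t' :: 'k
  assumes t: "t \<noteq> 0" "v t = 1" and t': "t' \<noteq> 0" "v t' = 1"
begin

lemma subst_rel_T: "c \<in> T \<Longrightarrow> subst_rel t t' c c"
  and subst_rel_t: "subst_rel t t' t t'"
proof -
  show "subst_rel t t' c c" if "c \<in> T"
    unfolding subst_rel_def
    using that by (intro allI exI[of _ "monom c 0"] exI[of _ 0]) (auto simp: laurent_def poly_monom T_poly_monom)
  show "subst_rel t t' t t'"
    unfolding subst_rel_def
    by (intro allI exI[of _ "monom 1 1"] exI[of _ 0]) (auto simp: laurent_def poly_monom T_poly_monom)
qed

lemma subst_rel_diff:
  assumes "subst_rel t t' x y" "subst_rel t t' x' y'"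
  shows "subst_rel t t' (x - x') (y - y')"
  unfolding subst_rel_def
proof
  fix N
  obtain P M where P: "T_poly P" "vge v (real N) (x - laurent P M t)" "vge v (real N) (y - laurent P M t')"
    using assms(1) unfolding subst_rel_def by blast
  obtain Q M' where Q: "T_poly Q" "vge v (real N) (x' - laurent Q M' t)" "vge v (real N) (y' - laurent Q M' t')"
    using assms(2) unfolding subst_rel_def by blast
  obtain R where R: "T_poly R" "\<And>t. t \<noteq> 0 \<Longrightarrow> laurent P M t - laurent Q M' t = laurent R (M + M') t"
    using laurent_diff[OF P(1) Q(1)] by blast
  have "vge v (real N) (x - x' - laurent R (M + M') t)"
    using vge_diff[OF P(2) Q(2)] R(2)[OF t(1)] by (simp add: algebra_simps)
  moreover have "vge v (real N) (y - y' - laurent R (M + M') t')"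
    using vge_diff[OF P(3) Q(3)] R(2)[OF t'(1)] by (simp add: algebra_simps)
  ultimately show "\<exists>P M. T_poly P \<and> vge v (real N) (x - x' - laurent P M t) \<and>
      vge v (real N) (y - y' - laurent P M t')"
    using R by blast
qed

lemma subst_rel_add:
  assumes "subst_rel t t' x y" "subst_rel t t' x' y'"
  shows "subst_rel t t' (x + x') (y + y')"
  using subst_rel_diff[OF assms(1) subst_rel_diff[OF subst_rel_T[OF T_0] assms(2)]] by simp

lemma vge_mult_diff:
  assumes "vge v (- C) y" "vge v (N + C) (x - X)" "vge v (- C) X" "vge v (N + C) (y - Y)"
  shows "vge v N (x * y - X * Y)"
proof -
  have "vge v N ((x - X) * y + X * (y - Y))"
    using vge_mult[OF assms(2,1)] vge_mult[OF assms(3,4)] by (intro vge_add) simp_all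
  then show ?thesis by (simp add: algebra_simps)
qed

lemma subst_rel_mult:
  assumes "subst_rel t t' x y" "subst_rel t t' x' y'"
  shows "subst_rel t t' (x * x') (y * y')"
  unfolding subst_rel_def
proof
  fix N
  \<comment> \<open>C bounds the poles of all four elements; approximating the factors to precision
    N + C gives the products to precision N.\<close>
  obtain C :: nat where C: "real C \<ge> Max {- v x, - v y, - v x', - v y'}"
    using real_arch_simple by blast
  have C': "vge v (- real C) x" "vge v (- real C) y" "vge v (- real C) x'" "vge v (- real C) y'"
    using C by (auto simp: vge_def)
  obtain P M where P: "T_poly P" "vge v (real (N + C)) (x - laurent P M t)"
    "vge v (real (N + C)) (y - laurent P M t')"
    using assms(1) unfolding subst_rel_def by blast
  obtain Q M' where Q: "T_poly Q" "vge v (real (N + C)) (x' - laurent Q M' t)"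
    "vge v (real (N + C)) (y' - laurent Q M' t')"
    using assms(2) unfolding subst_rel_def by blast
  obtain R where R: "T_poly R" "\<And>t. t \<noteq> 0 \<Longrightarrow> laurent P M t * laurent Q M' t = laurent R (M + M') t"
    using laurent_mult[OF P(1) Q(1)] by blast
  have "vge v (- real C) (x - (x - laurent P M t))" "vge v (- real C) (y - (y - laurent P M t'))"
    by (rule vge_diff[OF C'(1) vge_mono[OF P(2)]], simp)
       (rule vge_diff[OF C'(2) vge_mono[OF P(3)]], simp)
  then have "vge v (- real C) (laurent P M t)" "vge v (- real C) (laurent P M t')" by simp_all
  then have "vge v (real N) (x * x' - laurent R (M + M') t)" "vge v (real N) (y * y' - laurent R (M + M') t')"
    using P Q C' t t' by (auto simp flip: R(2) intro!: vge_mult_diff[where C = "real C"])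
  then show "\<exists>P M. T_poly P \<and> vge v (real N) (x * x' - laurent P M t) \<and>
      vge v (real N) (y * y' - laurent P M t')"
    using R by blast
qed

lemma subst_rel_vge:
  assumes "subst_rel t t' x y" "vge v (real N) x"
  shows "vge v (real N) y"
proof -
  obtain P M where P: "T_poly P" "vge v (real N) (x - laurent P M t)"
    "vge v (real N) (y - laurent P M t')"
    using assms(1) unfolding subst_rel_def by blast
  have "vge v (real N) (laurent P M t)" using vge_diff[OF assms(2) P(2)] by simp
  then have "vge v (real N) (laurent P M t')" using vge_laurent_transfer t t' P by blast
  then show ?thesis using vge_add[OF P(3)] by fastforce
qed

lemma subst_rel_unique:
  assumes "subst_rel t t' x y" "subst_rel t t' x y'"
  shows "y = y'"
proof -
  have "subst_rel t t' 0 (y - y')" using subst_rel_diff[OF assms] by simp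
  then have "y - y' = 0" using subst_rel_vge[of 0] by (intro zero_if_vge_all) simp
  then show ?thesis by simp
qed

lemma subst_rel_total: "\<exists>y. subst_rel t t' x y"
proof -
  have "\<forall>N. \<exists>PM. T_poly (fst PM) \<and> vge v (real N) (x - laurent (fst PM) (snd PM) t)"
    using laurent_dense[OF t] by simp
  then obtain PM where "\<forall>N. T_poly (fst (PM N)) \<and> vge v (real N) (x - laurent (fst (PM N)) (snd (PM N)) t)"
    by metis
  then obtain P M where PM: "\<And>N. T_poly (P N)" "\<And>N. vge v (real N) (x - laurent (P N) (M N) t)"
    using that[of "fst \<circ> PM" "snd \<circ> PM"] by auto
  \<comment> \<open>The approximations of x are Laurent polynomials in t. The same ones evaluated at
    t' form a Cauchy sequence, because differences of Laurent polynomials have equal values at t and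
    t'.\<close>
  define s where "s N = laurent (P N) (M N) t'" for N
  have "vge v (real N) (s (Suc N) - s N)" for N
  proof -
    obtain R where R: "T_poly R" "\<And>t. t \<noteq> 0 \<Longrightarrow> laurent (P (Suc N)) (M (Suc N)) t - laurent (P N) (M N) t
        = laurent R (M (Suc N) + M N) t"
      using laurent_diff[OF PM(1) PM(1)] by blast
    have "vge v (real N) (x - laurent (P (Suc N)) (M (Suc N)) t)"
      by (rule vge_mono[OF PM(2)]) simp
    from vge_diff[OF PM(2)[of N] this] have "vge v (real N) (laurent R (M (Suc N) + M N) t)"
      using R(2)[OF t(1)] by simp
    then show ?thesis
      using R(2)[OF t'(1)] unfolding s_def by (simp add: vge_laurent_transfer[OF t t' R(1)])
  qed
  then obtain y where y: "\<And>N. vge v (real N) (s N - y)"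
    using complete unfolding val_complete_def by blast
  have "vge v (real N) (y - laurent (P N) (M N) t')" for N
    using y[of N] unfolding s_def by (subst vge_diff_commute)
  then have "\<forall>N. T_poly (P N) \<and> vge v (real N) (x - laurent (P N) (M N) t) \<and>
      vge v (real N) (y - laurent (P N) (M N) t')"
    using PM by simp
  then have "subst_rel t t' x y"
    unfolding subst_rel_def by (intro allI) (rule exI, rule exI, erule spec)
  then show ?thesis ..
qed

end

lemma uniformizer_automorphism:
  assumes t: "t \<noteq> 0" "v t = 1" and t': "t' \<noteq> 0" "v t' = 1"
  obtains \<phi> :: "'k \<Rightarrow> 'k" where "bij \<phi>" "\<And>x y. \<phi> (x + y) = \<phi> x + \<phi> y" "\<And>x y. \<phi> (x * y) = \<phi> x * \<phi> y"
    "\<phi> t = t'" "\<And>c. c \<in> T \<Longrightarrow> \<phi> c = c" "\<And>N x. vge v (real N) x \<Longrightarrow> vge v (real N) (\<phi> x)"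
proof -
  obtain \<phi> where \<phi>: "\<And>x. subst_rel t t' x (\<phi> x)" using subst_rel_total[OF t t'] by metis
  obtain \<psi> where \<psi>: "\<And>x. subst_rel t' t x (\<psi> x)" using subst_rel_total[OF t' t] by metis
  note eq = subst_rel_unique[OF t t' \<phi>]
  have inv: "\<psi> (\<phi> x) = x" "\<phi> (\<psi> x) = x" for x
    using subst_rel_unique[OF t' t \<psi> subst_rel_sym[OF \<phi>]] eq[OF subst_rel_sym[OF \<psi>]] by auto
  show ?thesis
  proof (rule that)
    show "bij \<phi>" using inv by (intro o_bij[of \<psi>]) auto
    show "\<phi> (x + y) = \<phi> x + \<phi> y" for x y by (rule eq[OF subst_rel_add[OF t t' \<phi> \<phi>]])
    show "\<phi> (x * y) = \<phi> x * \<phi> y" for x y by (rule eq[OF subst_rel_mult[OF t t' \<phi> \<phi>]])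
    show "\<phi> t = t'" by (rule eq[OF subst_rel_t[OF t t']])
    show "\<phi> c = c" if "c \<in> T" for c by (rule eq[OF subst_rel_T[OF t t' that]])
    show "vge v (real N) (\<phi> x)" if "vge v (real N) x" for N x
      by (rule subst_rel_vge[OF t t' \<phi> that])
  qed
qed

section \<open>Powers of residues\<close>

lemma Tx_1 [simp]: "1 \<in> Tx"
  and Tx_mult: "x \<in> Tx \<Longrightarrow> y \<in> Tx \<Longrightarrow> x * y \<in> Tx"
  and Tx_divide: "x \<in> Tx \<Longrightarrow> y \<in> Tx \<Longrightarrow> x / y \<in> Tx"
  and Tx_power: "x \<in> Tx \<Longrightarrow> x ^ n \<in> Tx"
  by (auto simp: Tx_def T_mult T_divide T_power)

lemma Tx_nz: "x \<in> Tx \<Longrightarrow> x \<noteq> 0" and Tx_T: "x \<in> Tx \<Longrightarrow> x \<in> T"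
  by (auto simp: Tx_def)

lemma card_Tx_pos: "card Tx > 0"
  using Tx_1 finite_Tx card_gt_0_iff by blast

lemma card_roots_of_unity_le: assumes "g > 0" shows "card {x \<in> Tx. x ^ g = 1} \<le> g"
proof -
  define P :: "'k poly" where "P = monom 1 g + [:- 1:]"
  have deg: "degree P = g"
    unfolding P_def by (subst degree_add_eq_left) (use assms in \<open>auto simp: degree_monom_eq\<close>)
  then have "P \<noteq> 0" using assms by auto
  have "{x \<in> Tx. x ^ g = 1} \<subseteq> {x. poly P x = 0}" by (auto simp: P_def poly_monom)
  then have "card {x \<in> Tx. x ^ g = 1} \<le> card {x. poly P x = 0}"
    using poly_roots_finite[OF \<open>P \<noteq> 0\<close>] by (rule card_mono[rotated])
  also have "\<dots> \<le> g" using card_poly_roots_bound[OF \<open>P \<noteq> 0\<close>] deg by simp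
  finally show ?thesis .
qed

text \<open>With \<open>card Tx\<close> = g n, every element of \<open>Tx\<close> is a root of
  X^(gn) - 1 = (X^g - 1) Q. The factor Q has at most g (n - 1) roots, so at least g elements remain
  for X^g - 1. This counts roots of unity without showing that \<open>Tx\<close> is cyclic.\<close>

lemma card_roots_of_unity_dvd:
  assumes "g dvd card Tx"
  shows "card {x \<in> Tx. x ^ g = 1} = g"
proof -
  obtain n where n: "card Tx = g * n" using assms by auto
  have pos: "g > 0" "n > 0" using card_Tx_pos n by auto
  define Q :: "'k poly" where "Q = (\<Sum>l<n. monom 1 (g * l))"
  have cQ: "coeff Q (g * l) = 1" if "l < n" for l
  proof -
    have "coeff Q (g * l) = (\<Sum>j<n. if j = l then 1 else 0)"
      unfolding Q_def coeff_sum using pos by (intro sum.cong) auto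
    then show ?thesis using that by simp
  qed
  have "Q \<noteq> 0" using cQ[of 0] pos by auto
  have "degree Q \<le> g * (n - 1)"
    unfolding Q_def by (intro degree_sum_le) (auto intro!: order.trans[OF degree_monom_le])
  have "Tx \<subseteq> {x \<in> Tx. x ^ g = 1} \<union> {x. poly Q x = 0}"
  proof
    fix x assume x: "x \<in> Tx"
    have "(x ^ g - 1) * poly Q x = (x ^ g) ^ n - 1"
      unfolding Q_def by (subst power_diff_1_eq) (simp add: poly_sum poly_monom power_mult)
    then have "(x ^ g - 1) * poly Q x = 0" using Tx_order[OF x] n by (simp add: power_mult)
    then show "x \<in> {x \<in> Tx. x ^ g = 1} \<union> {x. poly Q x = 0}" using x by auto
  qed
  then have "card Tx \<le> card ({x \<in> Tx. x ^ g = 1} \<union> {x. poly Q x = 0})"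
    using poly_roots_finite[OF \<open>Q \<noteq> 0\<close>] finite_Tx by (intro card_mono) auto
  also have "\<dots> \<le> card {x \<in> Tx. x ^ g = 1} + card {x. poly Q x = 0}" by (rule card_Un_le)
  also have "card {x. poly Q x = 0} \<le> g * (n - 1)"
    using card_poly_roots_bound[OF \<open>Q \<noteq> 0\<close>] \<open>degree Q \<le> _\<close> by linarith
  finally have "g \<le> card {x \<in> Tx. x ^ g = 1}"
    using n pos by (cases n) auto
  then show ?thesis using card_roots_of_unity_le[of g] pos by simp
qed

lemma card_roots_of_unity:
  assumes "m > 0"
  shows "card {x \<in> Tx. x ^ m = 1} = gcd (card Tx) m"
proof -
  have "x ^ m = 1 \<longleftrightarrow> x ^ gcd (card Tx) m = 1" if "x \<in> Tx" for x
  proof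
    assume m: "x ^ m = 1"
    obtain a b where "m * a = card Tx * b + gcd m (card Tx)"
      using bezout_nat[of m "card Tx"] assms by auto
    then have "x ^ (m * a) = x ^ (card Tx * b) * x ^ gcd (card Tx) m"
      by (simp add: gcd.commute flip: power_add)
    then show "x ^ gcd (card Tx) m = 1" using m Tx_order[OF that] by (simp add: power_mult)
  next
    assume "x ^ gcd (card Tx) m = 1"
    then show "x ^ m = 1" by (metis dvdE gcd_dvd2 power_mult power_one)
  qed
  then have "{x \<in> Tx. x ^ m = 1} = {x \<in> Tx. x ^ gcd (card Tx) m = 1}" by auto
  then show ?thesis by (simp add: card_roots_of_unity_dvd)
qed

definition powers :: "nat \<Rightarrow> 'k set" where
  "powers m = (\<lambda>x. x ^ m) ` Tx"

lemma finite_powers: "finite (powers m)" and powers_subset: "powers m \<subseteq> Tx"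
  by (auto simp: powers_def finite_Tx Tx_power)

text \<open>Each fiber of the m-th power map is a translate of the group of m-th roots of
  unity.\<close>

lemma card_powers:
  assumes "m > 0"
  shows "card (powers m) * gcd (card Tx) m = card Tx"
proof -
  have fiber: "card {x \<in> Tx. x ^ m = y} = gcd (card Tx) m" if y: "y \<in> powers m" for y
  proof -
    obtain a where a: "a \<in> Tx" "y = a ^ m" using y by (auto simp: powers_def)
    have "bij_betw ((*) a) {x \<in> Tx. x ^ m = 1} {x \<in> Tx. x ^ m = y}"
      by (rule bij_betw_byWitness[where f' = "\<lambda>x. x / a"])
        (use a in \<open>auto simp: Tx_mult Tx_divide Tx_nz power_mult_distrib power_divide\<close>)
    then show ?thesis using card_roots_of_unity[OF assms] bij_betw_same_card by fastforce
  qed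
  have "card Tx = (\<Sum>x\<in>Tx. 1)" by simp
  also have "\<dots> = (\<Sum>y\<in>powers m. \<Sum>x\<in>{x \<in> Tx. x ^ m = y}. 1)"
    unfolding powers_def by (rule sum.image_gen[OF finite_Tx])
  also have "\<dots> = (\<Sum>y\<in>powers m. gcd (card Tx) m)"
    using fiber by (intro sum.cong) auto
  finally show ?thesis by simp
qed

lemma of_nat_Tx: "0 < i \<Longrightarrow> i < p \<Longrightarrow> of_nat i \<in> Tx"
  using T_of_nat by (auto simp: Tx_def of_nat_eq_0_iff_char_dvd char_p dest: dvd_imp_le)

lemma of_nat_power_p: "(of_nat j :: 'k) ^ p = of_nat j"
proof (induction j)
  case (Suc j)
  then show ?case using frobenius_add[of 1 "of_nat j" 1] by simp
qed (use p_pos in simp)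

lemma of_nat_inj: "inj_on (of_nat :: nat \<Rightarrow> 'k) {..<p}"
proof (rule linorder_inj_onI)
  fix i j assume ij: "i < j" "i \<in> {..<p}" "j \<in> {..<p}"
  then have "(of_nat (j - i) :: 'k) \<noteq> 0" using Tx_nz[OF of_nat_Tx[of "j - i"]] by simp
  then show "(of_nat i :: 'k) \<noteq> of_nat j" using ij by (auto simp: of_nat_diff)
qed auto

lemma of_nat_power_p_minus_1: "0 < j \<Longrightarrow> j < p \<Longrightarrow> (of_nat j :: 'k) ^ (p - 1) = 1"
proof -
  assume j: "0 < j" "j < p"
  have "(of_nat j :: 'k) * of_nat j ^ (p - 1) = of_nat j"
    using of_nat_power_p[of j] p_pos by (metis power_eq_if neq0_conv)
  then show ?thesis using Tx_nz[OF of_nat_Tx[OF j]] by simp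
qed

text \<open>The nonzero elements of the prime field are p - 1 solutions of x^(p - 1) = 1 in
  \<open>Tx\<close>, whereas the number of solutions is gcd(\<open>card Tx\<close>, p - 1).\<close>

lemma p_minus_1_dvd: "p - 1 dvd card Tx"
proof -
  have "of_nat ` {1..<p} \<subseteq> {x \<in> Tx. x ^ (p - 1) = 1}"
    using of_nat_power_p_minus_1 of_nat_Tx by auto
  then have "card (of_nat ` {1..<p} :: 'k set) \<le> card {x \<in> Tx. x ^ (p - 1) = 1}"
    using finite_Tx by (intro card_mono) auto
  moreover have "card (of_nat ` {1..<p} :: 'k set) = p - 1"
    by (subst card_image[OF inj_on_subset[OF of_nat_inj]]) auto
  moreover have "card {x \<in> Tx. x ^ (p - 1) = 1} = gcd (card Tx) (p - 1)"
    using p_gt_1 by (intro card_roots_of_unity) simp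
  ultimately have "p - 1 \<le> gcd (card Tx) (p - 1)" by (simp only:)
  moreover have "gcd (card Tx) (p - 1) \<le> p - 1" using p_gt_1 by (intro gcd_le2_nat) simp
  ultimately have "gcd (card Tx) (p - 1) = p - 1" by simp
  then show ?thesis by (metis gcd_dvd1)
qed

text \<open>By \<open>closed\<close>, A is a union of cosets of \<open>powers m\<close>, and the
  fibers of the map from w to its coset are these cosets, all of the same size.\<close>

lemma card_cosets:
  assumes A: "A \<subseteq> Tx" and closed: "\<And>w c. w \<in> A \<Longrightarrow> c \<in> powers m \<Longrightarrow> w * c \<in> A"
  shows "card ((\<lambda>w. (*) w ` powers m) ` A) * card (powers m) = card A"
proof -
  let ?f = "\<lambda>w. (*) w ` powers m"
  have one: "1 \<in> powers m" unfolding powers_def by (rule image_eqI[of _ _ 1]) simp_all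
  have mult: "x * y \<in> powers m" "x / y \<in> powers m" if "x \<in> powers m" "y \<in> powers m" for x y
    using that by (auto simp: powers_def Tx_mult Tx_divide simp flip: power_mult_distrib power_divide)
  have fiber: "{w' \<in> A. ?f w' = ?f w} = ?f w" if w: "w \<in> A" for w
  proof (intro equalityI subsetI)
    fix u assume "u \<in> {w' \<in> A. ?f w' = ?f w}"
    then show "u \<in> ?f w" using one by (metis (mono_tags, lifting) image_eqI mem_Collect_eq mult.right_neutral)
  next
    fix u assume "u \<in> ?f w"
    then obtain c where c: "c \<in> powers m" "u = w * c" by auto
    have c0: "c \<noteq> 0" using c powers_subset Tx_nz by blast
    have "?f u = ?f w"
    proof (intro equalityI subsetI)
      fix z assume "z \<in> ?f u"
      then show "z \<in> ?f w" using c mult by (auto simp: mult.assoc)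
    next
      fix z assume "z \<in> ?f w"
      then obtain d where "d \<in> powers m" "z = w * d" by auto
      then show "z \<in> ?f u" using c c0 mult(2)[of d c] by (intro image_eqI[of _ _ "d / c"]) auto
    qed
    then show "u \<in> {w' \<in> A. ?f w' = ?f w}" using closed w c by auto
  qed
  have "card A = (\<Sum>w\<in>A. 1)" by simp
  also have "\<dots> = (\<Sum>C\<in>?f ` A. \<Sum>w\<in>{w\<in>A. ?f w = C}. 1)"
    by (rule sum.image_gen[OF finite_subset[OF A finite_Tx]])
  also have "\<dots> = (\<Sum>C\<in>?f ` A. card (powers m))"
  proof (rule sum.cong)
    fix C assume "C \<in> ?f ` A"
    then obtain w where w: "w \<in> A" "C = ?f w" by auto
    have "inj_on ((*) w) (powers m)" using w A Tx_nz by (intro inj_onI) auto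
    then show "(\<Sum>w\<in>{w\<in>A. ?f w = C}. 1) = card (powers m)"
      using w fiber[OF w(1)] by (simp add: card_image)
  qed simp
  finally show ?thesis by simp
qed

end

section \<open>Totally ramified extensions\<close>

lemma subfieldD:
  assumes "is_subfield L"
  shows subfield_0: "0 \<in> L" and subfield_1: "1 \<in> L"
    and subfield_add: "x \<in> L \<Longrightarrow> y \<in> L \<Longrightarrow> x + y \<in> L"
    and subfield_mult: "x \<in> L \<Longrightarrow> y \<in> L \<Longrightarrow> x * y \<in> L"
    and subfield_minus: "x \<in> L \<Longrightarrow> - x \<in> L"
    and subfield_inverse: "x \<in> L \<Longrightarrow> inverse x \<in> L"
  using assms by (auto simp: is_subfield_def)

lemma subfield_diff: "is_subfield L \<Longrightarrow> x \<in> L \<Longrightarrow> y \<in> L \<Longrightarrow> x - y \<in> L"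
  using subfield_add[of L x "- y"] subfield_minus[of L y] by simp

lemma subfield_divide: "is_subfield L \<Longrightarrow> x \<in> L \<Longrightarrow> y \<in> L \<Longrightarrow> x / y \<in> L"
  by (simp add: divide_inverse subfield_mult subfield_inverse)

lemma subfield_power: "is_subfield L \<Longrightarrow> x \<in> L \<Longrightarrow> x ^ n \<in> L"
  by (induction n) (auto intro: subfield_mult subfield_1)

lemma subfield_sum: "is_subfield L \<Longrightarrow> (\<And>i. i \<in> A \<Longrightarrow> f i \<in> L) \<Longrightarrow> sum f A \<in> L"
  by (induction A rule: infinite_finite_induct) (auto intro: subfield_add subfield_0)

lemma hom_on_subfield:
  assumes "field_hom_on L \<sigma>" "is_subfield L"
  shows hom_on_0: "\<sigma> 0 = 0" and hom_on_1: "\<sigma> 1 = 1"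
    and hom_on_add: "x \<in> L \<Longrightarrow> y \<in> L \<Longrightarrow> \<sigma> (x + y) = \<sigma> x + \<sigma> y"
    and hom_on_mult: "x \<in> L \<Longrightarrow> y \<in> L \<Longrightarrow> \<sigma> (x * y) = \<sigma> x * \<sigma> y"
    and hom_on_minus: "x \<in> L \<Longrightarrow> \<sigma> (- x) = - \<sigma> x"
    and hom_on_power: "x \<in> L \<Longrightarrow> \<sigma> (x ^ n) = \<sigma> x ^ n"
    and hom_on_nz: "x \<in> L \<Longrightarrow> x \<noteq> 0 \<Longrightarrow> \<sigma> x \<noteq> 0"
proof -
  show 1: "\<sigma> 1 = 1" and add: "\<And>x y. x \<in> L \<Longrightarrow> y \<in> L \<Longrightarrow> \<sigma> (x + y) = \<sigma> x + \<sigma> y"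
    and mult: "\<And>x y. x \<in> L \<Longrightarrow> y \<in> L \<Longrightarrow> \<sigma> (x * y) = \<sigma> x * \<sigma> y"
    using assms(1) by (auto simp: field_hom_on_def)
  have "\<sigma> 0 = \<sigma> 0 + \<sigma> 0"
    using add[of 0 0] subfield_0[OF assms(2)] by (simp only: add_0_left)
  then show 0: "\<sigma> 0 = 0" by (simp only: add_cancel_right_right)
  show "\<sigma> (- x) = - \<sigma> x" if "x \<in> L"
    using add[OF that subfield_minus[OF assms(2) that]] 0 by (simp add: eq_neg_iff_add_eq_0 add.commute)
  show "\<sigma> (x ^ n) = \<sigma> x ^ n" if "x \<in> L"
    by (induction n) (use 1 mult that subfield_power[OF assms(2)] in auto)
  show "\<sigma> x \<noteq> 0" if "x \<in> L" "x \<noteq> 0"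
    using mult[OF that(1) subfield_inverse[OF assms(2) that(1)]] that 1 by auto
qed

lemma hom_on_sum:
  assumes "field_hom_on L \<sigma>" "is_subfield L" "\<And>i. i \<in> A \<Longrightarrow> f i \<in> L"
  shows "\<sigma> (sum f A) = (\<Sum>i\<in>A. \<sigma> (f i))"
  using assms(3)
  by (induction A rule: infinite_finite_induct)
    (auto simp: hom_on_0[OF assms(1,2)] hom_on_add[OF assms(1,2)] subfield_sum[OF assms(2)])

locale char_p_extension = char_p_local_field v p
  for v :: "'k::field \<Rightarrow> real" and p :: nat +
  fixes \<iota> :: "'k \<Rightarrow> 'a::field"
  assumes sep_closure: "separable_closure \<iota>"
begin

lemma iota_hom: "field_hom_on UNIV \<iota>"
  using sep_closure by (simp add: separable_closure_def)

lemma UNIV_subfield: "is_subfield (UNIV :: 'k set)"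
  by (simp add: is_subfield_def)

lemma iota_0 [simp]: "\<iota> 0 = 0" and iota_1 [simp]: "\<iota> 1 = 1"
  and iota_add: "\<iota> (x + y) = \<iota> x + \<iota> y"
  and iota_mult: "\<iota> (x * y) = \<iota> x * \<iota> y"
  and iota_minus: "\<iota> (- x) = - \<iota> x"
  and iota_power: "\<iota> (x ^ n) = \<iota> x ^ n"
  and iota_nz: "x \<noteq> 0 \<Longrightarrow> \<iota> x \<noteq> 0"
  using hom_on_subfield[OF iota_hom UNIV_subfield] by auto

lemma iota_eq_0_iff [simp]: "\<iota> x = 0 \<longleftrightarrow> x = 0"
  using iota_nz by auto

lemma iota_diff: "\<iota> (x - y) = \<iota> x - \<iota> y"
  using iota_add[of x "- y"] by (simp add: iota_minus)

lemma iota_inj: "inj \<iota>"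
  by (rule injI) (metis iota_diff iota_eq_0_iff right_minus_eq)

lemma iota_eq_iff [simp]: "\<iota> x = \<iota> y \<longleftrightarrow> x = y"
  using iota_inj by (auto dest: injD)

lemma iota_of_nat: "\<iota> (of_nat n) = of_nat n"
  by (induction n) (auto simp: iota_add)

lemma iota_inverse: "\<iota> (inverse x) = inverse (\<iota> x)"
proof (cases "x = 0")
  case False
  then have "\<iota> x * \<iota> (inverse x) = 1" by (simp flip: iota_mult)
  then show ?thesis by (metis inverse_unique)
qed simp

lemma iota_divide: "\<iota> (x / y) = \<iota> x / \<iota> y"
  by (simp add: divide_inverse iota_mult iota_inverse)

lemma char_p': "CHAR('a) = p"
proof (rule CHAR_eqI)
  show "of_nat p = (0::'a)"
    using iota_of_nat[of p] of_nat_CHAR[where ?'a = 'k] by (simp add: char_p)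
  show "p dvd n" if "of_nat n = (0::'a)" for n
  proof -
    have "\<iota> (of_nat n) = 0" using that by (simp add: iota_of_nat)
    then show ?thesis by (simp add: of_nat_eq_0_iff_char_dvd char_p)
  qed
qed

lemma frobenius_diff': "((x::'a) - y) ^ p = x ^ p - y ^ p"
proof -
  have "((x - y) + y) ^ p = (x - y) ^ p + y ^ p"
    by (rule freshmans_dream) (use prime_p in \<open>simp_all add: char_p'\<close>)
  then show ?thesis by simp
qed

lemma frobenius_add': "((x::'a) + y) ^ p = x ^ p + y ^ p"
  by (rule freshmans_dream) (use prime_p in \<open>simp_all add: char_p'\<close>)

sublocale V: vector_space "\<lambda>c x. \<iota> c * x"
  by unfold_locales (simp_all add: algebra_simps iota_add iota_mult)

definition lin :: "'a \<Rightarrow> (nat \<Rightarrow> 'k) \<Rightarrow> 'a" where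
  "lin \<pi> a = (\<Sum>j<p. \<iota> (a j) * \<pi> ^ j)"

lemma lin_diff: "lin \<pi> a - lin \<pi> b = lin \<pi> (\<lambda>j. a j - b j)"
  by (simp add: lin_def iota_diff algebra_simps sum_subtractf)

lemma lin_nonzero: "lin \<pi> a \<noteq> 0 \<Longrightarrow> \<exists>j<p. a j \<noteq> 0"
  by (rule ccontr) (simp add: lin_def)

lemma lin_split: "lin \<pi> a = \<iota> (a 0) + (\<Sum>j\<in>{1..<p}. \<iota> (a j) * \<pi> ^ j)"
proof -
  have "{..<p} = insert 0 {1..<p}" using p_pos by auto
  then show ?thesis by (simp add: lin_def)
qed

lemma lin_mem:
  assumes "is_subfield L" "range \<iota> \<subseteq> L" "\<pi> \<in> L"
  shows "lin \<pi> a \<in> L"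
  unfolding lin_def using assms by (auto intro!: subfield_sum subfield_mult subfield_power)

definition eisenstein :: "'a \<Rightarrow> (nat \<Rightarrow> 'k) \<Rightarrow> bool" where
  "eisenstein \<pi> a \<longleftrightarrow> \<pi> ^ p + lin \<pi> a = 0 \<and> a 0 \<noteq> 0 \<and> v (a 0) = 1 \<and> (\<forall>j<p. vge v 1 (a j))"

text \<open>If \<pi> had value at most 0, every term a_j \<pi>^j would be too small to balance
  \<pi>^p. Hence the value is positive, the constant term dominates, and \<pi>^p has the value c of
  a uniformizer of K. This determines every extension of the valuation on K(\<pi>), up to
  scaling.\<close>

lemma eisenstein_val:
  assumes mu: "is_valuation \<mu>" "c > 0" "\<And>x. x \<noteq> 0 \<Longrightarrow> \<mu> (\<iota> x) = c * v x"
    and eis: "eisenstein \<pi> a"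
  shows "\<pi> \<noteq> 0 \<and> real p * \<mu> \<pi> = c"
proof -
  interpret M: valuation \<mu> using mu(1) by unfold_locales
  have a0: "a 0 \<noteq> 0" "v (a 0) = 1" and aj: "\<And>j. j < p \<Longrightarrow> vge v 1 (a j)"
    and eq: "\<pi> ^ p + lin \<pi> a = 0"
    using eis by (auto simp: eisenstein_def)
  have nz: "\<pi> \<noteq> 0"
  proof
    assume "\<pi> = 0"
    then have "lin \<pi> a = \<iota> (a 0)" by (simp add: lin_split power_0_left)
    then show False using eq \<open>\<pi> = 0\<close> a0 p_pos by (simp add: power_0_left)
  qed
  have ge_c: "vge \<mu> c (\<iota> (a j))" if "j < p" for j
    using aj[OF that] mu(2,3) by (cases "a j = 0") (auto simp: vge_def)
  have pos: "\<mu> \<pi> > 0"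
  proof (rule ccontr)
    assume "\<not> \<mu> \<pi> > 0"
    then have le: "\<mu> \<pi> \<le> 0" by simp
    have "vge \<mu> (c + (real p - 1) * \<mu> \<pi>) (\<iota> (a j) * \<pi> ^ j)" if "j < p" for j
    proof -
      have "vge \<mu> (c + real j * \<mu> \<pi>) (\<iota> (a j) * \<pi> ^ j)"
        using nz ge_c[OF that] by (intro M.vge_mult) (auto simp: vge_def M.val_power)
      moreover have "(real p - 1) * \<mu> \<pi> \<le> real j * \<mu> \<pi>"
        using le that by (intro mult_right_mono_neg) auto
      ultimately show ?thesis by (elim vge_mono) simp
    qed
    then have "vge \<mu> (c + (real p - 1) * \<mu> \<pi>) (lin \<pi> a)"
      unfolding lin_def by (intro M.vge_sum) auto
    moreover have "lin \<pi> a = - (\<pi> ^ p)" using eq by (simp add: eq_neg_iff_add_eq_0 add.commute)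
    ultimately have "c + (real p - 1) * \<mu> \<pi> \<le> real p * \<mu> \<pi>"
      using nz by (simp add: vge_def M.val_power)
    then show False using le mu(2) by (simp add: algebra_simps)
  qed
  have "vgt \<mu> c (\<iota> (a j) * \<pi> ^ j)" if "j \<in> {1..<p}" for j
  proof -
    have "vge \<mu> (c + real j * \<mu> \<pi>) (\<iota> (a j) * \<pi> ^ j)"
      using nz ge_c that by (intro M.vge_mult) (auto simp: vge_def M.val_power)
    then show ?thesis using pos that by (elim vge_imp_vgt) simp
  qed
  then have "same_lead \<mu> (lin \<pi> a) (\<iota> (a 0))"
    unfolding lin_split using a0 mu by (intro M.same_lead_add M.vgt_sum) auto
  then have "\<mu> (lin \<pi> a) = c" using M.same_lead_val mu(3) a0 by fastforce
  moreover have "lin \<pi> a = - (\<pi> ^ p)" using eq by (simp add: eq_neg_iff_add_eq_0 add.commute)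
  ultimately show ?thesis using nz by (simp add: M.val_power)
qed

lemma hom_on_lin:
  assumes "field_hom_on L \<sigma>" "is_subfield L" "range \<iota> \<subseteq> L" "\<pi> \<in> L"
    and "\<And>x. \<sigma> (\<iota> x) = \<iota> (\<phi> x)"
  shows "\<sigma> (lin \<pi> a) = lin (\<sigma> \<pi>) (\<phi> \<circ> a)"
proof -
  have "\<sigma> (lin \<pi> a) = (\<Sum>j<p. \<sigma> (\<iota> (a j) * \<pi> ^ j))"
    unfolding lin_def using assms
    by (intro hom_on_sum[OF assms(1,2)]) (auto intro!: subfield_mult subfield_power)
  also have "\<dots> = lin (\<sigma> \<pi>) (\<phi> \<circ> a)"
    unfolding lin_def
  proof (intro sum.cong refl)
    fix j
    have "\<iota> (a j) \<in> L" using assms by auto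
    then show "\<sigma> (\<iota> (a j) * \<pi> ^ j) = \<iota> ((\<phi> \<circ> a) j) * \<sigma> \<pi> ^ j"
      using assms subfield_power[OF assms(2,4)]
      by (simp add: hom_on_mult[OF assms(1,2)] hom_on_power[OF assms(1,2)])
  qed
  finally show ?thesis .
qed

end

text \<open>With the scale p, prime elements of totally ramified extensions of degree p have value
  1, so one valuation of K_s serves all these extensions at once.\<close>

locale scaled_extension = char_p_extension v p \<iota> + valuation \<nu>
  for v :: "'k::field \<Rightarrow> real" and p :: nat and \<iota> :: "'k \<Rightarrow> 'a::field" and \<nu> :: "'a \<Rightarrow> real" +
  assumes val_iota: "\<And>x. x \<noteq> 0 \<Longrightarrow> \<nu> (\<iota> x) = real p * v x"
begin

lemma vge_iota: "vge \<nu> (real p * r) (\<iota> x) \<longleftrightarrow> vge v r x"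
  and vgt_iota: "vgt \<nu> (real p * r) (\<iota> x) \<longleftrightarrow> vgt v r x"
  using val_iota[of x] p_pos by (cases "x = 0"; simp add: vge_def vgt_def)+

lemma vge_iota_0: "vge \<nu> 0 (\<iota> x) \<longleftrightarrow> vge v 0 x"
  and vgt_iota_0: "vgt \<nu> 0 (\<iota> x) \<longleftrightarrow> vgt v 0 x"
  using vge_iota[of 0] vgt_iota[of 0] by simp_all

lemma same_lead_iota: "same_lead \<nu> (\<iota> x) (\<iota> y) \<longleftrightarrow> same_lead v x y"
  using vgt_iota[of "v x" "x - y"] val_iota[of x] by (auto simp: same_lead_def iota_diff)

lemma val_term: "\<pi> \<noteq> 0 \<Longrightarrow> \<nu> \<pi> = 1 \<Longrightarrow> x \<noteq> 0 \<Longrightarrow> \<nu> (\<iota> x * \<pi> ^ j) = real p * v x + real j"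
  by (simp add: val_mult val_power val_iota)

lemma mod_p_unique:
  assumes "real p * x + real i = real p * y + real j" "x \<in> \<int>" "y \<in> \<int>" "i < p" "j < p"
  shows "i = j"
proof -
  obtain a b :: int where "x = of_int a" "y = of_int b" using assms by (auto elim!: Ints_cases)
  then have "real_of_int (int p * a + int i) = real_of_int (int p * b + int j)" using assms by simp
  then have "int p * a + int i = int p * b + int j" by linarith
  then have "(int p * a + int i) mod int p = (int p * b + int j) mod int p" by simp
  then show ?thesis using assms by simp
qed

text \<open>Values of elements of K are multiples of p here, so the exponent of \<pi> is the residue
  modulo p of the value of the term.\<close>

lemma val_term_inj:
  assumes "\<pi> \<noteq> 0" "\<nu> \<pi> = 1" "i < p" "j < p" "\<iota> x * \<pi> ^ i \<noteq> 0" "\<iota> y * \<pi> ^ j \<noteq> 0"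
    "\<nu> (\<iota> x * \<pi> ^ i) = \<nu> (\<iota> y * \<pi> ^ j)"
  shows "i = j"
proof -
  have "x \<noteq> 0" "y \<noteq> 0" using assms by auto
  then show ?thesis
    using assms val_in_Ints by (intro mod_p_unique[of "v x" i "v y" j]) (simp_all add: val_term)
qed

lemma lin_lead:
  assumes "\<pi> \<noteq> 0" "\<nu> \<pi> = 1" "j0 < p" "a j0 \<noteq> 0"
  shows "\<exists>i<p. a i \<noteq> 0 \<and> same_lead \<nu> (lin \<pi> a) (\<iota> (a i) * \<pi> ^ i) \<and>
     (\<forall>j<p. vge \<nu> (\<nu> (\<iota> (a i) * \<pi> ^ i)) (\<iota> (a j) * \<pi> ^ j))"
proof -
  have "\<exists>i\<in>{..<p}. same_lead \<nu> (lin \<pi> a) (\<iota> (a i) * \<pi> ^ i) \<and>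
     (\<forall>j\<in>{..<p}. vge \<nu> (\<nu> (\<iota> (a i) * \<pi> ^ i)) (\<iota> (a j) * \<pi> ^ j)) \<and>
     (\<forall>j\<in>{..<p} - {i}. vgt \<nu> (\<nu> (\<iota> (a i) * \<pi> ^ i)) (\<iota> (a j) * \<pi> ^ j))"
    unfolding lin_def using assms val_term_inj[OF assms(1,2)]
    by (intro sum_distinct_values[of _ j0]) auto
  then show ?thesis by (force simp: same_lead_def)
qed

lemma lin_eq_0:
  assumes "\<pi> \<noteq> 0" "\<nu> \<pi> = 1" "lin \<pi> a = 0" "j < p"
  shows "a j = 0"
  using lin_lead[of \<pi> j a] assms by (auto simp: same_lead_def)

text \<open>The powers of \<pi> form an orthogonal basis over K. Estimates in L thus reduce to
  estimates of the coefficients.\<close>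

lemma vge_lin:
  assumes "\<pi> \<noteq> 0" "\<nu> \<pi> = 1"
  shows "vge \<nu> r (lin \<pi> a) \<longleftrightarrow> (\<forall>j<p. vge \<nu> r (\<iota> (a j) * \<pi> ^ j))"
proof
  assume r: "vge \<nu> r (lin \<pi> a)"
  show "\<forall>j<p. vge \<nu> r (\<iota> (a j) * \<pi> ^ j)"
  proof (intro allI impI)
    fix j assume j: "j < p"
    show "vge \<nu> r (\<iota> (a j) * \<pi> ^ j)"
    proof (cases "a j = 0")
      case False
      then obtain i where i: "same_lead \<nu> (lin \<pi> a) (\<iota> (a i) * \<pi> ^ i)"
        "vge \<nu> (\<nu> (\<iota> (a i) * \<pi> ^ i)) (\<iota> (a j) * \<pi> ^ j)"
        using lin_lead[OF assms j, of a] j by blast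
      then have "r \<le> \<nu> (\<iota> (a i) * \<pi> ^ i)"
        using r same_lead_val[OF i(1)] by (auto simp: same_lead_def vge_def)
      then show ?thesis using i(2) vge_mono by blast
    qed simp
  qed
qed (auto simp: lin_def intro: vge_sum)

end

text \<open>The working form of the hypotheses on L. It is derived from the definitions in
  \<open>tot_ramI\<close>, and from a root of an Eisenstein equation in
  \<open>lin_tot_ram\<close>.\<close>

locale tot_ram = scaled_extension v p \<iota> \<nu>
  for v :: "'k::field \<Rightarrow> real" and p :: nat and \<iota> :: "'k \<Rightarrow> 'a::field" and \<nu> :: "'a \<Rightarrow> real" +
  fixes L :: "'a set"
  assumes subfield: "is_subfield L"
    and iota_L: "range \<iota> \<subseteq> L"
    and val_L: "\<And>x. x \<in> L \<Longrightarrow> x \<noteq> 0 \<Longrightarrow> \<nu> x \<in> \<int>"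
    and prime_exists: "\<exists>\<pi>\<in>L. \<pi> \<noteq> 0 \<and> \<nu> \<pi> = 1"
    and generated: "\<And>\<pi>. \<pi> \<in> L \<Longrightarrow> \<pi> \<noteq> 0 \<Longrightarrow> \<nu> \<pi> = 1 \<Longrightarrow> L = range (lin \<pi>)"
begin

lemma L_int: "x \<in> L \<Longrightarrow> vgt \<nu> (of_int z) x \<longleftrightarrow> vge \<nu> (of_int z + 1) x"
  using val_L[of x] by (cases "x = 0") (auto simp: vge_def vgt_def elim!: Ints_cases)

lemma complete_L: "val_complete \<nu> L"
  unfolding val_complete_def
proof (intro allI impI)
  fix s :: "nat \<Rightarrow> 'a"
  assume "\<forall>n. s n \<in> L \<and> vge \<nu> (real n) (s (Suc n) - s n)"
  then have s: "s n \<in> L" "vge \<nu> (real n) (s (Suc n) - s n)" for n by auto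
  obtain \<pi> where \<pi>: "\<pi> \<in> L" "\<pi> \<noteq> 0" "\<nu> \<pi> = 1" using prime_exists by blast
  have tele: "vge \<nu> (real N) (s m - s N)" if "m \<ge> N" for m N
    by (rule vge_telescope[where s = s]) (use that vge_mono[OF s(2)] in simp_all)
  \<comment> \<open>Precision p (k + 1) in L gives precision k in each coefficient, since the factor
    \<pi>^j with j < p costs less than p.\<close>
  define r where "r k = p * Suc k" for k
  have "\<forall>k. \<exists>a. s (r k) = lin \<pi> a" using s(1) generated[OF \<pi>] by blast
  then obtain a where a: "\<And>k. s (r k) = lin \<pi> (a k)" by metis
  have "vge v (real k) (a (Suc k) j - a k j)" if j: "j < p" for k j
  proof -
    have "vge \<nu> (real (r k)) (s (r (Suc k)) - s (r k))" by (rule tele) (simp add: r_def)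
    then have "vge \<nu> (real (r k)) (\<iota> (a (Suc k) j - a k j) * \<pi> ^ j)"
      using j by (simp add: a lin_diff vge_lin[OF \<pi>(2,3)])
    moreover define d where "d = a (Suc k) j - a k j"
    ultimately have ge: "vge \<nu> (real (r k)) (\<iota> d * \<pi> ^ j)" by simp
    have "vge v (real k) d"
    proof (cases "d = 0")
      case False
      then have "real (r k) \<le> real p * v d + real j"
        using ge \<pi>(2) unfolding vge_def val_term[OF \<pi>(2,3) False] by simp
      then have "real p * real k + real p \<le> real p * v d + real j"
        by (simp add: r_def algebra_simps)
      then have "real p * real k \<le> real p * v d" using j by linarith
      then show ?thesis using p_pos by (simp add: vge_def)
    qed simp
    then show ?thesis by (simp add: d_def)
  qed
  then have "\<forall>j. \<exists>l. j < p \<longrightarrow> (\<forall>k. vge v (real k) (a k j - l))"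
    using complete unfolding val_complete_def by simp
  then obtain l where l: "\<And>j k. j < p \<Longrightarrow> vge v (real k) (a k j - l j)" by metis
  have lim: "vge \<nu> (real p * real k) (s (r k) - lin \<pi> l)" for k
  proof -
    have "vge \<nu> (real p * real k + 0) (\<iota> (a k j - l j) * \<pi> ^ j)" if "j < p" for j
      using l[OF that, of k] \<pi>
      by (intro vge_mult) (simp_all only: vge_iota, simp add: vge_def val_power)
    then show ?thesis by (simp add: a lin_diff vge_lin[OF \<pi>(2,3)])
  qed
  have "vge \<nu> (real n) (s n - lin \<pi> l)" for n
  proof -
    have "real n \<le> real p * real n" using p_pos by (simp add: mult_le_cancel_right1)
    then have "vge \<nu> (real n) (s (r n) - lin \<pi> l)" by (rule vge_mono[OF lim])
    moreover have "n \<le> r n" using p_pos by (simp add: r_def trans_le_add2)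
    then have "vge \<nu> (real n) (s (r n) - s n)" by (rule tele)
    ultimately have "vge \<nu> (real n) ((s (r n) - lin \<pi> l) - (s (r n) - s n))" by (rule vge_diff)
    then show ?thesis by simp
  qed
  then show "\<exists>l\<in>L. \<forall>n. vge \<nu> (real n) (s n - l)"
    using lin_mem[OF subfield iota_L \<pi>(1)] by blast
qed

text \<open>L has the same residue field as K: a term a_j \<pi>^j with 0 < j < p has a value prime
  to p, hence not 0, so only a_0 contributes to the residue.\<close>

lemma residue_L:
  assumes x: "x \<in> L" "vge \<nu> 0 x"
  shows "\<exists>c\<in>T. vgt \<nu> 0 (x - \<iota> c)"
proof -
  obtain \<pi> where \<pi>: "\<pi> \<in> L" "\<pi> \<noteq> 0" "\<nu> \<pi> = 1" using prime_exists by blast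
  obtain a where a: "x = lin \<pi> a" using x generated[OF \<pi>] by auto
  have ge: "vge \<nu> 0 (\<iota> (a j) * \<pi> ^ j)" if "j < p" for j
    using x(2) that by (simp add: a vge_lin[OF \<pi>(2,3)])
  have "vge v 0 (a 0)" using ge[of 0] p_pos by (simp add: vge_iota_0)
  then obtain c where c: "c \<in> T" "vgt v 0 (a 0 - c)" using T_approx by blast
  have "vgt \<nu> 0 (\<iota> (a j) * \<pi> ^ j)" if "j \<in> {1..<p}" for j
  proof (cases "a j = 0")
    case False
    then have "\<nu> (\<iota> (a j) * \<pi> ^ j) \<noteq> 0"
      using mod_p_unique[of "v (a j)" j 0 0] val_in_Ints that p_pos
      by (auto simp: val_term[OF \<pi>(2,3)])
    then show ?thesis using ge[of j] that by (auto simp: vge_def vgt_def)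
  qed simp
  then have "vgt \<nu> 0 (\<iota> (a 0 - c) + (\<Sum>j\<in>{1..<p}. \<iota> (a j) * \<pi> ^ j))"
    using c by (intro vgt_add vgt_sum) (auto simp: vgt_iota_0)
  then show ?thesis using c(1) by (auto simp: a lin_split iota_diff algebra_simps)
qed

lemma T_val': "c \<in> T \<Longrightarrow> c \<noteq> 0 \<Longrightarrow> \<nu> (\<iota> c) = 0"
  by (simp add: val_iota T_val)

lemma same_lead_residue:
  assumes "x \<in> L" "x \<noteq> 0" "\<nu> x = 0"
  obtains c where "c \<in> Tx" "same_lead \<nu> x (\<iota> c)"
proof -
  obtain c where c: "c \<in> T" "vgt \<nu> 0 (x - \<iota> c)" using residue_L[of x] assms by (auto simp: vge_def)
  have "same_lead \<nu> x (\<iota> c)" using assms c by (intro same_lead_iff) auto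
  then show ?thesis using c by (intro that) (auto simp: Tx_def same_lead_def)
qed

lemma Tx_same_lead:
  assumes "c \<in> Tx" "d \<in> Tx" "same_lead \<nu> (\<iota> c) (\<iota> d)"
  shows "c = d"
  using assms T_val[of c] unfolding same_lead_iota
  by (intro T_eq) (auto simp: same_lead_def Tx_def)

text \<open>In the expansion of - \<pi>^p the leading term has value p, which is a multiple of p, so
  it is the constant term. The other terms have value at least p with exponent j < p, which forces
  v(a_j) > 0.\<close>

lemma eisenstein_exists:
  assumes \<pi>: "\<pi> \<in> L" "\<pi> \<noteq> 0" "\<nu> \<pi> = 1"
  shows "\<exists>a. eisenstein \<pi> a"
proof -
  have "- (\<pi> ^ p) \<in> L" using \<pi> subfield by (intro subfield_minus subfield_power)
  then obtain a where a: "- (\<pi> ^ p) = lin \<pi> a" using generated[OF \<pi>] by auto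
  have "\<exists>j<p. a j \<noteq> 0" using a \<pi> by (intro lin_nonzero[of \<pi>]) auto
  then obtain i where i: "i < p" "a i \<noteq> 0" "same_lead \<nu> (lin \<pi> a) (\<iota> (a i) * \<pi> ^ i)"
     "\<forall>j<p. vge \<nu> (\<nu> (\<iota> (a i) * \<pi> ^ i)) (\<iota> (a j) * \<pi> ^ j)"
    using lin_lead[OF \<pi>(2,3)] by blast
  have "\<nu> (lin \<pi> a) = real p" using \<pi> by (simp add: val_power flip: a)
  then have vi: "\<nu> (\<iota> (a i) * \<pi> ^ i) = real p" using same_lead_val[OF i(3)] by simp
  then have "real p * v (a i) + real i = real p * 1 + real 0" using i \<pi> by (simp add: val_term)
  then have "i = 0" using i p_pos val_in_Ints by (intro mod_p_unique[of "v (a i)" i 1 0]) simp_all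
  have "v (a 0) = 1" using vi i \<open>i = 0\<close> p_pos val_iota[of "a 0"] by simp
  moreover have "vge v 1 (a j)" if "j < p" for j
  proof (cases "a j = 0")
    case False
    then have "real p \<le> real p * v (a j) + real j"
      using i(4) that \<pi>(2) False unfolding vi vge_def by (auto simp flip: val_term[OF \<pi>(2,3) False])
    then have "real p * v (a j) > 0" using that by linarith
    then have "vgt v 0 (a j)" using p_pos by (simp add: vgt_def zero_less_mult_iff)
    then show ?thesis by (simp add: vgt_0_iff)
  qed simp
  ultimately show ?thesis
    using i(2) \<open>i = 0\<close> a unfolding eisenstein_def
    by (intro exI[of _ a]) (auto simp flip: a)
qed

end

section \<open>Ramification\<close>

context scaled_extension
begin

lemma powers_basis:
  assumes \<pi>: "\<pi> \<noteq> 0" "\<nu> \<pi> = 1"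
  shows inj_powers: "inj_on ((^) \<pi>) {..<p}"
    and independent_powers: "\<not> V.dependent ((^) \<pi> ` {..<p})"
    and span_powers: "V.span ((^) \<pi> ` {..<p}) = range (lin \<pi>)"
proof -
  show inj: "inj_on ((^) \<pi>) {..<p}"
    using \<pi> val_power[OF \<pi>(1)] by (intro inj_onI) (metis mult.right_neutral of_nat_eq_iff)
  have sum: "(\<Sum>x\<in>(^) \<pi> ` {..<p}. \<iota> (u x) * x) = lin \<pi> (\<lambda>j. u (\<pi> ^ j))" for u
    by (simp add: lin_def sum.reindex[OF inj])
  show "\<not> V.dependent ((^) \<pi> ` {..<p})"
    by (subst V.dependent_finite) (use sum lin_eq_0[OF \<pi>] in fastforce)+
  have "range (lin \<pi>) \<subseteq> range (\<lambda>u. \<Sum>x\<in>(^) \<pi> ` {..<p}. \<iota> (u x) * x)"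
  proof
    fix x assume "x \<in> range (lin \<pi>)"
    then obtain a where a: "x = lin \<pi> a" by auto
    have "x = lin \<pi> (\<lambda>j. (a \<circ> inv_into {..<p} ((^) \<pi>)) (\<pi> ^ j))"
      unfolding a lin_def using inj by (intro sum.cong) auto
    then show "x \<in> range (\<lambda>u. \<Sum>x\<in>(^) \<pi> ` {..<p}. \<iota> (u x) * x)"
      unfolding sum[symmetric] by blast
  qed
  then show "V.span ((^) \<pi> ` {..<p}) = range (lin \<pi>)"
    by (subst V.span_finite) (auto simp: sum)
qed

lemma ext_degree_lin:
  assumes "\<pi> \<noteq> 0" "\<nu> \<pi> = 1"
  shows "ext_degree \<iota> (range (lin \<pi>)) = p"
  using V.dim_span_eq_card_independent[OF independent_powers[OF assms]]
    card_image[OF inj_powers[OF assms]]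
  by (simp add: ext_degree_def span_powers[OF assms])

lemma generated_by_prime:
  assumes L: "is_subfield L" "range \<iota> \<subseteq> L" "ext_degree \<iota> L = p"
    and \<pi>: "\<pi> \<in> L" "\<pi> \<noteq> 0" "\<nu> \<pi> = 1"
  shows "L = range (lin \<pi>)"
proof
  show "range (lin \<pi>) \<subseteq> L" using lin_mem L \<pi> by blast
  let ?B = "(^) \<pi> ` {..<p}"
  have "?B \<subseteq> L" using subfield_power L \<pi> by blast
  obtain B where B: "B \<subseteq> L" "\<not> V.dependent B" "L \<subseteq> V.span B" "card B = p"
    using V.basis_exists[of L] L(3) unfolding ext_degree_def by metis
  \<comment> \<open>That the cardinality is p > 0 matters: infinite sets have cardinality 0.\<close>
  have "finite B" using B(4) p_pos card_ge_0_finite by metis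
  show "L \<subseteq> range (lin \<pi>)"
  proof
    fix x assume x: "x \<in> L"
    show "x \<in> range (lin \<pi>)"
    proof (rule ccontr)
      assume "x \<notin> range (lin \<pi>)"
      then have "x \<notin> V.span ?B" by (simp add: span_powers[OF \<pi>(2,3)])
      then have ind: "\<not> V.dependent (insert x ?B)" "x \<notin> ?B"
        using V.independent_insertI[OF _ independent_powers[OF \<pi>(2,3)]] V.span_base[of x ?B] by auto
      have "card (insert x ?B) \<le> card B"
        using V.independent_span_bound[OF \<open>finite B\<close> ind(1)] \<open>?B \<subseteq> L\<close> x B(3) by blast
      then show False using ind(2) B(4) card_image[OF inj_powers[OF \<pi>(2,3)]] by simp
    qed
  qed
qed

lemma eisenstein_prime: "eisenstein \<pi> a \<Longrightarrow> \<pi> \<noteq> 0 \<and> \<nu> \<pi> = 1"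
  using eisenstein_val[OF valuation, of p \<pi> a] val_iota p_pos by simp

text \<open>Put y = \<rho> - \<pi>. Subtracting the two Eisenstein equations leaves y^p on one side
  and, to first order in y, the negative of y f'(\<pi>) on the other. The terms of f'(\<pi>) have
  distinct values, so one of them leads; then y is cancelled. The assumption on the value of y makes
  the higher-order terms negligible.\<close>

lemma ramification_equation:
  assumes \<pi>: "eisenstein \<pi> a" and \<rho>: "eisenstein \<rho> a" "\<rho> \<noteq> \<pi>" and gt: "\<nu> (\<rho> - \<pi>) > 1"
  shows "\<exists>i\<in>{1..<p}. a i \<noteq> 0 \<and>
           same_lead \<nu> ((\<rho> - \<pi>) ^ (p - 1)) (- (\<iota> (a i) * of_nat i * \<pi> ^ (i - 1))) \<and>
           (\<forall>j\<in>{1..<p}. vge \<nu> (real p * v (a i) + real i) (\<iota> (a j) * \<pi> ^ j))"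
proof -
  define y where "y = \<rho> - \<pi>"
  have y: "y \<noteq> 0" "\<nu> y > 1" "\<rho> = \<pi> + y" using \<rho> gt by (auto simp: y_def)
  have pr: "\<pi> \<noteq> 0" "\<nu> \<pi> = 1" using eisenstein_prime[OF \<pi>] by auto
  define g where "g j = \<iota> (a j) * of_nat j * \<pi> ^ (j - 1)" for j
  define e where "e j = \<rho> ^ j - \<pi> ^ j - of_nat j * \<pi> ^ (j - 1) * y" for j
  have "\<pi> ^ p + lin \<pi> a = 0" "\<rho> ^ p + lin \<rho> a = 0"
    using \<pi> \<rho> by (auto simp: eisenstein_def)
  then have "\<rho> ^ p - \<pi> ^ p = lin \<pi> a - lin \<rho> a" by (simp add: algebra_simps add_eq_0_iff2)
  then have "y ^ p = lin \<pi> a - lin \<rho> a" by (simp add: y_def frobenius_diff')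
  also have "\<dots> = - (\<Sum>j\<in>{1..<p}. g j * y + \<iota> (a j) * e j)"
    by (simp add: lin_split g_def e_def algebra_simps sum_subtractf)
  finally have yp: "y ^ p = - (sum g {1..<p} * y + (\<Sum>j\<in>{1..<p}. \<iota> (a j) * e j))"
    by (simp add: sum.distrib sum_distrib_right)
  have of_nat_nz: "(of_nat j :: 'a) \<noteq> 0" "\<nu> (of_nat j) = 0" if "j \<in> {1..<p}" for j
    using of_nat_Tx[of j] that val_iota[of "of_nat j"] T_val[of "of_nat j"]
    by (auto simp: Tx_def simp flip: iota_of_nat)
  have g_val: "\<nu> (g j) = real p * v (a j) + real j - 1" if "j \<in> {1..<p}" "a j \<noteq> 0" for j
    using that pr of_nat_nz[OF that(1)] by (simp add: g_def val_mult val_power val_iota of_nat_diff)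
  have "\<exists>j\<in>{1..<p}. a j \<noteq> 0"
  proof (rule ccontr)
    assume "\<not> (\<exists>j\<in>{1..<p}. a j \<noteq> 0)"
    then have "y ^ p = 0" unfolding yp by (simp add: g_def)
    then show False using y by simp
  qed
  then obtain j0 where j0: "j0 \<in> {1..<p}" "a j0 \<noteq> 0" by blast
  have "\<exists>i\<in>{1..<p}. same_lead \<nu> (sum g {1..<p}) (g i) \<and> (\<forall>j\<in>{1..<p}. vge \<nu> (\<nu> (g i)) (g j)) \<and>
      (\<forall>j\<in>{1..<p} - {i}. vgt \<nu> (\<nu> (g i)) (g j))"
  proof (rule sum_distinct_values[OF _ j0(1)])
    show "g j0 \<noteq> 0" using j0 pr of_nat_nz by (simp add: g_def)
    fix i j assume ij: "i \<in> {1..<p}" "j \<in> {1..<p}" "g i \<noteq> 0" "g j \<noteq> 0" "\<nu> (g i) = \<nu> (g j)"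
    then have "a i \<noteq> 0" "a j \<noteq> 0" by (auto simp: g_def)
    then show "i = j"
      using ij g_val val_in_Ints by (intro mod_p_unique[of "v (a i)" i "v (a j)" j]) auto
  qed simp
  then obtain i where i: "i \<in> {1..<p}" "same_lead \<nu> (sum g {1..<p}) (g i)"
    "\<And>j. j \<in> {1..<p} \<Longrightarrow> vge \<nu> (\<nu> (g i)) (g j)" by blast
  have ai: "a i \<noteq> 0" "g i \<noteq> 0" using i(2) by (auto simp: same_lead_def g_def)
  \<comment> \<open>The error of the j-th term beyond first order is strictly smaller than
    \<open>g j * y\<close>, hence than the leading \<open>g i * y\<close>.\<close>
  have "vgt \<nu> (\<nu> (g i) + \<nu> y) (\<iota> (a j) * e j)" if j: "j \<in> {1..<p}" for j
  proof (cases "a j = 0")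
    case False
    have "vgt \<nu> ((real j - 1) * 1 + \<nu> y) (e j)"
      using vgt_power_diff_first_order[OF pr(1) y(1), of j] y pr by (simp add: e_def)
    then have "vgt \<nu> (\<nu> (\<iota> (a j)) + ((real j - 1) * 1 + \<nu> y)) (\<iota> (a j) * e j)"
      by (intro vge_vgt_mult) simp_all
    moreover have "\<nu> (g i) \<le> \<nu> (g j)"
      using i(3)[OF j] False of_nat_nz[OF j] pr by (auto simp: vge_def g_def)
    ultimately show ?thesis
      using False g_val[OF j False] by (elim vgt_mono) (simp add: val_iota)
  qed simp
  then have "vgt \<nu> (\<nu> (g i) + \<nu> y) (\<Sum>j\<in>{1..<p}. \<iota> (a j) * e j)" by (rule vgt_sum)
  moreover have gy: "same_lead \<nu> (sum g {1..<p} * y) (g i * y)"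
    using i y by (intro same_lead_mult same_lead_refl)
  moreover have "\<nu> (sum g {1..<p} * y) = \<nu> (g i) + \<nu> y"
    using same_lead_val[OF gy] ai y by (simp add: val_mult)
  ultimately have "same_lead \<nu> (y ^ p) (- (g i * y))"
    unfolding yp by (intro same_lead_minus same_lead_add_left) simp_all
  then have "same_lead \<nu> (y ^ p / y) (- (g i * y) / y)"
    using y by (intro same_lead_divide same_lead_refl)
  moreover have "y ^ p / y = y ^ (p - 1)" using y p_pos by (cases p) auto
  ultimately have "same_lead \<nu> (y ^ (p - 1)) (- g i)" using y by simp
  moreover have "vge \<nu> (real p * v (a i) + real i) (\<iota> (a j) * \<pi> ^ j)" if j: "j \<in> {1..<p}" for j
  proof (cases "a j = 0")
    case False
    then have "\<nu> (g i) \<le> \<nu> (g j)" using i(3)[OF j] of_nat_nz[OF j] pr by (auto simp: vge_def g_def)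
    then show ?thesis
      using g_val[OF i(1) ai(1)] g_val[OF j False] val_term[OF pr False, of j] by (simp add: vge_def)
  qed simp
  ultimately show ?thesis using i(1) ai(1) by (auto simp: g_def y_def)
qed

text \<open>Here the dominating coefficient is known, and the lower bound on \<rho> - \<pi> is
  deduced from it. If the value were 1, then (\<rho> - \<pi>)^p would have value p, but it is a sum
  of differences a_j \<pi>^j - a_j \<rho>^j, all of value at least p + 1.\<close>

lemma ramification_equation':
  assumes \<pi>: "eisenstein \<pi> a" and \<rho>: "eisenstein \<rho> a" "\<rho> \<noteq> \<pi>"
    and k: "k \<in> {1..<p}" "a k \<noteq> 0"
    and min: "\<And>j. j \<in> {1..<p} \<Longrightarrow> vge \<nu> (real p * v (a k) + real k) (\<iota> (a j) * \<pi> ^ j)"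
  shows "\<nu> (\<rho> - \<pi>) > 1"
    and "same_lead \<nu> ((\<rho> - \<pi>) ^ (p - 1)) (- (\<iota> (a k) * of_nat k * \<pi> ^ (k - 1)))"
proof -
  have pr: "\<pi> \<noteq> 0" "\<nu> \<pi> = 1" "\<rho> \<noteq> 0" "\<nu> \<rho> = 1"
    using eisenstein_prime[OF \<pi>] eisenstein_prime[OF \<rho>(1)] by auto
  have "v (a k) \<ge> 1" using \<pi> k by (auto simp: eisenstein_def vge_def)
  then have vk: "real p * v (a k) \<ge> real p" using p_pos by simp
  have "vge \<nu> 1 (\<rho> - \<pi>)" using pr by (intro vge_diff) (auto simp: vge_def)
  then have ge1: "\<nu> (\<rho> - \<pi>) \<ge> 1" using \<rho> by (simp add: vge_def)
  show gt: "\<nu> (\<rho> - \<pi>) > 1"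
  proof (rule ccontr)
    assume "\<not> \<nu> (\<rho> - \<pi>) > 1"
    then have one: "\<nu> (\<rho> - \<pi>) = 1" using ge1 by simp
    have "\<pi> ^ p + lin \<pi> a = 0" "\<rho> ^ p + lin \<rho> a = 0"
      using \<pi> \<rho> by (auto simp: eisenstein_def)
    then have "\<rho> ^ p - \<pi> ^ p = lin \<pi> a - lin \<rho> a" by (simp add: algebra_simps add_eq_0_iff2)
    then have eq: "(\<rho> - \<pi>) ^ p = (\<Sum>j\<in>{1..<p}. \<iota> (a j) * \<pi> ^ j - \<iota> (a j) * \<rho> ^ j)"
      by (simp add: frobenius_diff' lin_split sum_subtractf)
    have "vge \<nu> (real p + 1) (\<iota> (a j) * \<pi> ^ j - \<iota> (a j) * \<rho> ^ j)" if j: "j \<in> {1..<p}" for j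
    proof (cases "a j = 0")
      case False
      have "real p * v (a k) + real k \<le> real p * v (a j) + real j"
        using min[OF j] val_term[OF pr(1,2) False, of j] False pr by (simp add: vge_def)
      moreover have "1 \<le> real k" using k by simp
      ultimately have "real p + 1 \<le> real p * v (a j) + real j" using vk by linarith
      then show ?thesis
        using val_term[OF pr(1,2) False, of j] val_term[OF pr(3,4) False, of j]
        by (intro vge_diff) (simp_all add: vge_def)
    qed simp
    then have "vge \<nu> (real p + 1) ((\<rho> - \<pi>) ^ p)" unfolding eq by (rule vge_sum)
    then show False using \<rho> one by (simp add: vge_def val_power)
  qed
  obtain i where i: "i \<in> {1..<p}" "a i \<noteq> 0"
    "same_lead \<nu> ((\<rho> - \<pi>) ^ (p - 1)) (- (\<iota> (a i) * of_nat i * \<pi> ^ (i - 1)))"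
    "\<And>j. j \<in> {1..<p} \<Longrightarrow> vge \<nu> (real p * v (a i) + real i) (\<iota> (a j) * \<pi> ^ j)"
    using ramification_equation[OF \<pi> \<rho> gt] by blast
  have "real p * v (a k) + real k = real p * v (a i) + real i"
    using min[OF i(1)] i(4)[OF k(1)] val_term[OF pr(1,2) i(2), of i] val_term[OF pr(1,2) k(2), of k]
      i(2) k(2) pr by (simp add: vge_def)
  then have "k = i" using i k val_in_Ints by (intro mod_p_unique[of "v (a k)" k "v (a i)" i]) auto
  then show "same_lead \<nu> ((\<rho> - \<pi>) ^ (p - 1)) (- (\<iota> (a k) * of_nat k * \<pi> ^ (k - 1)))"
    using i by simp
qed

end

context tot_ram
begin

lemma K_embedding_iota: "K_embedding \<iota> L \<sigma> \<Longrightarrow> \<sigma> (\<iota> x) = \<iota> x"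
  and K_embedding_hom: "K_embedding \<iota> L \<sigma> \<Longrightarrow> field_hom_on L \<sigma>"
  by (auto simp: K_embedding_def)

lemma K_embedding_lin:
  assumes "K_embedding \<iota> L \<sigma>" "\<pi> \<in> L"
  shows "\<sigma> (lin \<pi> a) = lin (\<sigma> \<pi>) a"
  using hom_on_lin[OF K_embedding_hom[OF assms(1)] subfield iota_L assms(2), of id]
    K_embedding_iota[OF assms(1)] by (simp add: comp_def)

lemma K_embedding_eisenstein:
  assumes \<sigma>: "K_embedding \<iota> L \<sigma>" and \<pi>: "\<pi> \<in> L" "eisenstein \<pi> a"
  shows "eisenstein (\<sigma> \<pi>) a"
proof -
  note hom = K_embedding_hom[OF \<sigma>]
  have "\<sigma> (\<pi> ^ p + lin \<pi> a) = \<sigma> \<pi> ^ p + lin (\<sigma> \<pi>) a"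
    using \<pi>(1) hom_on_add[OF hom subfield] hom_on_power[OF hom subfield] K_embedding_lin[OF \<sigma> \<pi>(1)]
      subfield_power[OF subfield] lin_mem[OF subfield iota_L] by simp
  then show ?thesis using \<pi>(2) hom_on_0[OF hom subfield] by (simp add: eisenstein_def)
qed

lemma K_embedding_moves:
  assumes \<sigma>: "K_embedding \<iota> L \<sigma>" "\<exists>x\<in>L. \<sigma> x \<noteq> x" and \<pi>: "\<pi> \<in> L" "\<pi> \<noteq> 0" "\<nu> \<pi> = 1"
  shows "\<sigma> \<pi> \<noteq> \<pi>"
proof
  assume eq: "\<sigma> \<pi> = \<pi>"
  obtain x where x: "x \<in> L" "\<sigma> x \<noteq> x" using \<sigma>(2) by blast
  then obtain a where "x = lin \<pi> a" using generated[OF \<pi>] by auto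
  then show False using x K_embedding_lin[OF \<sigma>(1) \<pi>(1)] eq by simp
qed

text \<open>Expanding \<pi>' in powers of \<pi> gives leading term c \<pi>, and \<sigma> moves
  \<pi>' by c times what it moves \<pi>, to leading order. The same c occurs twice: this yields both
  the independence of the ramification number from \<pi> and the change of w by an m-th
  power.\<close>

lemma change_prime:
  assumes \<sigma>: "K_embedding \<iota> L \<sigma>"
    and \<pi>: "\<pi> \<in> L" "\<pi> \<noteq> 0" "\<nu> \<pi> = 1" and \<pi>': "\<pi>' \<in> L" "\<pi>' \<noteq> 0" "\<nu> \<pi>' = 1"
    and moved: "\<sigma> \<pi> \<noteq> \<pi>" "\<nu> (\<sigma> \<pi> - \<pi>) > 1"
  shows "\<exists>c\<in>Tx. same_lead \<nu> \<pi>' (\<iota> c * \<pi>) \<and> same_lead \<nu> (\<sigma> \<pi>' - \<pi>') (\<iota> c * (\<sigma> \<pi> - \<pi>))"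
proof -
  define y where "y = \<sigma> \<pi> - \<pi>"
  have y: "y \<noteq> 0" "\<nu> y > 1" "\<sigma> \<pi> = \<pi> + y" using moved by (auto simp: y_def)
  obtain a where a: "\<pi>' = lin \<pi> a" using \<pi>' generated[OF \<pi>] by auto
  have ge: "vge \<nu> 1 (\<iota> (a j) * \<pi> ^ j)" if "j < p" for j
    using vge_lin[OF \<pi>(2,3), of 1 a] \<pi>' that unfolding a by (simp add: vge_def)
  have va: "vge v 0 (a j)" if "j < p" for j
  proof (cases "a j = 0")
    case False
    then have "1 \<le> real p * v (a j) + real j"
      using ge[OF that] \<pi>(2) by (simp add: vge_def flip: val_term[OF \<pi>(2,3) False])
    then have pos: "real p * v (a j) + real p > 0" using that by linarith
    obtain z where z: "v (a j) = of_int z" using val_in_Ints[OF False] by (auto elim: Ints_cases)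
    have "real p * (v (a j) + 1) > 0" using pos by (simp add: algebra_simps)
    then have "v (a j) + 1 > 0" using p_pos by (simp add: zero_less_mult_iff)
    then show ?thesis using z by (simp add: vge_def)
  qed simp
  have "\<exists>j<p. a j \<noteq> 0" using \<pi>' a by (intro lin_nonzero[of \<pi>]) simp
  then obtain i where i: "i < p" "a i \<noteq> 0" "same_lead \<nu> \<pi>' (\<iota> (a i) * \<pi> ^ i)"
    using lin_lead[OF \<pi>(2,3), of _ a] unfolding a by blast
  have "real p * v (a i) + real i = real p * 0 + real 1"
    using same_lead_val[OF i(3)] \<pi>' val_term[OF \<pi>(2,3) i(2), of i] by simp
  then have "i = 1" and v1: "v (a 1) = 0"
    using mod_p_unique[of "v (a i)" i 0 1] i val_in_Ints[of "a i"] p_gt_1 by auto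
  obtain c where c: "c \<in> T" "vgt v 0 (a 1 - c)" using T_approx[OF va[of 1]] p_gt_1 by blast
  have "same_lead v (a 1) c" using c i v1 \<open>i = 1\<close>
    by (intro valuation.same_lead_iff[OF valuation_v]) auto
  then have lc: "same_lead \<nu> (\<iota> (a 1)) (\<iota> c)" and cx: "c \<in> Tx"
    using c unfolding same_lead_iota by (auto simp: same_lead_def Tx_def)
  have lead1: "same_lead \<nu> \<pi>' (\<iota> c * \<pi>)"
    using same_lead_trans[OF i(3)] same_lead_mult[OF lc same_lead_refl[OF \<pi>(2)]] \<open>i = 1\<close> by simp
  have "\<sigma> \<pi>' - \<pi>' = lin (\<pi> + y) a - lin \<pi> a"
    unfolding a K_embedding_lin[OF \<sigma> \<pi>(1)] y(3) ..
  also have "\<dots> = (\<Sum>j\<in>{1..<p}. \<iota> (a j) * ((\<pi> + y) ^ j - \<pi> ^ j))"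
    by (simp add: lin_split algebra_simps sum_subtractf)
  also have "{1..<p} = insert 1 {2..<p}" using p_gt_1 by auto
  also have "(\<Sum>j\<in>insert 1 {2..<p}. \<iota> (a j) * ((\<pi> + y) ^ j - \<pi> ^ j))
      = \<iota> (a 1) * y + (\<Sum>j\<in>{2..<p}. \<iota> (a j) * ((\<pi> + y) ^ j - \<pi> ^ j))"
    by simp
  finally have diff: "\<sigma> \<pi>' - \<pi>' = \<iota> (a 1) * y + (\<Sum>j\<in>{2..<p}. \<iota> (a j) * ((\<pi> + y) ^ j - \<pi> ^ j))" .
  \<comment> \<open>For j at least 2 the difference of j-th powers gains j - 1 > 0 over y; the
    constant term of the expansion has cancelled.\<close>
  have "vgt \<nu> (\<nu> y) (\<iota> (a j) * ((\<pi> + y) ^ j - \<pi> ^ j))" if j: "j \<in> {2..<p}" for j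
  proof -
    have "vge \<nu> 1 (\<pi> + y)" using \<pi> y by (intro vge_add) (auto simp: vge_def)
    then have "vge \<nu> ((real j - 1) * 1 + \<nu> y) ((\<pi> + y) ^ j - \<pi> ^ j)"
      using \<pi> by (intro vge_power_diff) (auto simp: vge_def)
    then have "vge \<nu> (real j - 1 + \<nu> y) (\<iota> (a j) * ((\<pi> + y) ^ j - \<pi> ^ j))"
      using va[of j] j by (intro vge_mult_0) (auto simp: vge_iota_0)
    then show ?thesis using j by (elim vge_imp_vgt) auto
  qed
  then have "same_lead \<nu> (\<sigma> \<pi>' - \<pi>') (\<iota> c * y)"
    unfolding diff using y lc v1 i \<open>i = 1\<close>
    by (intro same_lead_add_left same_lead_mult same_lead_refl vgt_sum) (auto simp: val_mult val_iota)
  then show ?thesis using cx lead1 by (auto simp: y_def)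
qed

end

lemma Ints_unit: "x \<in> \<int> \<Longrightarrow> y \<in> \<int> \<Longrightarrow> x * y = 1 \<Longrightarrow> x > 0 \<Longrightarrow> x = (1::real)"
proof -
  assume "x \<in> \<int>" "y \<in> \<int>" and xy: "x * y = 1" "x > 0"
  then obtain a b where ab: "x = of_int a" "y = of_int b" by (auto elim!: Ints_cases)
  then have "a * b = 1" using xy by (simp flip: of_int_mult)
  then have "a = 1" using xy ab by (auto simp: zmult_eq_1_iff)
  then show ?thesis using ab by simp
qed

section \<open>Homomorphisms defined on an extension generated by an Eisenstein root\<close>

lemma poly_map_poly_hom:
  assumes "field_hom_on (UNIV :: 'k::field set) (\<kappa> :: 'k \<Rightarrow> 'a::field)"
  shows poly_map_add: "poly (map_poly \<kappa> (f + g)) x = poly (map_poly \<kappa> f) x + poly (map_poly \<kappa> g) x"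
    and poly_map_diff: "poly (map_poly \<kappa> (f - g)) x = poly (map_poly \<kappa> f) x - poly (map_poly \<kappa> g) x"
    and poly_map_mult: "poly (map_poly \<kappa> (f * g)) x = poly (map_poly \<kappa> f) x * poly (map_poly \<kappa> g) x"
proof -
  have sf: "is_subfield (UNIV :: 'k set)" by (simp add: is_subfield_def)
  note hom = hom_on_subfield[OF assms sf, simplified]
  note pc = map_poly_pCons[of \<kappa>, OF hom(1)]
  show add: "poly (map_poly \<kappa> (f + g)) x = poly (map_poly \<kappa> f) x + poly (map_poly \<kappa> g) x" for f g
    by (induction f g rule: poly_induct2) (simp_all add: pc hom algebra_simps)
  have minus: "poly (map_poly \<kappa> (- g)) x = - poly (map_poly \<kappa> g) x" for g
    by (induction g) (simp_all add: pc hom)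
  show "poly (map_poly \<kappa> (f - g)) x = poly (map_poly \<kappa> f) x - poly (map_poly \<kappa> g) x"
    using add[of f "- g"] minus[of g] by simp
  have smult: "poly (map_poly \<kappa> (smult c g)) x = \<kappa> c * poly (map_poly \<kappa> g) x" for c g
    by (induction g) (simp_all add: pc hom algebra_simps)
  show "poly (map_poly \<kappa> (f * g)) x = poly (map_poly \<kappa> f) x * poly (map_poly \<kappa> g) x"
    by (induction f) (simp_all add: pc hom add smult algebra_simps)
qed

lemma poly_map_monom:
  fixes \<kappa> :: "'k::field \<Rightarrow> 'a::field"
  shows "\<kappa> 0 = 0 \<Longrightarrow> poly (map_poly \<kappa> (monom c n)) x = \<kappa> c * x ^ n"
  by (simp add: map_poly_monom poly_monom)

lemma poly_map_sum:
  assumes "field_hom_on (UNIV :: 'k::field set) (\<kappa> :: 'k \<Rightarrow> 'a::field)"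
  shows "poly (map_poly \<kappa> (sum f A)) x = (\<Sum>i\<in>A. poly (map_poly \<kappa> (f i)) x)"
  by (induction A rule: infinite_finite_induct) (simp_all add: poly_map_add[OF assms])

lemma (in char_p_extension) lin_poly:
  assumes "field_hom_on UNIV (\<kappa> :: 'k \<Rightarrow> 'a)"
  shows "poly (map_poly \<kappa> (\<Sum>j<p. monom (a j) j)) x = (\<Sum>j<p. \<kappa> (a j) * x ^ j)"
  using hom_on_0[OF assms UNIV_subfield] by (simp add: poly_map_sum[OF assms] poly_map_monom)

definition (in char_p_local_field) eisenstein_poly :: "(nat \<Rightarrow> 'k) \<Rightarrow> 'k poly" where
  "eisenstein_poly a = monom 1 p + (\<Sum>j<p. monom (a j) j)"

lemma (in char_p_local_field) degree_eisenstein_poly: "degree (eisenstein_poly a) = p"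
proof -
  have "degree (\<Sum>j<p. monom (a j) j) < p"
    using p_pos by (intro degree_sum_less) (auto intro: le_less_trans[OF degree_monom_le])
  then show ?thesis
    unfolding eisenstein_poly_def by (subst degree_add_eq_left) (simp_all add: degree_monom_eq)
qed

lemma (in char_p_extension) poly_eisenstein_poly:
  assumes "field_hom_on UNIV (\<kappa> :: 'k \<Rightarrow> 'a)"
  shows "poly (map_poly \<kappa> (eisenstein_poly a)) x = x ^ p + (\<Sum>j<p. \<kappa> (a j) * x ^ j)"
  using hom_on_0[OF assms UNIV_subfield] hom_on_1[OF assms UNIV_subfield]
  by (simp add: eisenstein_poly_def poly_map_add[OF assms] poly_map_monom lin_poly[OF assms])

lemma (in char_p_extension) poly_mod_eisenstein_poly:
  fixes a and g :: "'k poly"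
  assumes "field_hom_on UNIV (\<kappa> :: 'k \<Rightarrow> 'a)"
  defines "r \<equiv> g mod eisenstein_poly a"
  shows "degree r < p"
    and "poly (map_poly \<kappa> r) x = (\<Sum>j<p. \<kappa> (coeff r j) * x ^ j)"
proof -
  have "eisenstein_poly a \<noteq> 0" using degree_eisenstein_poly[of a] p_pos by auto
  then show deg: "degree r < p"
    using degree_mod_less[of "eisenstein_poly a" g] p_pos by (auto simp: degree_eisenstein_poly r_def)
  have "r = (\<Sum>j<p. monom (coeff r j) j)"
  proof (rule poly_eqI)
    fix n
    have "coeff (\<Sum>j<p. monom (coeff r j) j) n = (\<Sum>j<p. if j = n then coeff r j else 0)"
      by (simp add: coeff_sum)
    also have "\<dots> = coeff r n" using deg by (cases "n < p") (auto simp: coeff_eq_0)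
    finally show "coeff r n = coeff (\<Sum>j<p. monom (coeff r j) j) n" ..
  qed
  then show "poly (map_poly \<kappa> r) x = (\<Sum>j<p. \<kappa> (coeff r j) * x ^ j)"
    using lin_poly[OF assms(1), of "coeff r" x] by simp
qed

context scaled_extension
begin

text \<open>A polynomial vanishing at \<pi> is a multiple of F: its remainder modulo F has degree
  below p, and \<open>lin_eq_0\<close> shows that its coefficients vanish. Hence it vanishes at
  \<rho> as well, after applying \<kappa>. A map \<kappa> other than \<iota> is allowed in order to
  cover isomorphisms that move K.\<close>

lemma hom_extension:
  fixes \<kappa> :: "'k \<Rightarrow> 'a"
  assumes eis: "eisenstein \<pi> a" and \<kappa>: "field_hom_on UNIV \<kappa>"
    and root: "\<rho> ^ p + (\<Sum>j<p. \<kappa> (a j) * \<rho> ^ j) = 0"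
  obtains \<sigma> where "field_hom_on (range (lin \<pi>)) \<sigma>" "\<sigma> \<pi> = \<rho>" "\<And>x. \<sigma> (\<iota> x) = \<kappa> x"
proof -
  define ev where "ev g = poly (map_poly \<iota> g) \<pi>" for g
  define ev' where "ev' g = poly (map_poly \<kappa> g) \<rho>" for g
  have pr: "\<pi> \<noteq> 0" "\<nu> \<pi> = 1" using eisenstein_prime[OF eis] by auto
  note \<iota>0 = iota_0 and \<kappa>0 = hom_on_0[OF \<kappa> UNIV_subfield] and \<kappa>1 = hom_on_1[OF \<kappa> UNIV_subfield]
  have ev: "ev (f + g) = ev f + ev g" "ev (f - g) = ev f - ev g" "ev (f * g) = ev f * ev g" for f g
    unfolding ev_def by (simp_all add: poly_map_add poly_map_diff poly_map_mult iota_hom)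
  have ev': "ev' (f + g) = ev' f + ev' g" "ev' (f - g) = ev' f - ev' g" "ev' (f * g) = ev' f * ev' g" for f g
    unfolding ev'_def by (simp_all add: poly_map_add poly_map_diff poly_map_mult \<kappa>)
  define F where "F = eisenstein_poly a"
  have evF: "ev F = 0" "ev' F = 0"
    using eis root by (simp_all add: ev_def ev'_def F_def poly_eisenstein_poly iota_hom \<kappa> eisenstein_def lin_def)
  have zero: "ev' g = 0" if "ev g = 0" for g
  proof -
    define r where "r = g mod F"
    have g: "g = F * (g div F) + r" by (simp add: r_def)
    have "ev r = 0" using that ev evF by (subst (asm) g) simp
    moreover have "ev r = lin \<pi> (coeff r)"
      unfolding ev_def r_def F_def lin_def by (rule poly_mod_eisenstein_poly(2)[OF iota_hom])
    ultimately have low: "coeff r j = 0" if "j < p" for j using lin_eq_0[OF pr _ that] by simp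
    have "degree r < p" unfolding r_def F_def by (rule poly_mod_eisenstein_poly(1)[OF iota_hom])
    then have "coeff r n = 0" for n using low by (cases "n < p") (auto simp: coeff_eq_0)
    then have "r = 0" by (simp add: poly_eq_iff)
    then have "ev' g = ev' (F * (g div F))" using g by simp
    then show ?thesis using ev' evF by simp
  qed
  \<comment> \<open>Evaluation at \<rho> of any polynomial that represents x at \<pi>; by
    \<open>zero\<close> the choice has no influence.\<close>
  define \<sigma> where "\<sigma> x = ev' (SOME g. ev g = x)" for x
  have \<sigma>: "\<sigma> (ev g) = ev' g" for g
  proof -
    have "ev (SOME g'. ev g' = ev g) = ev g" by (rule someI_ex) blast
    then have "ev' ((SOME g'. ev g' = ev g) - g) = 0" by (intro zero) (simp add: ev)
    then show ?thesis by (simp add: \<sigma>_def ev')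
  qed
  have ev_iota: "ev (monom x 0) = \<iota> x" "ev' (monom x 0) = \<kappa> x" for x
    using \<kappa>0 by (simp_all add: ev_def ev'_def poly_map_monom)
  have ev_X: "ev (monom 1 1) = \<pi>" "ev' (monom 1 1) = \<rho>"
    using \<kappa>0 \<kappa>1 by (simp_all add: ev_def ev'_def poly_map_monom)
  have range: "\<exists>g. x = ev g" if x: "x \<in> range (lin \<pi>)" for x
  proof -
    obtain b where "x = lin \<pi> b" using x by auto
    then have "x = ev (\<Sum>j<p. monom (b j) j)" by (simp add: ev_def lin_poly[OF iota_hom] lin_def)
    then show ?thesis ..
  qed
  show ?thesis
  proof (rule that)
    show "\<sigma> (\<iota> x) = \<kappa> x" for x using \<sigma>[of "monom x 0"] by (simp add: ev_iota)
    show "\<sigma> \<pi> = \<rho>" using \<sigma>[of "monom 1 1"] by (simp only: ev_X)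
    have "\<sigma> 1 = 1" using \<sigma>[of "monom 1 0"] \<kappa>1 unfolding ev_iota by simp
    moreover have "\<sigma> (x + y) = \<sigma> x + \<sigma> y \<and> \<sigma> (x * y) = \<sigma> x * \<sigma> y"
      if xy: "x \<in> range (lin \<pi>)" "y \<in> range (lin \<pi>)" for x y
    proof -
      obtain f g where fg: "x = ev f" "y = ev g" using range xy by metis
      show ?thesis unfolding fg by (simp only: \<sigma> ev' flip: ev)
    qed
    ultimately show "field_hom_on (range (lin \<pi>)) \<sigma>" by (simp add: field_hom_on_def)
  qed
qed

end

context tot_ram
begin

lemma val_L_Ints: "\<nu> ` (L - {0}) = \<int>"
proof
  show "\<nu> ` (L - {0}) \<subseteq> \<int>" using val_L by auto
  obtain \<pi> where \<pi>: "\<pi> \<in> L" "\<pi> \<noteq> 0" "\<nu> \<pi> = 1" using prime_exists by blast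
  show "\<int> \<subseteq> \<nu> ` (L - {0})"
  proof
    fix z :: real assume "z \<in> \<int>"
    then obtain k where k: "z = of_int k" by (auto elim: Ints_cases)
    show "z \<in> \<nu> ` (L - {0})"
    proof (cases "k \<ge> 0")
      case True
      then have "z = \<nu> (\<pi> ^ nat k)" using \<pi> k by (simp add: val_power)
      then show ?thesis using \<pi> subfield_power[OF subfield] by auto
    next
      case False
      then have "z = \<nu> (inverse (\<pi> ^ nat (- k)))" using \<pi> k by (simp add: val_power val_inverse)
      then show ?thesis using \<pi> subfield_power[OF subfield] subfield_inverse[OF subfield] by auto
    qed
  qed
qed

lemma ext_degree: "ext_degree \<iota> L = p"
  using prime_exists generated ext_degree_lin by metis

lemma normalized: "normalized_valuation \<iota> v L \<nu>"
  unfolding normalized_valuation_def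
  using valuation val_iota val_L_Ints p_pos by (intro conjI exI[of _ "real p"]) auto

lemma totally_ramified: "totally_ramified \<iota> v L"
proof -
  have "\<nu> ` (range \<iota> - {0}) = (\<lambda>z. real p * z) ` v ` (UNIV - {0})"
    unfolding image_image
  proof (intro equalityI subsetI)
    fix z assume "z \<in> \<nu> ` (range \<iota> - {0})"
    then show "z \<in> (\<lambda>x. real p * v x) ` (UNIV - {0})" using val_iota by auto
  next
    fix z assume "z \<in> (\<lambda>x. real p * v x) ` (UNIV - {0})"
    then obtain x where "x \<noteq> 0" "z = \<nu> (\<iota> x)" using val_iota by auto
    then show "z \<in> \<nu> ` (range \<iota> - {0})" by auto
  qed
  also have "v ` (UNIV - {0}) = \<int>" using local_field by (simp add: local_field_def)
  finally show ?thesis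
    using normalized unfolding totally_ramified_def ext_degree by blast
qed

end

section \<open>Uniqueness of the normalized valuation on L\<close>

context char_p_extension
begin

text \<open>The definitions allow total ramification and the break to be witnessed by different
  valuations \<mu> and \<nu>. Both extend v up to scaling; the proof shows that the scale is p for
  \<mu>, then that \<nu> is a multiple e \<mu> on L, and finally e = 1 because both have value group
  \<int> on L.\<close>

lemma tot_ramI:
  assumes L: "subextension \<iota> L" "ext_degree \<iota> L = p" "totally_ramified \<iota> v L"
    and \<nu>: "normalized_valuation \<iota> v L \<nu>"
  shows "tot_ram v p \<iota> \<nu> L"
proof -
  have sub: "is_subfield L" "range \<iota> \<subseteq> L" using L(1) by (auto simp: subextension_def)
  have norm: "tot_ram v p \<iota> \<mu> L"
    if \<mu>: "normalized_valuation \<iota> v L \<mu>" "\<And>x. x \<noteq> 0 \<Longrightarrow> \<mu> (\<iota> x) = real p * v x" for \<mu>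
  proof -
    interpret M: scaled_extension v p \<iota> \<mu>
      by unfold_locales (use \<mu> in \<open>auto simp: normalized_valuation_def\<close>)
    have img: "\<mu> ` (L - {0}) = \<int>" using \<mu> by (simp add: normalized_valuation_def)
    have "1 \<in> \<mu> ` (L - {0})" unfolding img by simp
    then have ex: "\<exists>\<pi>\<in>L. \<pi> \<noteq> 0 \<and> \<mu> \<pi> = 1" by force
    show ?thesis
    proof unfold_locales
      show "is_subfield L" "range \<iota> \<subseteq> L" by (rule sub)+
      show "\<exists>\<pi>\<in>L. \<pi> \<noteq> 0 \<and> \<mu> \<pi> = 1" by (rule ex)
      show "\<mu> x \<in> \<int>" if "x \<in> L" "x \<noteq> 0" for x unfolding img[symmetric] using that by blast
      show "L = range (lin \<pi>)" if "\<pi> \<in> L" "\<pi> \<noteq> 0" "\<mu> \<pi> = 1" for \<pi>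
        by (rule M.generated_by_prime[OF sub L(2) that])
    qed
  qed
  obtain \<mu> where \<mu>: "normalized_valuation \<iota> v L \<mu>"
    "\<mu> ` (range \<iota> - {0}) = (\<lambda>z. real p * z) ` \<int>"
    using L by (auto simp: totally_ramified_def)
  obtain c where c: "c > 0" "\<And>x. x \<noteq> 0 \<Longrightarrow> \<mu> (\<iota> x) = c * v x"
    using \<mu>(1) by (auto simp: normalized_valuation_def)
  obtain t where t: "t \<noteq> 0" "v t = 1" using uniformizer_exists by blast
  \<comment> \<open>The value group of K under \<mu> is c \<int>, and it is also p \<int> by total
    ramification, so the positive number c is p.\<close>
  have "c \<in> \<mu> ` (range \<iota> - {0})" using t c by (auto intro!: image_eqI[of _ _ "\<iota> t"])
  then obtain z where z: "z \<in> \<int>" "c = real p * z" using \<mu>(2) by auto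
  have "real p * 1 \<in> \<mu> ` (range \<iota> - {0})"
    unfolding \<mu>(2) by (rule imageI) simp
  then obtain y where y: "y \<in> range \<iota> - {0}" "real p = \<mu> y" by auto
  then obtain x where "y = \<iota> x" by auto
  then have "x \<noteq> 0" "real p = c * v x" using c(2)[of x] y by auto
  then have "z * v x = 1" "v x \<in> \<int>" using z p_pos val_in_Ints by auto
  then have "z = 1" using z c p_pos by (intro Ints_unit[of z "v x"]) (auto simp: zero_less_mult_iff)
  then interpret M: tot_ram v p \<iota> \<mu> L using norm[OF \<mu>(1)] c z by simp
  obtain \<pi> where \<pi>: "\<pi> \<in> L" "\<pi> \<noteq> 0" "\<mu> \<pi> = 1" using M.prime_exists by blast
  obtain a where a: "eisenstein \<pi> a" using M.eisenstein_exists[OF \<pi>] by blast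
  obtain d where d: "d > 0" "\<And>x. x \<noteq> 0 \<Longrightarrow> \<nu> (\<iota> x) = d * v x"
    using \<nu> by (auto simp: normalized_valuation_def)
  have "is_valuation \<nu>" using \<nu> by (simp add: normalized_valuation_def)
  then interpret N: valuation \<nu> by unfold_locales
  define e where "e = \<nu> \<pi>"
  have e: "d = real p * e" using eisenstein_val[OF N.valuation d(1,2) a] by (simp add: e_def)
  have val_term: "\<nu> (\<iota> x * \<pi> ^ j) = e * \<mu> (\<iota> x * \<pi> ^ j)" if "x \<noteq> 0" for x j
    using that \<pi> by (simp add: N.val_mult N.val_power d e M.val_term e_def[symmetric] algebra_simps)
  have epos: "e > 0" using d(1) e p_pos by (simp add: zero_less_mult_iff)
  \<comment> \<open>On terms x \<pi>^j the two valuations are proportional. The values of the terms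
    are therefore distinct for \<nu> too, and the same term leads for both.\<close>
  have eq: "\<nu> x = e * \<mu> x" if x: "x \<in> L" "x \<noteq> 0" for x
  proof -
    obtain b where b: "x = lin \<pi> b" using x M.generated[OF \<pi>] by auto
    have "\<exists>j<p. b j \<noteq> 0" using x b by (intro lin_nonzero[of \<pi>]) simp
    then obtain j0 where j0: "j0 < p" "b j0 \<noteq> 0" by blast
    obtain i where i: "i < p" "b i \<noteq> 0" "same_lead \<mu> x (\<iota> (b i) * \<pi> ^ i)"
      "\<forall>j<p. vge \<mu> (\<mu> (\<iota> (b i) * \<pi> ^ i)) (\<iota> (b j) * \<pi> ^ j)"
      using M.lin_lead[where a = b, OF \<pi>(2,3) j0] unfolding b by blast
    have "\<exists>i\<in>{..<p}. same_lead \<nu> x (\<iota> (b i) * \<pi> ^ i) \<and>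
     (\<forall>j\<in>{..<p}. vge \<nu> (\<nu> (\<iota> (b i) * \<pi> ^ i)) (\<iota> (b j) * \<pi> ^ j)) \<and>
     (\<forall>j\<in>{..<p} - {i}. vgt \<nu> (\<nu> (\<iota> (b i) * \<pi> ^ i)) (\<iota> (b j) * \<pi> ^ j))"
      unfolding b lin_def
    proof (rule N.sum_distinct_values[of _ j0])
      fix i j assume ij: "i \<in> {..<p}" "j \<in> {..<p}" "\<iota> (b i) * \<pi> ^ i \<noteq> 0" "\<iota> (b j) * \<pi> ^ j \<noteq> 0"
        "\<nu> (\<iota> (b i) * \<pi> ^ i) = \<nu> (\<iota> (b j) * \<pi> ^ j)"
      then have "b i \<noteq> 0" "b j \<noteq> 0" by auto
      then show "i = j"
        using M.val_term_inj[OF \<pi>(2,3) _ _ ij(3,4)] ij epos by (simp add: val_term)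
    qed (use j0 \<pi> in auto)
    then obtain k where k: "k < p" "same_lead \<nu> x (\<iota> (b k) * \<pi> ^ k)"
      "\<forall>j<p. vge \<nu> (\<nu> (\<iota> (b k) * \<pi> ^ k)) (\<iota> (b j) * \<pi> ^ j)"
      by auto
    have bk: "b k \<noteq> 0" using k(2) by (auto simp: same_lead_def)
    have "\<mu> (\<iota> (b i) * \<pi> ^ i) \<le> \<mu> (\<iota> (b k) * \<pi> ^ k)" using i(4) k(1) bk \<pi> by (auto simp: vge_def)
    moreover have "\<nu> (\<iota> (b k) * \<pi> ^ k) \<le> \<nu> (\<iota> (b i) * \<pi> ^ i)" using k(3) i(1,2) \<pi> by (auto simp: vge_def)
    ultimately have "\<mu> (\<iota> (b i) * \<pi> ^ i) = \<mu> (\<iota> (b k) * \<pi> ^ k)"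
      unfolding val_term[OF bk] val_term[OF i(2)] using epos by simp
    then show ?thesis
      using N.same_lead_val[OF k(2)] M.same_lead_val[OF i(3)] val_term[OF bk] by simp
  qed
  have img: "\<nu> ` (L - {0}) = \<int>" using \<nu> by (simp add: normalized_valuation_def)
  have "e \<in> \<int>" unfolding img[symmetric] e_def using \<pi> by blast
  have "1 \<in> \<nu> ` (L - {0})" unfolding img by simp
  then obtain x where "x \<in> L" "x \<noteq> 0" "\<nu> x = 1" by force
  then have "e * \<mu> x = 1" "\<mu> x \<in> \<int>" using eq M.val_L by auto
  then have "e = 1" using Ints_unit[OF \<open>e \<in> \<int>\<close>] epos by blast
  then show ?thesis using norm[OF \<nu>] d e by simp
qed

end

section \<open>The invariant of an extension\<close>

text \<open>Units go to units with the same residue, so v(\<phi> x) = v(x) v(\<phi> t) for a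
  uniformizer t. The factor is positive, because \<phi> t is congruent to t, and surjectivity makes
  it invertible in \<int>.\<close>

lemma (in char_p_local_field) residual_identity_val:
  assumes mult: "\<And>x y. \<phi> (x * y) = \<phi> x * \<phi> y" and one: "\<phi> 1 = 1" and "surj \<phi>" and zero: "\<phi> 0 = 0"
    and res: "\<And>x. vge v 0 x \<Longrightarrow> vgt v 0 (\<phi> x - x)"
    and x: "x \<noteq> 0"
  shows "\<phi> x \<noteq> 0" "v (\<phi> x) = v x"
proof -
  have nz: "\<phi> x \<noteq> 0" if "x \<noteq> 0" for x
    using mult[of x "inverse x"] that one by auto
  have pow: "\<phi> (x ^ n) = \<phi> x ^ n" for x n
    by (induction n) (auto simp: one mult)
  have inv: "\<phi> (inverse x) = inverse (\<phi> x)" if "x \<noteq> 0" for x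
    using mult[of x "inverse x"] that one inverse_unique[of "\<phi> x"] by simp
  have unit: "v (\<phi> u) = 0" if "u \<noteq> 0" "v u = 0" for u
  proof -
    have "same_lead v u (\<phi> u)"
      using that res[of u] vgt_diff_commute by (intro same_lead_iff) (auto simp: vge_def)
    then show ?thesis using same_lead_val that by metis
  qed
  obtain t where t: "t \<noteq> 0" "v t = 1" using uniformizer_exists by blast
  have all: "v (\<phi> x) = v x * v (\<phi> t)" if x: "x \<noteq> 0" for x
  proof -
    obtain k where k: "v x = of_int k" using val_in_Ints[OF x] by (auto elim: Ints_cases)
    \<comment> \<open>The unit part of x with respect to t; the two natural exponents stand for the
      integer k, whatever its sign.\<close>
    define u where "u = x * t ^ nat (- k) / t ^ nat k"
    have u: "u \<noteq> 0" "v u = 0" using x t k by (auto simp: u_def val_mult val_divide val_power)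
    have "u * t ^ nat k = x * t ^ nat (- k)" using t by (simp add: u_def)
    then have "\<phi> u * \<phi> t ^ nat k = \<phi> x * \<phi> t ^ nat (- k)" by (metis mult pow)
    then have "v (\<phi> u * \<phi> t ^ nat k) = v (\<phi> x * \<phi> t ^ nat (- k))" by simp
    then have "real (nat k) * v (\<phi> t) = v (\<phi> x) + real (nat (- k)) * v (\<phi> t)"
      using u t x unit[OF u] nz by (simp add: val_mult val_power)
    then show ?thesis by (cases "k \<ge> 0") (simp_all add: k)
  qed
  have "vgt v 0 ((\<phi> t - t) + t)"
    using res[of t] t by (intro vgt_add) (auto simp: vge_def vgt_def)
  then have pos: "v (\<phi> t) > 0" using nz[OF t(1)] by (simp add: vgt_def)
  obtain s where s: "t = \<phi> s" using \<open>surj \<phi>\<close> by (metis surjD)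
  then have "s \<noteq> 0" using t zero by auto
  then have "v (\<phi> t) * v s = 1" using all[of s] t s by (simp add: mult.commute)
  then have "v (\<phi> t) = 1"
    using val_in_Ints nz t \<open>s \<noteq> 0\<close> pos by (intro Ints_unit[of "v (\<phi> t)" "v s"]) auto
  then show "\<phi> x \<noteq> 0" "v (\<phi> x) = v x" using all[OF x] nz[OF x] by auto
qed

locale ramified_extensions = char_p_extension v p \<iota>
  for v :: "'k::field \<Rightarrow> real" and p :: nat and \<iota> :: "'k \<Rightarrow> 'a::field" +
  fixes m :: nat
  assumes m_pos: "m > 0" and not_dvd: "\<not> p dvd m"
begin

text \<open>The coefficient of \<open>X\<^bsup>ri\<^esup>\<close> is the one that dominates, and its value is \<open>rn\<close>.\<close>

definition ri :: nat where "ri = m mod p"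
definition rn :: nat where "rn = m div p + 1"
definition E :: "'a set set" where "E = ramified_exts \<iota> v p (real m / (real p - 1))"

lemma ri: "ri \<in> {1..<p}" and ri_pos: "0 < ri" and ri_less: "ri < p"
  using not_dvd p_pos by (auto simp: ri_def dvd_eq_mod_eq_0 Suc_le_eq)

lemma rn_pos: "rn \<ge> 1"
  by (simp add: rn_def)

text \<open>The value of f'(\<pi>) has to be (p - 1)(b + 1) = m + p - 1, so the dominating term a_j
  \<pi>^j of f has value m + p. Division of m + p by p yields \<open>rn\<close> as the value of the
  coefficient in K and \<open>ri\<close> as the exponent.\<close>

lemma m_eq: "m + p = p * rn + ri"
  by (simp add: rn_def ri_def algebra_simps)

lemma m_eq_real: "real m + real p = real p * real rn + real ri"
  using m_eq by (simp flip: of_nat_add of_nat_mult)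

lemma of_nat_ri: "of_nat ri \<in> Tx" "(of_nat ri :: 'k) \<noteq> 0" "(of_nat ri :: 'a) \<noteq> 0"
  using of_nat_Tx[OF ri_pos ri_less] by (auto simp: Tx_def simp flip: iota_of_nat)

text \<open>The condition that the break is b, expressed by coefficients: for 0 < j < p the terms
  a_j \<pi>^j have value at least m + p, and the one at \<open>ri\<close> attains it.\<close>

definition eis_data :: "'a set \<Rightarrow> 'a \<Rightarrow> (nat \<Rightarrow> 'k) \<Rightarrow> bool" where
  "eis_data L \<pi> a \<longleftrightarrow> \<pi> \<in> L \<and> eisenstein \<pi> a \<and> a ri \<noteq> 0 \<and> v (a ri) = real rn \<and>
     (\<forall>j\<in>{1..<p}. a j = 0 \<or> real m + real p \<le> real p * v (a j) + real j)"

text \<open>This is the dominating term of - f'(\<pi>) divided by \<pi>^(m + p - 1), with each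
  \<pi>^p replaced by - a_0, which has the same leading term. As m + p - 1 = p rn + (ri - 1), the
  remaining powers of \<pi> cancel and an element of K is left.\<close>

definition lead_coef :: "(nat \<Rightarrow> 'k) \<Rightarrow> 'k" where
  "lead_coef a = - (of_nat ri * a ri) / (- a 0) ^ rn"

text \<open>
  The invariant \<open>w\<close> of an extension is the residue of
  \<open>(\<sigma> \<pi> - \<pi>)\<^bsup>p - 1\<^esup> / \<pi>\<^bsup>m + p - 1\<^esup>\<close>; it is read off the minimal polynomial of \<open>\<pi>\<close>, so that
  \<open>k\<close>-isomorphisms preserve it.
\<close>

definition inv_rel :: "'a set \<Rightarrow> 'k \<Rightarrow> bool" where
  "inv_rel L w \<longleftrightarrow> w \<in> Tx \<and> (\<exists>\<pi> a. eis_data L \<pi> a \<and> same_lead v w (lead_coef a))"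

lemma ramified_extE:
  assumes "L \<in> E"
  obtains \<nu> \<sigma> \<pi> where "tot_ram v p \<iota> \<nu> L" "K_embedding \<iota> L \<sigma>" "\<exists>x\<in>L. \<sigma> x \<noteq> x"
    "\<pi> \<in> L" "\<pi> \<noteq> 0" "\<nu> \<pi> = 1" "\<nu> (\<sigma> \<pi> - \<pi>) = real m / (real p - 1) + 1"
proof -
  obtain \<nu> where norm: "normalized_valuation \<iota> v L \<nu>"
    and nums: "{ramification_number \<nu> \<pi> \<sigma> | \<pi> \<sigma>. prime_element L \<nu> \<pi> \<and> K_embedding \<iota> L \<sigma> \<and>
      (\<exists>x\<in>L. \<sigma> x \<noteq> x)} = {real m / (real p - 1)}"
    using assms by (auto simp: E_def ramified_exts_def has_ramification_break_def)
  have "real m / (real p - 1) \<in> {ramification_number \<nu> \<pi> \<sigma> | \<pi> \<sigma>. prime_element L \<nu> \<pi> \<and>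
      K_embedding \<iota> L \<sigma> \<and> (\<exists>x\<in>L. \<sigma> x \<noteq> x)}"
    unfolding nums by simp
  then obtain \<pi> \<sigma> where "prime_element L \<nu> \<pi>" "K_embedding \<iota> L \<sigma>" "\<exists>x\<in>L. \<sigma> x \<noteq> x"
    "real m / (real p - 1) = ramification_number \<nu> \<pi> \<sigma>"
    by blast
  moreover have "tot_ram v p \<iota> \<nu> L"
    using assms norm by (intro tot_ramI) (auto simp: E_def ramified_exts_def)
  ultimately show ?thesis
    by (intro that[of \<nu> \<sigma> \<pi>]) (auto simp: prime_element_def ramification_number_def)
qed

lemma break_pos: "real m / (real p - 1) > 0"
  using m_pos p_gt_1 by simp

text \<open>By the ramification equation (p - 1)(b + 1) equals p v(a_i) + i - 1 for the dominating
  index i. Reduction modulo p then identifies i with \<open>ri\<close>.\<close>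

lemma eis_dataI:
  assumes "tot_ram v p \<iota> \<nu> L" "K_embedding \<iota> L \<sigma>"
    and \<pi>: "\<pi> \<in> L" "\<pi> \<noteq> 0" "\<nu> \<pi> = 1" and moved: "\<nu> (\<sigma> \<pi> - \<pi>) = real m / (real p - 1) + 1"
    and nt: "\<sigma> \<pi> \<noteq> \<pi>" and a: "eisenstein \<pi> a"
  shows "eis_data L \<pi> a"
proof -
  interpret M: tot_ram v p \<iota> \<nu> L by fact
  have "\<nu> (\<sigma> \<pi> - \<pi>) > 1" using moved break_pos by simp
  then obtain i where i: "i\<in>{1..<p}" "a i \<noteq> 0"
      "same_lead \<nu> ((\<sigma> \<pi> - \<pi>) ^ (p - 1)) (- (\<iota> (a i) * of_nat i * \<pi> ^ (i - 1)))"
      "\<forall>j\<in>{1..<p}. vge \<nu> (real p * v (a i) + real i) (\<iota> (a j) * \<pi> ^ j)"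
    using M.ramification_equation[OF a M.K_embedding_eisenstein[OF assms(2) \<pi>(1) a] nt] by blast
  have "\<nu> (of_nat i) = 0"
    using of_nat_Tx[of i] i(1) M.val_iota[of "of_nat i"] T_val[of "of_nat i"]
    by (auto simp: Tx_def simp flip: iota_of_nat)
  moreover have "(of_nat i :: 'a) \<noteq> 0"
    using of_nat_Tx[of i] i(1) by (auto simp: Tx_def simp flip: iota_of_nat)
  ultimately have "\<nu> (\<iota> (a i) * of_nat i * \<pi> ^ (i - 1)) = real p * v (a i) + (real i - 1)"
    using i(1,2) \<pi> by (simp add: M.val_mult M.val_power M.val_iota of_nat_diff)
  then have "real (p - 1) * \<nu> (\<sigma> \<pi> - \<pi>) = real p * v (a i) + (real i - 1)"
    using M.same_lead_val[OF i(3)] nt by (simp add: M.val_power)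
  moreover have "real (p - 1) * (real m / (real p - 1) + 1) = real m + real p - 1"
    using p_gt_1 by (simp add: field_simps of_nat_diff)
  ultimately have eq: "real p * v (a i) + real i = real m + real p" using moved by simp
  then have "real p * v (a i) + real i = real p * real rn + real ri" using m_eq_real by simp
  then have "i = ri"
    using i ri_less val_in_Ints by (intro M.mod_p_unique[of "v (a i)" i "real rn" ri]) auto
  then have "v (a ri) = real rn" using eq m_eq_real p_pos by simp
  moreover have "a j = 0 \<or> real m + real p \<le> real p * v (a j) + real j" if "j \<in> {1..<p}" for j
    using i(4) that eq M.val_term[OF \<pi>(2,3), of "a j" j] \<pi>(2) by (cases "a j = 0") (auto simp: vge_def)
  ultimately show ?thesis using \<pi> a i \<open>i = ri\<close> by (simp add: eis_data_def)
qed

lemma lead_coef_val: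
  assumes "eis_data L \<pi> a"
  shows "lead_coef a \<noteq> 0" "v (lead_coef a) = 0"
proof -
  have a: "a ri \<noteq> 0" "v (a ri) = real rn" "a 0 \<noteq> 0" "v (a 0) = 1"
    using assms by (auto simp: eis_data_def eisenstein_def)
  then show "lead_coef a \<noteq> 0" using of_nat_ri by (simp add: lead_coef_def)
  have "v (of_nat ri) = 0" using T_val of_nat_ri by (simp add: Tx_def)
  then show "v (lead_coef a) = 0"
    using a of_nat_ri valuation.val_mult[OF valuation_v] valuation.val_divide[OF valuation_v]
      valuation.val_power[OF valuation_v] valuation.val_minus[OF valuation_v]
    by (simp add: lead_coef_def)
qed

lemma lead_coef_residue:
  assumes "eis_data L \<pi> a"
  obtains w where "w \<in> Tx" "same_lead v w (lead_coef a)"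
proof -
  obtain w where w: "w \<in> T" "vgt v 0 (lead_coef a - w)"
    using T_approx[of "lead_coef a"] lead_coef_val[OF assms] by (auto simp: vge_def)
  have "same_lead v (lead_coef a) w"
    using lead_coef_val[OF assms] w by (intro valuation.same_lead_iff[OF valuation_v]) auto
  then have "same_lead v w (lead_coef a)" by (rule valuation.same_lead_sym[OF valuation_v])
  then show ?thesis using w by (intro that) (auto simp: Tx_def same_lead_def)
qed

lemma inv_exists:
  assumes "L \<in> E" shows "\<exists>w. inv_rel L w"
proof -
  obtain \<nu> \<sigma> \<pi> where M: "tot_ram v p \<iota> \<nu> L" "K_embedding \<iota> L \<sigma>" "\<exists>x\<in>L. \<sigma> x \<noteq> x"
    "\<pi> \<in> L" "\<pi> \<noteq> 0" "\<nu> \<pi> = 1" "\<nu> (\<sigma> \<pi> - \<pi>) = real m / (real p - 1) + 1"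
    by (rule ramified_extE[OF assms])
  obtain a where a: "eisenstein \<pi> a" using tot_ram.eisenstein_exists[OF M(1,4-6)] by blast
  have "eis_data L \<pi> a"
    using tot_ram.K_embedding_moves[OF M(1-6)] by (intro eis_dataI[OF M(1,2,4-7) _ a])
  then show ?thesis using lead_coef_residue unfolding inv_rel_def by metis
qed

lemma eis_data_prime:
  assumes "tot_ram v p \<iota> \<nu> L" "eis_data L \<pi> a"
  shows "\<pi> \<in> L" "\<pi> \<noteq> 0" "\<nu> \<pi> = 1" "eisenstein \<pi> a"
  using assms(2) scaled_extension.eisenstein_prime[OF tot_ram.axioms(1)[OF assms(1)], of \<pi> a]
  by (auto simp: eis_data_def)

context
  fixes \<nu> L \<pi> a
  assumes M: "tot_ram v p \<iota> \<nu> L" and data: "eis_data L \<pi> a"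
begin

lemma prime_power_lead: "same_lead \<nu> (\<pi> ^ p) (\<iota> (- a 0))"
  and vge_eis_term: "j \<in> {1..<p} \<Longrightarrow> vge \<nu> (real m + real p) (\<iota> (a j) * \<pi> ^ j)"
proof -
  interpret M: tot_ram v p \<iota> \<nu> L by (rule M)
  note \<pi> = eis_data_prime[OF M data]
  show ge: "vge \<nu> (real m + real p) (\<iota> (a j) * \<pi> ^ j)" if "j \<in> {1..<p}" for j
    using data that M.val_term[OF \<pi>(2,3), of "a j" j] \<pi>(2)
    by (cases "a j = 0") (auto simp: vge_def eis_data_def)
  have "\<pi> ^ p + lin \<pi> a = 0" using \<pi>(4) by (simp add: eisenstein_def)
  then have eq: "\<pi> ^ p = \<iota> (- a 0) + - (\<Sum>j\<in>{1..<p}. \<iota> (a j) * \<pi> ^ j)"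
    by (simp add: lin_split iota_minus algebra_simps add_eq_0_iff2)
  have a0: "a 0 \<noteq> 0" "v (a 0) = 1" using \<pi>(4) by (auto simp: eisenstein_def)
  have "vge \<nu> (real m + real p) (- (\<Sum>j\<in>{1..<p}. \<iota> (a j) * \<pi> ^ j))"
    using ge by (subst M.vge_minus) (rule M.vge_sum)
  then have "vgt \<nu> (\<nu> (\<iota> (- a 0))) (- (\<Sum>j\<in>{1..<p}. \<iota> (a j) * \<pi> ^ j))"
    using a0 m_pos by (elim vge_imp_vgt) (simp add: M.val_iota iota_minus)
  then show "same_lead \<nu> (\<pi> ^ p) (\<iota> (- a 0))"
    unfolding eq using a0 by (intro M.same_lead_add) auto
qed

lemma inv_lead:
  assumes w: "w \<in> Tx" "same_lead v w (lead_coef a)"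
  shows "same_lead \<nu> (\<iota> w * \<pi> ^ (m + p - 1)) (- (\<iota> (a ri) * of_nat ri * \<pi> ^ (ri - 1)))"
proof -
  interpret M: tot_ram v p \<iota> \<nu> L by (rule M)
  note \<pi> = eis_data_prime[OF M data]
  define z where "z = - (\<iota> (a ri) * of_nat ri)"
  have "a ri \<noteq> 0" using data by (simp add: eis_data_def)
  then have z: "z \<noteq> 0" using of_nat_ri by (simp add: z_def)
  have "\<iota> (lead_coef a) = z / \<iota> (- a 0) ^ rn"
    by (simp add: lead_coef_def z_def iota_divide iota_minus iota_mult iota_power iota_of_nat)
  moreover have "same_lead \<nu> (\<iota> w) (\<iota> (lead_coef a))" using w by (simp add: M.same_lead_iota)
  moreover have "same_lead \<nu> (z / \<iota> (- a 0) ^ rn) (z / (\<pi> ^ p) ^ rn)"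
    using z by (intro M.same_lead_divide M.same_lead_refl M.same_lead_power M.same_lead_sym[OF prime_power_lead])
  ultimately have "same_lead \<nu> (\<iota> w) (z / (\<pi> ^ p) ^ rn)" using M.same_lead_trans by metis
  then have "same_lead \<nu> (\<iota> w * \<pi> ^ (m + p - 1)) (z / (\<pi> ^ p) ^ rn * \<pi> ^ (m + p - 1))"
    using \<pi> by (intro M.same_lead_mult M.same_lead_refl) auto
  moreover have "m + p - 1 = p * rn + (ri - 1)" using m_eq ri_pos by simp
  then have "z / (\<pi> ^ p) ^ rn * \<pi> ^ (m + p - 1) = z * \<pi> ^ (ri - 1)"
    using \<pi>(2) by (simp add: power_add flip: power_mult)
  ultimately show ?thesis by (simp add: z_def)
qed

text \<open>Conjugates enter only as further roots \<rho> of the same equation, so the lemma serves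
  for the images of \<pi> under arbitrary embeddings.\<close>

lemma conjugate_lead:
  assumes w: "w \<in> Tx" "same_lead v w (lead_coef a)" and \<rho>: "eisenstein \<rho> a" "\<rho> \<noteq> \<pi>"
  shows "same_lead \<nu> ((\<rho> - \<pi>) ^ (p - 1)) (\<iota> w * \<pi> ^ (m + p - 1))"
    and "\<nu> (\<rho> - \<pi>) = real m / (real p - 1) + 1"
proof -
  interpret M: tot_ram v p \<iota> \<nu> L by (rule M)
  note \<pi> = eis_data_prime[OF M data]
  have ari: "a ri \<noteq> 0" "v (a ri) = real rn" using data by (auto simp: eis_data_def)
  have "vge \<nu> (real p * v (a ri) + real ri) (\<iota> (a j) * \<pi> ^ j)" if "j \<in> {1..<p}" for j
    using vge_eis_term[OF that] m_eq_real ari by simp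
  then have "same_lead \<nu> ((\<rho> - \<pi>) ^ (p - 1)) (- (\<iota> (a ri) * of_nat ri * \<pi> ^ (ri - 1)))"
    using M.ramification_equation'(2)[OF \<pi>(4) \<rho> ri ari(1)] by blast
  then show lead: "same_lead \<nu> ((\<rho> - \<pi>) ^ (p - 1)) (\<iota> w * \<pi> ^ (m + p - 1))"
    using inv_lead[OF w] M.same_lead_sym M.same_lead_trans by blast
  have "real (p - 1) * \<nu> (\<rho> - \<pi>) = real m + real p - 1"
    using M.same_lead_val[OF lead] \<rho> \<pi> w p_pos
    by (simp add: M.val_mult M.val_power M.T_val' Tx_def of_nat_diff)
  then show "\<nu> (\<rho> - \<pi>) = real m / (real p - 1) + 1"
    using p_gt_1 by (simp add: of_nat_diff field_simps)
qed

end

text \<open>Let \<pi>' have leading term c \<pi>, so that y' has leading term c y. Computing y'^(p -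
  1) from w' and from w gives w' c^(m + p - 1) = w c^(p - 1).\<close>

lemma inv_unique:
  assumes "L \<in> E" "inv_rel L w" "inv_rel L w'"
  shows "\<exists>c\<in>Tx. w = w' * c ^ m"
proof -
  obtain \<nu> \<sigma> \<pi>0 where M: "tot_ram v p \<iota> \<nu> L" "K_embedding \<iota> L \<sigma>" "\<exists>x\<in>L. \<sigma> x \<noteq> x"
    by (rule ramified_extE[OF assms(1)])
  interpret M: tot_ram v p \<iota> \<nu> L by (rule M)
  obtain \<pi> a where a: "eis_data L \<pi> a" "same_lead v w (lead_coef a)" and w: "w \<in> Tx"
    using assms(2) by (auto simp: inv_rel_def)
  obtain \<pi>' a' where a': "eis_data L \<pi>' a'" "same_lead v w' (lead_coef a')" and w': "w' \<in> Tx"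
    using assms(3) by (auto simp: inv_rel_def)
  note \<pi> = eis_data_prime[OF M(1) a(1)] and \<pi>' = eis_data_prime[OF M(1) a'(1)]
  define y where "y = \<sigma> \<pi> - \<pi>"
  define y' where "y' = \<sigma> \<pi>' - \<pi>'"
  have nt: "\<sigma> \<pi> \<noteq> \<pi>" "\<sigma> \<pi>' \<noteq> \<pi>'"
    using M.K_embedding_moves[OF M(2,3)] \<pi> \<pi>' by auto
  note lead = conjugate_lead[OF M(1) a(1) w a(2) M.K_embedding_eisenstein[OF M(2) \<pi>(1,4)] nt(1)]
  note lead' = conjugate_lead[OF M(1) a'(1) w' a'(2) M.K_embedding_eisenstein[OF M(2) \<pi>'(1,4)] nt(2)]
  have "\<nu> (\<sigma> \<pi> - \<pi>) > 1" using lead(2) break_pos by simp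
  then obtain c where c: "c \<in> Tx" "same_lead \<nu> \<pi>' (\<iota> c * \<pi>)" "same_lead \<nu> y' (\<iota> c * y)"
    using M.change_prime[OF M(2) \<pi>(1-3) \<pi>'(1-3) nt(1)] by (auto simp: y_def y'_def)
  have cnz: "\<iota> c \<noteq> 0" using c(1) by (simp add: Tx_def)
  have e1: "same_lead \<nu> (y' ^ (p - 1)) (\<iota> w' * (\<iota> c * \<pi>) ^ (m + p - 1))"
    using M.same_lead_trans[OF lead'(1) M.same_lead_mult[OF M.same_lead_refl M.same_lead_power[OF c(2)]]]
      Tx_nz[OF w'] by (simp add: y'_def)
  have e2: "same_lead \<nu> (y' ^ (p - 1)) (\<iota> c ^ (p - 1) * (\<iota> w * \<pi> ^ (m + p - 1)))"
  proof -
    have "same_lead \<nu> (y' ^ (p - 1)) (\<iota> c ^ (p - 1) * y ^ (p - 1))"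
      using M.same_lead_power[OF c(3), of "p - 1"] by (simp add: power_mult_distrib)
    moreover have "same_lead \<nu> (\<iota> c ^ (p - 1) * y ^ (p - 1)) (\<iota> c ^ (p - 1) * (\<iota> w * \<pi> ^ (m + p - 1)))"
      using lead(1) cnz by (intro M.same_lead_mult M.same_lead_refl) (auto simp: y_def)
    ultimately show ?thesis by (rule M.same_lead_trans)
  qed
  have "same_lead \<nu> (\<iota> c ^ (p - 1) * (\<iota> w * \<pi> ^ (m + p - 1))) (\<iota> w' * (\<iota> c * \<pi>) ^ (m + p - 1))"
    by (rule M.same_lead_trans[OF M.same_lead_sym[OF e2] e1])
  then have "same_lead \<nu> (\<iota> c ^ (p - 1) * (\<iota> w * \<pi> ^ (m + p - 1)) / (\<iota> c ^ (p - 1) * \<pi> ^ (m + p - 1)))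
      (\<iota> w' * (\<iota> c * \<pi>) ^ (m + p - 1) / (\<iota> c ^ (p - 1) * \<pi> ^ (m + p - 1)))"
    using cnz \<pi>(2) by (intro M.same_lead_divide M.same_lead_refl) simp_all
  moreover have "(\<iota> c * \<pi>) ^ (m + p - 1) = \<iota> c ^ m * (\<iota> c ^ (p - 1) * \<pi> ^ (m + p - 1))"
  proof -
    have "m + p - 1 = m + (p - 1)" using p_pos by simp
    then show ?thesis by (simp only: power_mult_distrib power_add mult_ac)
  qed
  ultimately have "same_lead \<nu> (\<iota> w) (\<iota> (w' * c ^ m))"
    using cnz \<pi>(2) by (simp add: iota_mult iota_power)
  then have "w = w' * c ^ m" using w w' c by (intro M.Tx_same_lead) (auto intro: Tx_mult Tx_power)
  then show ?thesis using c by blast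
qed

text \<open>Passing from \<pi> to d \<pi> with d = 1/c multiplies a_j by d^(p - j). Then
  \<open>lead_coef\<close> changes by d^(p - ri - p rn), and this exponent is - m.\<close>

lemma inv_scale:
  assumes "L \<in> E" "inv_rel L w" "c \<in> Tx"
  shows "inv_rel L (w * c ^ m)"
proof -
  obtain \<nu> \<sigma> \<pi>0 where M: "tot_ram v p \<iota> \<nu> L" by (rule ramified_extE[OF assms(1)])
  interpret M: tot_ram v p \<iota> \<nu> L by (rule M)
  obtain \<pi> a where a: "eis_data L \<pi> a" "same_lead v w (lead_coef a)" and w: "w \<in> Tx"
    using assms(2) by (auto simp: inv_rel_def)
  have c0: "c \<noteq> 0" "v c = 0" using assms(3) T_val by (auto simp: Tx_def)
  define d where "d = inverse c"
  have d: "d \<noteq> 0" "v d = 0" using c0 valuation.val_inverse[OF valuation_v] by (auto simp: d_def)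
  define b where "b j = d ^ (p - j) * a j" for j
  have v_b: "v (b j) = v (a j)" if "a j \<noteq> 0" for j
    using that d by (simp add: b_def valuation.val_mult[OF valuation_v] valuation.val_power[OF valuation_v])
  have b0: "b j = 0 \<longleftrightarrow> a j = 0" for j using d by (simp add: b_def)
  have vb: "a j = 0 \<or> r \<le> v (b j) \<longleftrightarrow> a j = 0 \<or> r \<le> v (a j)"
    "a j = 0 \<or> r \<le> real p * v (b j) + r' \<longleftrightarrow> a j = 0 \<or> r \<le> real p * v (a j) + r'" for j r r'
    using v_b[of j] by (cases "a j = 0"; simp)+
  have "lin (\<iota> d * \<pi>) b = \<iota> d ^ p * lin \<pi> a"
    unfolding lin_def sum_distrib_left
  proof (intro sum.cong refl)
    fix j assume "j \<in> {..<p}"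
    then have "\<iota> d ^ p = \<iota> d ^ (p - j) * \<iota> d ^ j" by (simp flip: power_add)
    then show "\<iota> (b j) * (\<iota> d * \<pi>) ^ j = \<iota> d ^ p * (\<iota> (a j) * \<pi> ^ j)"
      by (simp add: b_def iota_mult iota_power power_mult_distrib mult_ac)
  qed
  then have "(\<iota> d * \<pi>) ^ p + lin (\<iota> d * \<pi>) b = \<iota> d ^ p * (\<pi> ^ p + lin \<pi> a)"
    by (simp add: power_mult_distrib algebra_simps)
  moreover have "\<iota> d * \<pi> \<in> L"
    using a M.iota_L by (intro subfield_mult[OF M.subfield]) (auto simp: eis_data_def)
  ultimately have "eis_data L (\<iota> d * \<pi>) b"
    using a(1) v_b b0 vb unfolding eis_data_def eisenstein_def vge_def by simp
  moreover have "lead_coef b = lead_coef a * c ^ m"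
  proof -
    have "lead_coef b = - (of_nat ri * (d ^ (p - ri) * a ri)) / (d ^ p * (- a 0)) ^ rn"
      by (simp add: lead_coef_def b_def)
    also have "\<dots> = lead_coef a * (d ^ (p - ri) / d ^ (p * rn))"
      by (simp only: lead_coef_def power_mult_distrib power_mult times_divide_times_eq) (simp add: mult_ac)
    also have "p * rn = m + (p - ri)" using m_eq ri_less by simp
    also have "d ^ (p - ri) / d ^ (m + (p - ri)) = c ^ m"
      using d c0 by (simp add: power_add d_def field_simps)
    finally show ?thesis .
  qed
  moreover have "same_lead v (w * c ^ m) (lead_coef a * c ^ m)"
    using a(2) c0 by (intro valuation.same_lead_mult[OF valuation_v] valuation.same_lead_refl[OF valuation_v]) auto
  ultimately show ?thesis
    using w assms(3) unfolding inv_rel_def by (metis Tx_mult Tx_power)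
qed

text \<open>The isomorphism carries the Eisenstein equation of \<pi> to that of \<sigma> \<pi>, with
  coefficients \<phi>(a_j), where \<phi> is the automorphism induced on K. Since \<phi> preserves
  values and residues, \<open>lead_coef\<close> keeps its residue.\<close>

lemma k_iso_inv:
  assumes L: "is_subfield L1" "range \<iota> \<subseteq> L1" and iso: "k_isomorphic \<iota> v L1 L2" and w: "inv_rel L1 w"
  shows "inv_rel L2 w"
proof -
  obtain \<sigma> where \<sigma>: "field_hom_on L1 \<sigma>" "bij_betw \<sigma> L1 L2" "\<sigma> ` range \<iota> = range \<iota>"
    "\<forall>x\<in>val_ring v. \<exists>y. \<sigma> (\<iota> x) = \<iota> y \<and> y - x \<in> val_max_ideal v"
    using iso by (auto simp: k_isomorphic_def)
  have "\<forall>x. \<exists>y. \<sigma> (\<iota> x) = \<iota> y" using \<sigma>(3) by (metis imageI rangeE rangeI)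
  then obtain \<phi> where \<phi>: "\<And>x. \<sigma> (\<iota> x) = \<iota> (\<phi> x)" by metis
  note hom = hom_on_subfield[OF \<sigma>(1) L(1)]
  have iL: "\<iota> x \<in> L1" for x using L(2) by auto
  have hom': "\<phi> (x * y) = \<phi> x * \<phi> y" "\<phi> (- x) = - \<phi> x" "\<phi> (x ^ n) = \<phi> x ^ n" "x \<noteq> 0 \<Longrightarrow> \<phi> x \<noteq> 0"
    "\<phi> (x + y) = \<phi> x + \<phi> y" for x y n
  proof -
    have "\<iota> (\<phi> (x * y)) = \<iota> (\<phi> x * \<phi> y)" by (simp add: hom(4)[OF iL iL] iota_mult flip: \<phi>)
    then show "\<phi> (x * y) = \<phi> x * \<phi> y" by simp
    have "\<iota> (\<phi> (x + y)) = \<iota> (\<phi> x + \<phi> y)" by (simp add: hom(3)[OF iL iL] iota_add flip: \<phi>)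
    then show "\<phi> (x + y) = \<phi> x + \<phi> y" by simp
    have "\<iota> (\<phi> (- x)) = \<iota> (- \<phi> x)" by (simp add: hom(5)[OF iL] iota_minus flip: \<phi>)
    then show "\<phi> (- x) = - \<phi> x" by simp
    have "\<iota> (\<phi> (x ^ n)) = \<iota> (\<phi> x ^ n)" by (simp add: hom(6)[OF iL] iota_power flip: \<phi>)
    then show "\<phi> (x ^ n) = \<phi> x ^ n" by simp
    show "\<phi> x \<noteq> 0" if "x \<noteq> 0"
      using hom(7)[OF iL, of x] that by (auto simp: \<phi>)
  qed
  have "\<iota> (\<phi> 1) = \<iota> 1" using \<phi>[of 1] hom(2) by simp
  then have \<phi>_1: "\<phi> 1 = 1" by (simp only: iota_eq_iff)
  have \<phi>_nat: "\<phi> (of_nat j) = of_nat j" for j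
    using \<phi>[of 0] hom(1) by (induction j) (auto simp: hom' \<phi>_1)
  have res: "vgt v 0 (\<phi> x - x)" if "vge v 0 x" for x
    using \<sigma>(4) that by (auto simp: val_ring_def val_max_ideal_def vge_def vgt_def \<phi>)
  have "surj \<phi>"
  unfolding surj_def
  proof
    fix y
    have "\<iota> y \<in> \<sigma> ` range \<iota>" unfolding \<sigma>(3) by simp
    then obtain x where "\<iota> y = \<sigma> (\<iota> x)" by auto
    then have "y = \<phi> x" by (simp add: \<phi>)
    then show "\<exists>x. y = \<phi> x" ..
  qed
  have \<phi>_0: "\<phi> 0 = 0" using \<phi>[of 0] hom(1) by simp
  have \<phi>v: "v (\<phi> x) = v x" if "x \<noteq> 0" for x
    by (rule residual_identity_val(2)[OF hom'(1) \<phi>_1 \<open>surj \<phi>\<close> \<phi>_0 res that])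
  obtain \<pi> a where a: "eis_data L1 \<pi> a" "same_lead v w (lead_coef a)" and wT: "w \<in> Tx"
    using w by (auto simp: inv_rel_def)
  have \<pi>: "\<pi> \<in> L1" using a by (simp add: eis_data_def)
  have "\<sigma> (\<pi> ^ p + lin \<pi> a) = \<sigma> \<pi> ^ p + lin (\<sigma> \<pi>) (\<phi> \<circ> a)"
    using hom(3)[OF subfield_power[OF L(1) \<pi>] lin_mem[OF L \<pi>]] hom(6)[OF \<pi>]
      hom_on_lin[OF \<sigma>(1) L \<pi> \<phi>] by simp
  moreover have vphi: "(\<phi> \<circ> a) j = 0 \<longleftrightarrow> a j = 0" "(\<phi> \<circ> a) j = 0 \<or> r \<le> v ((\<phi> \<circ> a) j) \<longleftrightarrow> a j = 0 \<or> r \<le> v (a j)"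
    "(\<phi> \<circ> a) j = 0 \<or> r \<le> real p * v ((\<phi> \<circ> a) j) + r' \<longleftrightarrow> a j = 0 \<or> r \<le> real p * v (a j) + r'" for j r r'
    using hom'(4)[of "a j"] \<phi>_0 \<phi>v[of "a j"] by (cases "a j = 0"; simp)+
  ultimately have "eis_data L2 (\<sigma> \<pi>) (\<phi> \<circ> a)"
    using a(1) hom(1) hom'(4) vphi bij_betwE[OF \<sigma>(2)] ri_less \<phi>v
    unfolding eis_data_def eisenstein_def vge_def by simp
  moreover have "lead_coef (\<phi> \<circ> a) = \<phi> (lead_coef a)"
  proof -
    have nz: "a 0 \<noteq> 0" using a(1) by (simp add: eis_data_def eisenstein_def)
    have "lead_coef a * (- a 0) ^ rn = - (of_nat ri * a ri)" using nz by (simp add: lead_coef_def)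
    then have "\<phi> (lead_coef a) * (- \<phi> (a 0)) ^ rn = - (of_nat ri * \<phi> (a ri))"
      by (metis hom'(1-3) \<phi>_nat)
    then show ?thesis using hom'(4)[OF nz] by (simp add: lead_coef_def field_simps)
  qed
  moreover have "same_lead v (lead_coef a) (\<phi> (lead_coef a))"
    using res[of "lead_coef a"] lead_coef_val[OF a(1)] valuation.vgt_diff_commute[OF valuation_v]
    by (intro valuation.same_lead_iff[OF valuation_v]) (auto simp: vge_def)
  then have "same_lead v w (\<phi> (lead_coef a))"
    by (rule valuation.same_lead_trans[OF valuation_v a(2)])
  ultimately show ?thesis using wT unfolding inv_rel_def by metis
qed

text \<open>The coefficients determine the number of every nontrivial embedding at \<pi>, and
  \<open>change_prime\<close> carries it to all other prime elements. The embedding \<tau> is there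
  so that the set of ramification numbers is not empty.\<close>

lemma E_I:
  assumes M: "tot_ram v p \<iota> \<nu> L" and data: "eis_data L \<pi> a"
    and \<tau>: "K_embedding \<iota> L \<tau>" "\<exists>x\<in>L. \<tau> x \<noteq> x"
  shows "L \<in> E"
proof -
  interpret M: tot_ram v p \<iota> \<nu> L by (rule M)
  note \<pi> = eis_data_prime[OF M data]
  obtain w where w: "w \<in> Tx" "same_lead v w (lead_coef a)" by (rule lead_coef_residue[OF data])
  have num: "ramification_number \<nu> \<pi>' \<sigma> = real m / (real p - 1)"
    if \<pi>': "prime_element L \<nu> \<pi>'" and \<sigma>: "K_embedding \<iota> L \<sigma>" "\<exists>x\<in>L. \<sigma> x \<noteq> x" for \<pi>' \<sigma>
  proof -
    have p': "\<pi>' \<in> L" "\<pi>' \<noteq> 0" "\<nu> \<pi>' = 1" using \<pi>' by (auto simp: prime_element_def)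
    have nt: "\<sigma> \<pi> \<noteq> \<pi>" by (rule M.K_embedding_moves[OF \<sigma> \<pi>(1-3)])
    have val: "\<nu> (\<sigma> \<pi> - \<pi>) = real m / (real p - 1) + 1"
      by (rule conjugate_lead(2)[OF M data w M.K_embedding_eisenstein[OF \<sigma>(1) \<pi>(1,4)] nt])
    then have "\<nu> (\<sigma> \<pi> - \<pi>) > 1" using break_pos by simp
    then obtain c where c: "c \<in> Tx" "same_lead \<nu> (\<sigma> \<pi>' - \<pi>') (\<iota> c * (\<sigma> \<pi> - \<pi>))"
      using M.change_prime[OF \<sigma>(1) \<pi>(1-3) p' nt] by blast
    have "\<nu> (\<sigma> \<pi>' - \<pi>') = \<nu> (\<sigma> \<pi> - \<pi>)"
      using M.same_lead_val[OF c(2)] c(1) nt by (simp add: M.val_mult M.T_val' Tx_def)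
    then show ?thesis using val by (simp add: ramification_number_def)
  qed
  have "prime_element L \<nu> \<pi>" using \<pi> by (simp add: prime_element_def)
  then have ex: "ramification_number \<nu> \<pi> \<tau> = real m / (real p - 1)" "prime_element L \<nu> \<pi>"
    using num \<tau> by blast+
  have "{ramification_number \<nu> \<pi> \<sigma> | \<pi> \<sigma>. prime_element L \<nu> \<pi> \<and> K_embedding \<iota> L \<sigma> \<and>
      (\<exists>x\<in>L. \<sigma> x \<noteq> x)} = {real m / (real p - 1)}"
  proof (intro equalityI subsetI)
    fix r assume "r \<in> {real m / (real p - 1)}"
    then show "r \<in> {ramification_number \<nu> \<pi> \<sigma> | \<pi> \<sigma>. prime_element L \<nu> \<pi> \<and>
        K_embedding \<iota> L \<sigma> \<and> (\<exists>x\<in>L. \<sigma> x \<noteq> x)}"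
      using ex \<tau> by (intro CollectI exI[of _ \<pi>] exI[of _ \<tau>]) simp
  qed (use num in auto)
  then have "has_ramification_break \<iota> v L (real m / (real p - 1))"
    using M.normalized unfolding has_ramification_break_def by blast
  then show ?thesis
    using M.subfield M.iota_L M.ext_degree M.totally_ramified
    by (simp add: E_def ramified_exts_def subextension_def)
qed

section \<open>Normal form\<close>

text \<open>The lower coefficients of X^p - \<omega> t^rn X^ri - t. Their \<open>lead_coef\<close>
  is ri \<omega>, so an extension with invariant w calls for \<omega> = w / ri.\<close>

definition nf_coeff :: "'k \<Rightarrow> 'k \<Rightarrow> nat \<Rightarrow> 'k" where
  "nf_coeff \<omega> t j = (if j = 0 then - t else if j = ri then - (\<omega> * t ^ rn) else 0)"

definition nf_eval :: "'k \<Rightarrow> 'k \<Rightarrow> 'a \<Rightarrow> 'a" where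
  "nf_eval \<omega> t x = x ^ p - \<iota> (\<omega> * t ^ rn) * x ^ ri - \<iota> t"

lemma nf_eval_lin: "nf_eval \<omega> t x = x ^ p + lin x (nf_coeff \<omega> t)"
proof -
  have "(\<Sum>j\<in>{1..<p}. \<iota> (nf_coeff \<omega> t j) * x ^ j) = (\<Sum>j\<in>{1..<p}. if j = ri then - \<iota> (\<omega> * t ^ rn) * x ^ ri else 0)"
    by (intro sum.cong) (auto simp: nf_coeff_def iota_minus)
  also have "\<dots> = - \<iota> (\<omega> * t ^ rn) * x ^ ri" using ri by simp
  finally have "lin x (nf_coeff \<omega> t) = \<iota> (- t) - \<iota> (\<omega> * t ^ rn) * x ^ ri"
    unfolding lin_split by (simp add: nf_coeff_def)
  then show ?thesis by (simp add: nf_eval_def iota_minus)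
qed

lemma nf_eisenstein:
  assumes "\<omega> \<in> T" "t \<noteq> 0" "v t = 1" "nf_eval \<omega> t x = 0"
  shows "eisenstein x (nf_coeff \<omega> t)"
proof -
  have "vge v 1 (\<omega> * t ^ rn)"
  proof -
    have "vge v (0 + real rn) (\<omega> * t ^ rn)"
      using assms T_vge_0 valuation.vge_power[OF valuation_v, of 1 t rn]
      by (intro valuation.vge_mult[OF valuation_v]) (auto simp: vge_def)
    then show ?thesis using rn_pos by (elim vge_mono) simp
  qed
  moreover have "vge v 1 t" using assms by (simp add: vge_def)
  ultimately show ?thesis
    using assms valuation.val_minus[OF valuation_v] valuation.vge_minus[OF valuation_v]
    by (auto simp: eisenstein_def nf_coeff_def simp flip: nf_eval_lin)
qed

context
  fixes \<nu> L
  assumes M: "tot_ram v p \<iota> \<nu> L"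
begin

interpretation M: tot_ram v p \<iota> \<nu> L by (rule M)

lemma nf_main_term:
  assumes "\<omega> \<in> Tx" "t \<noteq> 0" "v t = 1" "x \<noteq> 0" "\<nu> x = 1"
  shows "\<nu> (\<iota> (\<omega> * t ^ rn) * x ^ ri) = real m + real p" "\<iota> (\<omega> * t ^ rn) * x ^ ri \<noteq> 0"
  using assms m_eq_real
  by (simp_all add: iota_mult iota_power M.val_mult M.val_power M.val_iota T_val Tx_def)

text \<open>Linearization in t and x simultaneously. The threshold r + m + p - 1 is the value of the
  linear term when d has value r. The power d^p is exact by Frobenius and is retained together with
  s, because it need not be negligible.\<close>

lemma nf_expand:
  fixes r :: nat
  assumes \<omega>: "\<omega> \<in> Tx" and t: "t \<noteq> 0" "v t = 1" and x: "x \<noteq> 0" "\<nu> x = 1"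
    and r: "r \<ge> 2" and d: "vge \<nu> (real r) d" and s: "vge v (real r) s"
  shows "vgt \<nu> (real r + real m + real p - 1) (nf_eval \<omega> (t + s) (x + d) -
     (nf_eval \<omega> t x + (d ^ p - \<iota> s) - \<iota> (\<omega> * t ^ rn) * (of_nat ri * x ^ (ri - 1) * d)))"
proof -
  \<comment> \<open>A is the effect of s on the coefficient of X^ri, and B is the part of the ri-th
    power beyond first order in d.\<close>
  define A where "A = \<iota> (\<omega> * ((t + s) ^ rn - t ^ rn)) * (x + d) ^ ri"
  define B where "B = \<iota> (\<omega> * t ^ rn) * ((x + d) ^ ri - x ^ ri - of_nat ri * x ^ (ri - 1) * d)"
  have "vgt \<nu> (real r + real m + real p - 1) B"
  proof (cases "d = 0")
    case False
    then have "\<nu> d > \<nu> x" using d r x by (simp add: vge_def)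
    from M.vgt_power_diff_first_order[OF x(1) False this, of ri]
    have "vgt \<nu> (\<nu> (\<iota> (\<omega> * t ^ rn)) + ((real ri - 1) * \<nu> x + \<nu> d)) B"
      unfolding B_def by (intro M.vge_vgt_mult) simp_all
    moreover have "\<nu> (\<iota> (\<omega> * t ^ rn)) = real p * real rn"
      using \<omega> t by (simp add: iota_mult iota_power M.val_mult M.val_power M.val_iota T_val Tx_def)
    ultimately show ?thesis
      using m_eq_real d False x by (elim vgt_mono) (simp add: vge_def)
  qed (simp add: B_def)
  moreover have "vgt \<nu> (real r + real m + real p - 1) A"
  proof -
    have "vge v ((real rn - 1) * 1 + real r) ((t + s) ^ rn - t ^ rn)"
      using t s r by (intro valuation.vge_power_diff[OF valuation_v] valuation.vge_add[OF valuation_v])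
        (auto simp: vge_def)
    then have "vge v (real rn - 1 + real r) (\<omega> * ((t + s) ^ rn - t ^ rn))"
      using \<omega> T_vge_0 by (intro valuation.vge_mult_0[OF valuation_v]) (auto simp: Tx_def)
    then have "vge \<nu> (real p * (real rn - 1 + real r)) (\<iota> (\<omega> * ((t + s) ^ rn - t ^ rn)))"
      by (simp only: M.vge_iota)
    moreover have "vge \<nu> (real ri * 1) ((x + d) ^ ri)"
      using x d r by (intro M.vge_power M.vge_add) (auto simp: vge_def)
    ultimately have "vge \<nu> (real p * (real rn - 1 + real r) + real ri * 1) A"
      unfolding A_def by (rule M.vge_mult)
    \<comment> \<open>The right-hand side equals m + p r, so the claim is r - 1 < p (r - 1), which
      uses r > 1.\<close>
    moreover have "real r + real m + real p - 1 < real p * (real rn - 1 + real r) + real ri * 1"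
    proof -
      have "1 * (real r - 1) < real p * (real r - 1)"
        using p_gt_1 r by (intro mult_strict_right_mono) auto
      then show ?thesis using m_eq_real by (simp add: algebra_simps)
    qed
    ultimately show ?thesis by (rule vge_imp_vgt)
  qed
  ultimately have "vgt \<nu> (real r + real m + real p - 1) (- A - B)"
    by (intro M.vgt_diff) simp_all
  moreover have "nf_eval \<omega> (t + s) (x + d) -
     (nf_eval \<omega> t x + (d ^ p - \<iota> s) - \<iota> (\<omega> * t ^ rn) * (of_nat ri * x ^ (ri - 1) * d)) = - A - B"
  proof -
    define C where "C = (x + d) ^ ri"
    have "\<iota> (\<omega> * ((t + s) ^ rn - t ^ rn)) = \<iota> (\<omega> * (t + s) ^ rn) - \<iota> (\<omega> * t ^ rn)"
      by (simp add: iota_mult iota_diff right_diff_distrib)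
    then show ?thesis
      unfolding nf_eval_def A_def B_def frobenius_add' iota_add[of t s] C_def[symmetric]
      by (simp only: right_diff_distrib left_diff_distrib) simp
  qed
  ultimately show ?thesis by simp
qed

lemma nf_mem: "x \<in> L \<Longrightarrow> nf_eval \<omega> t x \<in> L"
  using M.iota_L unfolding nf_eval_def
  by (auto intro!: subfield_diff[OF M.subfield] subfield_mult[OF M.subfield] subfield_power[OF M.subfield])

text \<open>A Newton step: c is the residue of the error divided by the derivative term
  \<open>den\<close>. The change s of t is left open, subject to cancelling the p-th power of the
  correction: \<open>normal_form\<close> moves t to achieve this, and \<open>nf_conjugate\<close>
  takes s = 0.\<close>

lemma nf_step:
  fixes r :: nat
  assumes \<omega>: "\<omega> \<in> Tx" and t: "t \<noteq> 0" "v t = 1" and x: "x \<in> L" "x \<noteq> 0" "\<nu> x = 1"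
    and r: "r \<ge> 2" and e: "vge \<nu> (real r + real m + real p - 1) (nf_eval \<omega> t x)"
  obtains c where "c \<in> T"
    "\<And>s. vge v (real r) s \<Longrightarrow> vgt \<nu> (real r + real m + real p - 1) ((\<iota> c * x ^ r) ^ p - \<iota> s) \<Longrightarrow>
       vge \<nu> (real (Suc r) + real m + real p - 1) (nf_eval \<omega> (t + s) (x + \<iota> c * x ^ r))"
proof -
  define N where "N = real r + real m + real p - 1"
  define den where "den = \<iota> (\<omega> * t ^ rn) * (of_nat ri * x ^ (ri - 1) * x ^ r)"
  have nz: "\<omega> \<noteq> 0" using \<omega> by (simp add: Tx_def)
  have vri: "\<nu> (of_nat ri) = 0"
    using M.T_val'[of "of_nat ri"] of_nat_ri by (simp add: Tx_def iota_of_nat)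
  have den: "den \<noteq> 0" "\<nu> den = N" "den \<in> L"
  proof -
    show "den \<noteq> 0" using nz t x of_nat_ri by (simp add: den_def)
    have "\<nu> den = real p * real rn + real (ri - 1) + real r"
      using nz t x of_nat_ri vri \<omega>
      by (simp add: den_def iota_mult iota_power M.val_mult M.val_power M.val_iota T_val Tx_def)
    then show "\<nu> den = N" using m_eq_real ri_pos by (simp add: N_def of_nat_diff)
    have "of_nat ri \<in> L" using M.iota_L by (auto simp flip: iota_of_nat)
    then show "den \<in> L" using x M.iota_L unfolding den_def
      by (auto intro!: subfield_mult[OF M.subfield] subfield_power[OF M.subfield])
  qed
  have "vge \<nu> 0 (nf_eval \<omega> t x / den)" using e den by (simp add: M.vge_divide N_def)
  moreover have "nf_eval \<omega> t x / den \<in> L" using den nf_mem x by (intro subfield_divide[OF M.subfield])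
  ultimately obtain c where c: "c \<in> T" "vgt \<nu> 0 (nf_eval \<omega> t x / den - \<iota> c)"
    using M.residue_L by blast
  have "nf_eval \<omega> t x / den - \<iota> c = (nf_eval \<omega> t x - den * \<iota> c) / den" using den by (simp add: field_simps)
  then have main: "vgt \<nu> N (nf_eval \<omega> t x - den * \<iota> c)" using c den by (simp add: M.vgt_divide)
  define d where "d = \<iota> c * x ^ r"
  have dr: "vge \<nu> (0 + real r) d"
    unfolding d_def using c(1) x T_vge_0 by (intro M.vge_mult) (auto simp: M.vge_iota_0 vge_def[of _ "real r"] M.val_power)
  have dx: "x + d \<in> L" using x M.iota_L unfolding d_def
    by (auto intro!: subfield_add[OF M.subfield] subfield_mult[OF M.subfield] subfield_power[OF M.subfield])
  show ?thesis
  proof (rule that[OF c(1)])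
    fix s assume s: "vge v (real r) s" and ds: "vgt \<nu> (real r + real m + real p - 1) ((\<iota> c * x ^ r) ^ p - \<iota> s)"
    have den_d: "\<iota> (\<omega> * t ^ rn) * (of_nat ri * x ^ (ri - 1) * d) = den * \<iota> c"
      by (simp add: den_def d_def mult_ac)
    have "vgt \<nu> N (nf_eval \<omega> (t + s) (x + d) -
        (nf_eval \<omega> t x + (d ^ p - \<iota> s) - den * \<iota> c))"
      using nf_expand[OF \<omega> t x(2,3) r _ s, of d] dr unfolding den_d N_def by simp
    from M.vgt_add[OF M.vgt_add[OF this main] ds[folded d_def N_def]]
    have "vgt \<nu> N (nf_eval \<omega> (t + s) (x + d))" by (simp add: algebra_simps)
    moreover have "N = of_int (int r + int m + int p - 1)" by (simp add: N_def)
    ultimately have "vge \<nu> (N + 1) (nf_eval \<omega> (t + s) (x + d))"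
      using M.L_int[OF nf_mem[OF dx], of "int r + int m + int p - 1"] by metis
    then show "vge \<nu> (real (Suc r) + real m + real p - 1) (nf_eval \<omega> (t + s) (x + \<iota> c * x ^ r))"
      by (simp add: N_def d_def algebra_simps)
  qed
qed

lemma nf_limit:
  assumes \<omega>: "\<omega> \<in> Tx"
    and "\<And>k. vge \<nu> (real k) (x k - x')" "\<And>k. vge v (real k) (t k - t')"
    and "\<And>k. vge \<nu> 0 (x k)" "\<And>k. vge v 0 (t k)" "vge \<nu> 0 x'" "vge v 0 t'"
    and e: "\<And>k. vge \<nu> (real k) (nf_eval \<omega> (t k) (x k))"
  shows "nf_eval \<omega> t' x' = 0"
proof (rule M.zero_if_vge_all)
  fix k
  have pw: "vge \<nu> (real k) (x k ^ n - x' ^ n)" for n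
    using M.vge_power_diff[of 0 "x k" x' "real k" n] assms by simp
  have pw': "vge v (real k) (t k ^ n - t' ^ n)" for n
    using valuation.vge_power_diff[OF valuation_v, of 0 "t k" t' "real k" n] assms by simp
  have up: "vge \<nu> (real k) (\<iota> z)" if "vge v (real k) z" for z
  proof -
    have "vge \<nu> (real p * real k) (\<iota> z)" using that by (simp only: M.vge_iota)
    then show ?thesis using p_pos by (elim vge_mono) (simp add: mult_le_cancel_right1)
  qed
  have \<omega>0: "vge v 0 \<omega>" using \<omega> T_vge_0 by (simp add: Tx_def)
  have "vge \<nu> (real k) (\<iota> (\<omega> * (t k ^ rn - t' ^ rn)) * x k ^ ri)"
    using pw' \<omega>0 assms by (intro M.vge_mult_0_right up valuation.vge_mult_0[OF valuation_v] M.vge_power_0)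
  moreover have "vge \<nu> (real k) (\<iota> (\<omega> * t' ^ rn) * (x k ^ ri - x' ^ ri))"
    using pw \<omega>0 assms
    by (intro M.vge_mult_0) (auto simp: M.vge_iota_0 intro!: valuation.vge_mult_0[OF valuation_v]
        valuation.vge_power_0[OF valuation_v])
  ultimately have "vge \<nu> (real k) (nf_eval \<omega> (t k) (x k) - (x k ^ p - x' ^ p)
      + (\<iota> (\<omega> * (t k ^ rn - t' ^ rn)) * x k ^ ri + \<iota> (\<omega> * t' ^ rn) * (x k ^ ri - x' ^ ri))
      + \<iota> (t k - t'))"
    using up[OF assms(3)] M.vge_diff[OF e pw] by (intro M.vge_add) (auto simp: iota_diff)
  also have "nf_eval \<omega> (t k) (x k) - (x k ^ p - x' ^ p)
      + (\<iota> (\<omega> * (t k ^ rn - t' ^ rn)) * x k ^ ri + \<iota> (\<omega> * t' ^ rn) * (x k ^ ri - x' ^ ri))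
      + \<iota> (t k - t') = nf_eval \<omega> t' x'"
    by (simp add: nf_eval_def iota_mult iota_diff algebra_simps)
  finally show "vge \<nu> (real k) (nf_eval \<omega> t' x')" .
qed

text \<open>
  Amano's normal form.  The correction \<open>x + c x\<^sup>r\<close> cancels the leading term of the error, and
  its \<open>p\<close>-th power \<open>c\<^sup>p x\<^bsup>p r\<^esup>\<close>, which is too large, is absorbed by \<open>t + c\<^sup>p t\<^sup>r\<close>.
\<close>

lemma normal_form:
  assumes w: "inv_rel L w"
  obtains t x where "t \<noteq> 0" "v t = 1" "x \<in> L" "x \<noteq> 0" "\<nu> x = 1" "nf_eval (w / of_nat ri) t x = 0"
proof -
  define \<omega> where "\<omega> = w / of_nat ri"
  obtain \<pi> a where a: "eis_data L \<pi> a" "same_lead v w (lead_coef a)" and wT: "w \<in> Tx"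
    using w by (auto simp: inv_rel_def)
  note \<pi> = eis_data_prime[OF M a(1)]
  have \<omega>: "\<omega> \<in> Tx" using wT of_nat_ri by (simp add: \<omega>_def Tx_divide)
  have a0: "- a 0 \<noteq> 0" "v (- a 0) = 1"
    using \<pi>(4) valuation.val_minus[OF valuation_v] by (auto simp: eisenstein_def)
  have w\<omega>: "w = of_nat ri * \<omega>" using of_nat_ri by (simp add: \<omega>_def)
  \<comment> \<open>By the choice of \<omega> the terms at \<open>ri\<close> agree to leading order.
    The other terms have value at least m + p and not congruent to it modulo p. So the error has
    value at least m + p + 1, which is the precision required by \<open>nf_step\<close> at r =
    2.\<close>
  have start: "vge \<nu> (real 2 + real m + real p - 1) (nf_eval \<omega> (- a 0) \<pi>)"
  proof -
    have "same_lead v (w * (- a 0) ^ rn / of_nat ri) (lead_coef a * (- a 0) ^ rn / of_nat ri)"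
      using a(2) a0 of_nat_ri
      by (intro valuation.same_lead_divide[OF valuation_v] valuation.same_lead_mult[OF valuation_v]
          valuation.same_lead_refl[OF valuation_v]) auto
    then have "same_lead v (\<omega> * (- a 0) ^ rn) (- a ri)"
      using a0 of_nat_ri by (simp add: \<omega>_def lead_coef_def)
    then have "same_lead \<nu> (\<iota> (\<omega> * (- a 0) ^ rn) * \<pi> ^ ri) (\<iota> (- a ri) * \<pi> ^ ri)"
      using \<pi> by (intro M.same_lead_mult M.same_lead_refl) (simp_all add: M.same_lead_iota)
    then have "vgt \<nu> (real m + real p) (\<iota> (\<omega> * (- a 0) ^ rn) * \<pi> ^ ri - \<iota> (- a ri) * \<pi> ^ ri)"
      using nf_main_term(1)[OF \<omega> a0 \<pi>(2,3)] by (simp add: same_lead_def)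
    then have 1: "vgt \<nu> (real m + real p) (- (\<iota> (\<omega> * (- a 0) ^ rn) * \<pi> ^ ri - \<iota> (- a ri) * \<pi> ^ ri))"
      by (simp only: M.vgt_minus)
    have 2: "vgt \<nu> (real m + real p) (\<Sum>j\<in>{1..<p} - {ri}. - (\<iota> (a j) * \<pi> ^ j))"
    proof (rule M.vgt_sum)
      fix j assume j: "j \<in> {1..<p} - {ri}"
      show "vgt \<nu> (real m + real p) (- (\<iota> (a j) * \<pi> ^ j))"
      proof (cases "a j = 0")
        case False
        have ge: "vge \<nu> (real m + real p) (\<iota> (a j) * \<pi> ^ j)" using vge_eis_term[OF M a(1)] j by simp
        have "\<nu> (\<iota> (a j) * \<pi> ^ j) \<noteq> real m + real p"
          using M.mod_p_unique[of "v (a j)" j "real rn" ri] j ri_less val_in_Ints[OF False] m_eq_real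
          by (auto simp: M.val_term[OF \<pi>(2,3) False])
        then show ?thesis using ge by (auto simp: vge_def vgt_def)
      qed simp
    qed
    have "\<pi> ^ p + lin \<pi> a = 0" using \<pi>(4) by (simp add: eisenstein_def)
    moreover have "(\<Sum>j\<in>{1..<p}. \<iota> (a j) * \<pi> ^ j) = \<iota> (a ri) * \<pi> ^ ri + (\<Sum>j\<in>{1..<p} - {ri}. \<iota> (a j) * \<pi> ^ j)"
      using ri by (intro sum.remove) auto
    ultimately have "\<pi> ^ p = - (\<iota> (a 0) + (\<iota> (a ri) * \<pi> ^ ri + (\<Sum>j\<in>{1..<p} - {ri}. \<iota> (a j) * \<pi> ^ j)))"
      by (simp only: lin_split eq_neg_iff_add_eq_0)
    then have "nf_eval \<omega> (- a 0) \<pi> = - (\<iota> (\<omega> * (- a 0) ^ rn) * \<pi> ^ ri - \<iota> (- a ri) * \<pi> ^ ri) +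
       (\<Sum>j\<in>{1..<p} - {ri}. - (\<iota> (a j) * \<pi> ^ j))"
      by (simp add: nf_eval_def sum_negf iota_minus)
    then have "vgt \<nu> (of_int (int m + int p)) (nf_eval \<omega> (- a 0) \<pi>)"
      using M.vgt_add[OF 1 2] by simp
    then show ?thesis using M.L_int[OF nf_mem[OF \<pi>(1)], of "int m + int p"] by (simp add: algebra_simps)
  qed
  \<comment> \<open>After k steps the next correction has order r = k + 2; t and x stay of value 1
    because all corrections have value at least 2.\<close>
  define P where "P k z \<longleftrightarrow> fst z \<noteq> 0 \<and> v (fst z) = 1 \<and> snd z \<in> L \<and> snd z \<noteq> 0 \<and> \<nu> (snd z) = 1 \<and>
     vge \<nu> (real (k + 2) + real m + real p - 1) (nf_eval \<omega> (fst z) (snd z))" for k :: nat and z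
  define Q where "Q k z z' \<longleftrightarrow> vge v (real (k + 2)) (fst z' - fst z) \<and> vge \<nu> (real (k + 2)) (snd z' - snd z)"
    for k :: nat and z z' :: "'k \<times> 'a"
  have "\<exists>f. \<forall>k. P k (f k) \<and> Q k (f k) (f (Suc k))"
  proof (rule dependent_nat_choice)
    show "\<exists>z. P 0 z" using start a0 \<pi> by (intro exI[of _ "(- a 0, \<pi>)"]) (simp add: P_def)
    fix z k assume "P k z"
    then obtain t x where z: "z = (t, x)" and t: "t \<noteq> 0" "v t = 1" and x: "x \<in> L" "x \<noteq> 0" "\<nu> x = 1"
      and e: "vge \<nu> (real (k + 2) + real m + real p - 1) (nf_eval \<omega> t x)"
      by (cases z) (auto simp: P_def)
    define r where "r = k + 2"
    have r: "r \<ge> 2" by (simp add: r_def)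
    obtain c where c: "c \<in> T"
      "\<And>s. vge v (real r) s \<Longrightarrow> vgt \<nu> (real r + real m + real p - 1) ((\<iota> c * x ^ r) ^ p - \<iota> s) \<Longrightarrow>
         vge \<nu> (real (Suc r) + real m + real p - 1) (nf_eval \<omega> (t + s) (x + \<iota> c * x ^ r))"
      using nf_step[OF \<omega> t x r e[folded r_def]] by blast
    define s where "s = c ^ p * t ^ r"
    have s: "vge v (real r) s"
    proof -
      have "vge v (0 + real r) s" unfolding s_def
        using c(1) t T_vge_0 valuation.val_power[OF valuation_v, of t r]
        by (intro valuation.vge_mult[OF valuation_v] valuation.vge_power_0[OF valuation_v]) (auto simp: vge_def[of _ "real r"])
      then show ?thesis by simp
    qed
    have xd: "vge \<nu> (real r) (\<iota> c * x ^ r)"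
    proof -
      have "vge \<nu> (0 + real r) (\<iota> c * x ^ r)"
        using c(1) x T_vge_0 by (intro M.vge_mult) (auto simp: M.vge_iota_0 vge_def[of _ "real r"] M.val_power)
      then show ?thesis by simp
    qed
    \<comment> \<open>The elements x^p and t agree up to value m + p, hence their r-th powers agree
      up to (r - 1) p + m + p. This exceeds the threshold because r - 1 < (r - 1) p.\<close>
    have "vgt \<nu> (real r + real m + real p - 1) ((\<iota> c * x ^ r) ^ p - \<iota> s)"
    proof -
      have "vge \<nu> (real m + real p) (nf_eval \<omega> t x + \<iota> (\<omega> * t ^ rn) * x ^ ri)"
        using vge_mono[OF e] nf_main_term(1)[OF \<omega> t x(2,3)] by (intro M.vge_add) (auto simp: vge_def)
      then have "vge \<nu> (real m + real p) (x ^ p - \<iota> t)" by (simp add: nf_eval_def)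
      then have "vge \<nu> ((real r - 1) * real p + (real m + real p)) ((x ^ p) ^ r - \<iota> t ^ r)"
        using x t by (intro M.vge_power_diff) (auto simp: vge_def M.val_power M.val_iota)
      then have "vge \<nu> (0 + ((real r - 1) * real p + (real m + real p))) (\<iota> (c ^ p) * ((x ^ p) ^ r - \<iota> t ^ r))"
        using c(1) T_vge_0 T_power by (intro M.vge_mult) (auto simp: M.vge_iota_0)
      moreover have "\<iota> (c ^ p) * ((x ^ p) ^ r - \<iota> t ^ r) = (\<iota> c * x ^ r) ^ p - \<iota> s"
        by (simp add: s_def iota_mult iota_power power_mult_distrib algebra_simps flip: power_mult)
      moreover have "1 * (real r - 1) < real p * (real r - 1)"
        using p_gt_1 r by (intro mult_strict_right_mono) auto
      then have "real r + real m + real p - 1 < 0 + ((real r - 1) * real p + (real m + real p))"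
        by (simp add: algebra_simps)
      ultimately show ?thesis by (metis vge_imp_vgt)
    qed
    note e' = c(2)[OF s this]
    have t': "t + s \<noteq> 0 \<and> v (t + s) = v t"
      using t s r by (intro valuation.val_add_eq[OF valuation_v]) (auto elim!: vge_imp_vgt)
    have x': "x + \<iota> c * x ^ r \<noteq> 0 \<and> \<nu> (x + \<iota> c * x ^ r) = \<nu> x"
      using x xd r by (intro M.val_add_eq) (auto elim!: vge_imp_vgt)
    have "x + \<iota> c * x ^ r \<in> L" using x M.iota_L
      by (auto intro!: subfield_add[OF M.subfield] subfield_mult[OF M.subfield] subfield_power[OF M.subfield])
    then show "\<exists>z'. P (Suc k) z' \<and> Q k z z'"
      using e' t' x' t x s xd unfolding P_def Q_def z r_def
      by (intro exI[of _ "(t + s, x + \<iota> c * x ^ (k + 2))"]) simp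
  qed
  then obtain f where f: "\<And>k. P k (f k)" "\<And>k. Q k (f k) (f (Suc k))" by blast
  define tt where "tt k = fst (f k)" for k
  define xx where "xx k = snd (f k)" for k
  have P: "tt k \<noteq> 0" "v (tt k) = 1" "xx k \<in> L" "xx k \<noteq> 0" "\<nu> (xx k) = 1"
     "vge \<nu> (real (k + 2) + real m + real p - 1) (nf_eval \<omega> (tt k) (xx k))" for k
    using f(1)[of k] by (auto simp: P_def tt_def xx_def)
  have Q: "vge v (real (k + 2)) (tt (Suc k) - tt k)" "vge \<nu> (real (k + 2)) (xx (Suc k) - xx k)" for k
    using f(2)[of k] by (auto simp: Q_def tt_def xx_def)
  have Q': "vge v (real k) (tt (Suc k) - tt k)" "vge \<nu> (real k) (xx (Suc k) - xx k)" for k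
    by (rule vge_mono[OF Q(1)], simp) (rule vge_mono[OF Q(2)], simp)
  have Q2: "vge v 2 (tt (Suc k) - tt k)" "vge \<nu> 2 (xx (Suc k) - xx k)" for k
    by (rule vge_mono[OF Q(1)], simp) (rule vge_mono[OF Q(2)], simp)
  obtain t where t: "\<And>k. vge v (real k) (tt k - t)"
    using complete Q'(1) unfolding val_complete_def by blast
  obtain x where x: "x \<in> L" "\<And>k. vge \<nu> (real k) (xx k - x)"
    using M.complete_L Q'(2) P(3) unfolding val_complete_def by blast
  have "vge v 2 (tt 0 - t)" by (rule valuation.vge_limit[OF valuation_v Q2(1) t])
  then have "vgt v (v (tt 0)) (t - tt 0)"
    using P(2)[of 0] valuation.vge_diff_commute[OF valuation_v] by (auto elim!: vge_imp_vgt)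
  then have t1: "t \<noteq> 0" "v t = 1"
    using valuation.val_add_eq[OF valuation_v P(1)[of 0], of "t - tt 0"] P(2)[of 0] by auto
  have "vge \<nu> 2 (xx 0 - x)" by (rule M.vge_limit[OF Q2(2) x(2)])
  then have "vgt \<nu> (\<nu> (xx 0)) (x - xx 0)"
    using P(5)[of 0] M.vge_diff_commute by (auto elim!: vge_imp_vgt)
  then have x1: "x \<noteq> 0" "\<nu> x = 1"
    using M.val_add_eq[OF P(4)[of 0], of "x - xx 0"] P(5)[of 0] by auto
  have "nf_eval \<omega> t x = 0"
  proof (rule nf_limit[OF \<omega> x(2) t])
    show "vge \<nu> (real k) (nf_eval \<omega> (tt k) (xx k))" for k
      by (rule vge_mono[OF P(6)]) (use p_pos in simp)
  qed (use P t1 x1 in \<open>auto simp: vge_def\<close>)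
  then show ?thesis using that t1 x x1 by (simp add: \<omega>_def)
qed

end

text \<open>As \<phi> fixes \<omega> and sends t to t', it carries one normal form to the other. It
  is used with the automorphism that exchanges uniformizers to get k-isomorphisms, and with the
  identity to get K-embeddings.\<close>

lemma nf_hom_extension:
  assumes M: "tot_ram v p \<iota> \<nu> L" and \<omega>: "\<omega> \<in> T"
    and t: "t \<noteq> 0" "v t = 1" and x: "x \<in> L" "x \<noteq> 0" "\<nu> x = 1" "nf_eval \<omega> t x = 0"
    and \<phi>: "\<And>x y. \<phi> (x + y) = \<phi> x + \<phi> y" "\<And>x y. \<phi> (x * y) = \<phi> x * \<phi> y" "\<phi> t = t'" "\<And>c. c \<in> T \<Longrightarrow> \<phi> c = c"
    and z: "nf_eval \<omega> t' z = 0"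
  obtains \<sigma> where "field_hom_on L \<sigma>" "\<sigma> x = z" "\<And>a. \<sigma> (\<iota> a) = \<iota> (\<phi> a)"
    "\<And>a. \<sigma> (lin x a) = lin z (\<phi> \<circ> a)"
proof -
  interpret M: tot_ram v p \<iota> \<nu> L by (rule M)
  have hom\<phi>: "field_hom_on UNIV \<phi>" using \<phi> by (simp add: field_hom_on_def)
  have hom: "field_hom_on UNIV (\<iota> \<circ> \<phi>)"
    using \<phi> by (simp add: field_hom_on_def iota_add iota_mult)
  note h = hom_on_subfield[OF hom\<phi> UNIV_subfield, simplified]
  have coeff: "\<phi> (nf_coeff \<omega> t j) = nf_coeff \<omega> t' j" for j
    using \<omega> \<phi>(3,4) by (simp add: nf_coeff_def h)
  have root: "z ^ p + (\<Sum>j<p. (\<iota> \<circ> \<phi>) (nf_coeff \<omega> t j) * z ^ j) = 0"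
    using z by (simp add: coeff nf_eval_lin lin_def)
  obtain \<sigma> where \<sigma>: "field_hom_on (range (lin x)) \<sigma>" "\<sigma> x = z" "\<And>a. \<sigma> (\<iota> a) = (\<iota> \<circ> \<phi>) a"
    using M.hom_extension[OF nf_eisenstein[OF \<omega> t x(4)] hom root] by blast
  have L: "range (lin x) = L" using M.generated[OF x(1-3)] by simp
  show ?thesis
  proof (rule that[of \<sigma>])
    show "field_hom_on L \<sigma>" using \<sigma>(1) by (simp add: L)
    show "\<sigma> x = z" by (rule \<sigma>)
    show \<iota>: "\<sigma> (\<iota> a) = \<iota> (\<phi> a)" for a using \<sigma>(3) by simp
    show "\<sigma> (lin x a) = lin z (\<phi> \<circ> a)" for a
      using hom_on_lin[where \<sigma> = \<sigma> and \<phi> = \<phi> and a = a, OF _ M.subfield M.iota_L x(1) \<iota>] \<sigma>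
      by (simp add: L)
  qed
qed

text \<open>The two normal forms share \<omega> and differ only in the uniformizer of K, and an
  automorphism of K over \<open>T\<close> takes one uniformizer to the other.\<close>

lemma inv_imp_k_isomorphic:
  assumes E: "L1 \<in> E" "L2 \<in> E" and w: "inv_rel L1 w" "inv_rel L2 w"
  shows "k_isomorphic \<iota> v L1 L2"
proof -
  obtain \<nu>1 where M1: "tot_ram v p \<iota> \<nu>1 L1" by (rule ramified_extE[OF E(1)])
  obtain \<nu>2 where M2: "tot_ram v p \<iota> \<nu>2 L2" by (rule ramified_extE[OF E(2)])
  interpret M1: tot_ram v p \<iota> \<nu>1 L1 by (rule M1)
  interpret M2: tot_ram v p \<iota> \<nu>2 L2 by (rule M2)
  define \<omega> where "\<omega> = w / of_nat ri"
  have \<omega>: "\<omega> \<in> T"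
    using w(1) of_nat_ri T_divide unfolding \<omega>_def by (simp add: inv_rel_def Tx_def)
  obtain t1 x1 where 1: "t1 \<noteq> 0" "v t1 = 1" "x1 \<in> L1" "x1 \<noteq> 0" "\<nu>1 x1 = 1" "nf_eval \<omega> t1 x1 = 0"
    using normal_form[OF M1 w(1)] unfolding \<omega>_def by blast
  obtain t2 x2 where 2: "t2 \<noteq> 0" "v t2 = 1" "x2 \<in> L2" "x2 \<noteq> 0" "\<nu>2 x2 = 1" "nf_eval \<omega> t2 x2 = 0"
    using normal_form[OF M2 w(2)] unfolding \<omega>_def by blast
  obtain \<phi> :: "'k \<Rightarrow> 'k" where \<phi>: "bij \<phi>" "\<And>x y. \<phi> (x + y) = \<phi> x + \<phi> y" "\<And>x y. \<phi> (x * y) = \<phi> x * \<phi> y"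
    "\<phi> t1 = t2" "\<And>c. c \<in> T \<Longrightarrow> \<phi> c = c" "\<And>N x. vge v (real N) x \<Longrightarrow> vge v (real N) (\<phi> x)"
    using uniformizer_automorphism[OF 1(1,2) 2(1,2)] by blast
  obtain \<sigma> where \<sigma>: "field_hom_on L1 \<sigma>" "\<sigma> x1 = x2" "\<And>a. \<sigma> (\<iota> a) = \<iota> (\<phi> a)"
    "\<And>a. \<sigma> (lin x1 a) = lin x2 (\<phi> \<circ> a)"
    using nf_hom_extension[OF M1 \<omega> 1 \<phi>(2-5) 2(6)] by blast
  have L1: "L1 = range (lin x1)" and L2: "L2 = range (lin x2)"
    using M1.generated[OF 1(3-5)] M2.generated[OF 2(3-5)] by auto
  have "inj_on \<sigma> L1"
  proof (rule inj_onI)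
    fix x y assume xy: "x \<in> L1" "y \<in> L1" "\<sigma> x = \<sigma> y"
    have "\<sigma> (x + - y) = 0"
      using xy hom_on_add[OF \<sigma>(1) M1.subfield xy(1) subfield_minus[OF M1.subfield xy(2)]]
        hom_on_minus[OF \<sigma>(1) M1.subfield xy(2)] by simp
    then have "x + - y = 0"
      using hom_on_nz[OF \<sigma>(1) M1.subfield] subfield_diff[OF M1.subfield xy(1,2)] by fastforce
    then show "x = y" by simp
  qed
  moreover have "\<sigma> ` L1 = L2"
  proof -
    have "\<sigma> ` L1 = range (\<lambda>a. lin x2 (\<phi> \<circ> a))" unfolding L1 image_image \<sigma>(4) ..
    also have "\<dots> = lin x2 ` range ((\<circ>) \<phi>)" by (simp add: image_image)
    also have "range ((\<circ>) \<phi>) = (UNIV :: (nat \<Rightarrow> 'k) set)"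
      using bij_is_surj[OF \<phi>(1)] surj_f_inv_f[of \<phi>] by (intro surjI[of _ "(\<circ>) (inv \<phi>)"]) (auto simp: fun_eq_iff)
    finally show ?thesis by (simp add: L2)
  qed
  moreover have "\<sigma> ` range \<iota> = range \<iota>"
    using bij_is_surj[OF \<phi>(1)] by (simp add: image_image \<sigma>(3)) (metis image_image)
  \<comment> \<open>x is congruent to some c in \<open>T\<close>, which \<phi> fixes, and \<phi>
    preserves the maximal ideal.\<close>
  moreover have "\<exists>y. \<sigma> (\<iota> x) = \<iota> y \<and> y - x \<in> val_max_ideal v" if "x \<in> val_ring v" for x
  proof -
    have "vge v 0 x" using that by (simp add: val_ring_def vge_def)
    then obtain c where c: "c \<in> T" "vge v 1 (x - c)" using T_approx by (auto simp: vgt_0_iff)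
    have "\<phi> x = \<phi> (x - c) + c" using \<phi>(2)[of "x - c" c] \<phi>(5)[OF c(1)] by simp
    moreover have "vge v 1 (\<phi> (x - c))" using \<phi>(6)[of 1] c(2) by simp
    ultimately have "vge v 1 (\<phi> x - c)" by simp
    then have "vge v 1 ((\<phi> x - c) - (x - c))" using c(2) by (rule valuation.vge_diff[OF valuation_v])
    then have "vgt v 0 (\<phi> x - x)" by (simp add: vgt_0_iff)
    then show ?thesis using \<sigma>(3)[of x] by (intro exI[of _ "\<phi> x"]) (simp add: val_max_ideal_def vgt_def)
  qed
  ultimately show ?thesis using \<sigma>(1) unfolding k_isomorphic_def bij_betw_def by blast
qed

text \<open>Newton's method with t fixed, starting at x + c x^(b + 1). At order b + 1 the p-th power
  of the correction and the linear term have the same value, and they cancel to leading order by the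
  condition on c. At orders r > b + 1 the p-th power has value at least p r > r + (p - 1)(b + 1) = r
  + m + p - 1 and is negligible.\<close>

lemma nf_conjugate:
  assumes M: "tot_ram v p \<iota> \<nu> L" and mb: "m = (p - 1) * b" and c: "c \<in> Tx"
    and t: "t \<noteq> 0" "v t = 1" and x: "x \<in> L" "x \<noteq> 0" "\<nu> x = 1"
    and \<omega>: "\<omega> \<in> Tx" "of_nat ri * \<omega> = c ^ (p - 1)" and e: "nf_eval \<omega> t x = 0"
  obtains z where "z \<in> L" "nf_eval \<omega> t z = 0" "vge \<nu> (real b + 2) (z - x - \<iota> c * x ^ (b + 1))"
proof -
  interpret M: tot_ram v p \<iota> \<nu> L by (rule M)
  have b: "b \<ge> 1" using mb m_pos by (cases b) auto
  have mbr: "real m + real p - 1 = (real p - 1) * (real b + 1)"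
    using mb p_pos by (simp add: of_nat_diff algebra_simps)
  have c0: "c \<noteq> 0" "\<nu> (\<iota> c) = 0" using c M.T_val' by (auto simp: Tx_def)
  define d where "d = \<iota> c * x ^ (b + 1)"
  have d: "d \<noteq> 0" "\<nu> d = real b + 1" using c0 x by (simp_all add: d_def M.val_mult M.val_power)
  have add_term: "y + \<iota> a * u ^ r \<in> L" if "y \<in> L" "u \<in> L" for y a u r
    using that M.iota_L
    by (auto intro!: subfield_add[OF M.subfield] subfield_mult[OF M.subfield] subfield_power[OF M.subfield])
  have dL: "x + d \<in> L" unfolding d_def by (intro add_term x)
  have start: "vge \<nu> (real (b + 2) + real m + real p - 1) (nf_eval \<omega> t (x + d))"
  proof -
    define N where "N = real (b + 1) + real m + real p - 1"
    have pw: "(\<iota> c * x ^ (b + 1)) ^ p = \<iota> c ^ p * (x ^ p) ^ (b + 1)"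
      by (simp only: power_mult_distrib mult.commute[of "b + 1" p] flip: power_mult)
    \<comment> \<open>Both terms to be cancelled are multiples of c^p x^(ri + b): one contains
      (x^p)^rn where the other contains t^rn.\<close>
    have exp: "p * (b + 1) = p * rn + (ri + b)"
    proof -
      have "p * (b + 1) = (p - 1) * b + b + p" using p_pos by (cases p) (simp_all add: algebra_simps)
      then show ?thesis using mb m_eq by simp
    qed
    have "(x ^ p) ^ (b + 1) = (x ^ p) ^ rn * x ^ (ri + b)"
      using exp by (metis power_add power_mult)
    then have dp: "d ^ p = \<iota> c ^ p * ((x ^ p) ^ rn * x ^ (ri + b))"
      unfolding d_def pw by simp
    have "of_nat ri * \<omega> * c = c ^ p" unfolding \<omega>(2) using p_pos by (rule power_minus_mult)
    then have cp: "of_nat ri * \<iota> \<omega> * \<iota> c = \<iota> c ^ p"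
      by (simp flip: iota_of_nat iota_mult iota_power)
    have "x ^ (ri + b) = x ^ (ri - 1) * x ^ (b + 1)"
    proof -
      have "ri + b = (ri - 1) + (b + 1)" using ri_pos by simp
      then show ?thesis by (simp only: power_add)
    qed
    then have "\<iota> (\<omega> * t ^ rn) * (of_nat ri * x ^ (ri - 1) * d)
        = (of_nat ri * \<iota> \<omega> * \<iota> c) * \<iota> t ^ rn * x ^ (ri + b)"
      by (simp only: d_def iota_mult iota_power mult_ac)
    then have diff: "d ^ p - \<iota> (\<omega> * t ^ rn) * (of_nat ri * x ^ (ri - 1) * d)
        = \<iota> c ^ p * x ^ (ri + b) * ((x ^ p) ^ rn - \<iota> t ^ rn)"
      unfolding dp cp by (simp add: algebra_simps)
    have "vge \<nu> (real m + real p) (x ^ p - \<iota> t)"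
    proof -
      have "x ^ p - \<iota> t = \<iota> (\<omega> * t ^ rn) * x ^ ri" using e by (simp add: nf_eval_def algebra_simps)
      then show ?thesis using nf_main_term(1)[OF M \<omega>(1) t x(2,3)] by (simp add: vge_def)
    qed
    then have "vge \<nu> ((real rn - 1) * real p + (real m + real p)) ((x ^ p) ^ rn - \<iota> t ^ rn)"
      using x t by (intro M.vge_power_diff) (auto simp: vge_def M.val_power M.val_iota)
    then have "vge \<nu> (real (ri + b) + ((real rn - 1) * real p + (real m + real p)))
        (\<iota> c ^ p * x ^ (ri + b) * ((x ^ p) ^ rn - \<iota> t ^ rn))"
      using x c0 by (intro M.vge_mult) (auto simp: vge_def M.val_mult M.val_power)
    moreover have "N < real (ri + b) + ((real rn - 1) * real p + (real m + real p))"
    proof -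
      have "0 \<le> (real rn - 1) * real p" using rn_pos by simp
      then show ?thesis using ri_pos by (simp add: N_def)
    qed
    ultimately have lead: "vgt \<nu> N (d ^ p - \<iota> (\<omega> * t ^ rn) * (of_nat ri * x ^ (ri - 1) * d))"
      unfolding diff by (rule vge_imp_vgt)
    have "vgt \<nu> N (nf_eval \<omega> (t + 0) (x + d) -
        (nf_eval \<omega> t x + (d ^ p - \<iota> 0) - \<iota> (\<omega> * t ^ rn) * (of_nat ri * x ^ (ri - 1) * d)))"
      unfolding N_def using b d by (intro nf_expand[OF M \<omega>(1) t x(2,3)]) (auto simp: vge_def)
    from M.vgt_add[OF this lead] have "vgt \<nu> N (nf_eval \<omega> t (x + d))" using e by simp
    moreover have "N = of_int (int b + int m + int p)" by (simp add: N_def)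
    ultimately have "vge \<nu> (N + 1) (nf_eval \<omega> t (x + d))"
      using M.L_int[OF nf_mem[OF M dL], of "int b + int m + int p"] by metis
    then show ?thesis by (simp add: N_def algebra_simps)
  qed
  define P where "P k z \<longleftrightarrow> z \<in> L \<and> z \<noteq> 0 \<and> \<nu> z = 1 \<and>
      vge \<nu> (real (k + b + 2) + real m + real p - 1) (nf_eval \<omega> t z)" for k :: nat and z
  define Q where "Q k z z' \<longleftrightarrow> vge \<nu> (real (k + b + 2)) (z' - z)" for k :: nat and z z'
  \<comment> \<open>The clause for k = 0 records the starting point, from which the leading term of
    z - x is read off at the end.\<close>
  have "\<exists>f. \<forall>k. P k (f k) \<and> Q k (f k) (f (Suc k)) \<and> (k = 0 \<longrightarrow> f k = x + d)"
  proof -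
    have "\<exists>f. \<forall>k. (P k (f k) \<and> (k = 0 \<longrightarrow> f k = x + d)) \<and> Q k (f k) (f (Suc k))"
    proof (rule dependent_nat_choice)
      have "x + d \<noteq> 0 \<and> \<nu> (x + d) = \<nu> x"
        using x d b by (intro M.val_add_eq) (auto simp: vgt_def)
      then show "\<exists>z. P 0 z \<and> (0 = (0::nat) \<longrightarrow> z = x + d)"
        using start dL x by (intro exI[of _ "x + d"]) (simp add: P_def)
      fix z k assume "P k z \<and> (k = 0 \<longrightarrow> z = x + d)"
      then have z: "z \<in> L" "z \<noteq> 0" "\<nu> z = 1"
        and ez: "vge \<nu> (real (k + b + 2) + real m + real p - 1) (nf_eval \<omega> t z)"
        by (auto simp: P_def)
      define r where "r = k + b + 2"
      have r: "r \<ge> 2" by (simp add: r_def)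
      obtain a where a: "a \<in> T"
        "\<And>s. vge v (real r) s \<Longrightarrow> vgt \<nu> (real r + real m + real p - 1) ((\<iota> a * z ^ r) ^ p - \<iota> s) \<Longrightarrow>
           vge \<nu> (real (Suc r) + real m + real p - 1) (nf_eval \<omega> (t + s) (z + \<iota> a * z ^ r))"
        using nf_step[OF M \<omega>(1) t z r ez[folded r_def]] by blast
      have zd: "vge \<nu> (real r) (\<iota> a * z ^ r)"
        using a(1) z T_vge_0 by (intro M.vge_mult_0) (auto simp: M.vge_iota_0 vge_def[of _ "real r"] M.val_power)
      have "vge \<nu> (real p * real r) ((\<iota> a * z ^ r) ^ p)" by (rule M.vge_power[OF zd])
      moreover have "real r + real m + real p - 1 < real p * real r"
      proof -
        have "(real p - 1) * (real b + 1) < (real p - 1) * real r"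
          using p_gt_1 by (intro mult_strict_left_mono) (auto simp: r_def)
        then show ?thesis using mbr by (simp add: algebra_simps)
      qed
      ultimately have "vgt \<nu> (real r + real m + real p - 1) ((\<iota> a * z ^ r) ^ p - \<iota> 0)"
        by (simp add: vge_imp_vgt)
      from a(2)[OF _ this] have ez': "vge \<nu> (real (Suc r) + real m + real p - 1) (nf_eval \<omega> t (z + \<iota> a * z ^ r))"
        by simp
      have "z + \<iota> a * z ^ r \<noteq> 0 \<and> \<nu> (z + \<iota> a * z ^ r) = \<nu> z"
        using z zd r by (intro M.val_add_eq) (auto elim!: vge_imp_vgt)
      then show "\<exists>z'. (P (Suc k) z' \<and> (Suc k = 0 \<longrightarrow> z' = x + d)) \<and> Q k z z'"
        using ez' z zd add_term[OF z(1) z(1), of a r] unfolding P_def Q_def r_def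
        by (intro exI[of _ "z + \<iota> a * z ^ (k + b + 2)"]) simp
    qed
    then show ?thesis by blast
  qed
  then obtain f where f: "\<And>k. P k (f k)" "\<And>k. Q k (f k) (f (Suc k))" "f 0 = x + d" by blast
  have Q: "vge \<nu> (real k) (f (Suc k) - f k)" "vge \<nu> (real b + 2) (f (Suc k) - f k)" for k
    using f(2)[of k] unfolding Q_def by (auto elim!: vge_mono)
  obtain z where z: "z \<in> L" "\<And>k. vge \<nu> (real k) (f k - z)"
    using M.complete_L Q(1) f(1) unfolding val_complete_def P_def by blast
  have lim: "vge \<nu> (real b + 2) (f 0 - z)" by (rule M.vge_limit[OF Q(2) z(2)])
  have "vge \<nu> 0 (f 0 - (f 0 - z))"
  proof (rule M.vge_diff)
    show "vge \<nu> 0 (f 0)" using f(1)[of 0] by (simp add: P_def vge_def)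
    show "vge \<nu> 0 (f 0 - z)" by (rule vge_mono[OF lim]) simp
  qed
  then have z0: "vge \<nu> 0 z" by simp
  have "nf_eval \<omega> t z = 0"
  proof (rule nf_limit[OF M \<omega>(1) z(2), where t = "\<lambda>_. t"])
    show "vge \<nu> (real k) (nf_eval \<omega> t (f k))" for k
    proof -
      have "vge \<nu> (real (k + b + 2) + real m + real p - 1) (nf_eval \<omega> t (f k))" using f(1) by (simp add: P_def)
      then show ?thesis by (rule vge_mono) (use p_pos in simp)
    qed
    show "vge \<nu> 0 (f k)" for k using f(1)[of k] by (simp add: P_def vge_def)
  qed (use t z0 in \<open>auto simp: vge_def\<close>)
  moreover have "vge \<nu> (real b + 2) (z - x - d)"
    using lim M.vge_minus[of "real b + 2" "f 0 - z"] by (simp add: f(3) algebra_simps)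
  ultimately show ?thesis using that z(1) by (simp add: d_def)
qed

text \<open>For 0 < j < p also j c is a (p - 1)-st root of w, so with j = 0 for x itself the normal
  form has p distinct roots z_j in L. Let y = lin x a be fixed by all automorphisms. Applying the
  one that sends x to z_j gives y = lin z_j a, so a polynomial of degree below p has p roots. It
  vanishes, and y = a_0 lies in K.\<close>

lemma galois_if_power:
  assumes L: "L \<in> E" and mb: "m = (p - 1) * b" and c: "c \<in> Tx" and w: "inv_rel L (c ^ (p - 1))"
  shows "galois_ext \<iota> L"
proof -
  obtain \<nu> where M: "tot_ram v p \<iota> \<nu> L" by (rule ramified_extE[OF L])
  interpret M: tot_ram v p \<iota> \<nu> L by (rule M)
  define \<omega> where "\<omega> = c ^ (p - 1) / of_nat ri"
  have \<omega>: "\<omega> \<in> Tx" using of_nat_ri c by (simp add: \<omega>_def Tx_divide Tx_power)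
  obtain t x where t: "t \<noteq> 0" "v t = 1" and x: "x \<in> L" "x \<noteq> 0" "\<nu> x = 1" and e: "nf_eval \<omega> t x = 0"
    using normal_form[OF M w] unfolding \<omega>_def by blast
  have "\<exists>z\<in>L. nf_eval \<omega> t z = 0 \<and> vge \<nu> (real b + 2) (z - x - \<iota> (of_nat j * c) * x ^ (b + 1))"
    if j: "j < p" for j
  proof (cases "j = 0")
    case True
    then show ?thesis using x e by (intro bexI[of _ x]) auto
  next
    case False
    have "of_nat j * c \<in> Tx" using of_nat_Tx[of j] j False c by (intro Tx_mult) auto
    moreover have "of_nat ri * \<omega> = (of_nat j * c) ^ (p - 1)"
      using of_nat_power_p_minus_1[of j] j False of_nat_ri by (simp add: \<omega>_def power_mult_distrib)
    ultimately show ?thesis using nf_conjugate[OF M mb _ t x \<omega> _ e] by metis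
  qed
  then obtain z where z: "\<And>j. j < p \<Longrightarrow> z j \<in> L" "\<And>j. j < p \<Longrightarrow> nf_eval \<omega> t (z j) = 0"
    "\<And>j. j < p \<Longrightarrow> vge \<nu> (real b + 2) (z j - x - \<iota> (of_nat j * c) * x ^ (b + 1))"
    by metis
  \<comment> \<open>The differences z_j - x agree with j c x^(b + 1) up to value b + 2, and the
    multiples j c are distinct.\<close>
  have z_inj: "inj_on z {..<p}"
  proof (rule inj_onI)
    fix i j assume ij: "i \<in> {..<p}" "j \<in> {..<p}" "z i = z j"
    then have "vge \<nu> (real b + 2) ((z i - x - \<iota> (of_nat i * c) * x ^ (b + 1)) - (z j - x - \<iota> (of_nat j * c) * x ^ (b + 1)))"
      by (intro M.vge_diff[OF z(3) z(3)]) auto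
    also have "(z i - x - \<iota> (of_nat i * c) * x ^ (b + 1)) - (z j - x - \<iota> (of_nat j * c) * x ^ (b + 1))
        = \<iota> ((of_nat j - of_nat i) * c) * x ^ (b + 1)"
      using ij by (simp add: iota_mult iota_diff algebra_simps)
    finally have ge: "vge \<nu> (real b + 2) (\<iota> ((of_nat j - of_nat i) * c) * x ^ (b + 1))" .
    have "(of_nat j - of_nat i) * c \<in> T"
      using c by (intro T_mult T_diff T_of_nat) (simp add: Tx_def)
    then have "\<nu> (\<iota> ((of_nat j - of_nat i) * c) * x ^ (b + 1)) = real (b + 1)" if "(of_nat j - of_nat i) * c \<noteq> 0"
      using that x M.T_val' iota_nz[OF that] unfolding M.val_mult[OF iota_nz[OF that] power_not_zero[OF x(2)]]
      by (simp add: M.val_power del: power_Suc)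
    then have "(of_nat j - of_nat i) * c = 0"
      using ge x unfolding vge_def by fastforce
    then have "(of_nat i :: 'k) = of_nat j" using c by (auto simp: Tx_def)
    then show "i = j" using of_nat_inj ij by (auto dest: inj_onD)
  qed
  have fixed: "y \<in> range \<iota>" if y: "y \<in> L" and inv: "\<And>\<sigma>. K_embedding \<iota> L \<sigma> \<Longrightarrow> \<sigma> ` L = L \<Longrightarrow> \<sigma> y = y" for y
  proof -
    obtain a where a: "y = lin x a" using y M.generated[OF x] by auto
    have root: "lin (z j) a = y" if j: "j < p" for j
    proof -
      obtain \<sigma> where \<sigma>: "field_hom_on L \<sigma>" "\<sigma> x = z j" "\<And>a. \<sigma> (\<iota> a) = \<iota> (id a)"
        "\<And>a. \<sigma> (lin x a) = lin (z j) (id \<circ> a)"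
        using nf_hom_extension[OF M Tx_T[OF \<omega>] t x e, of id t "z j"] z(2)[OF j] by auto
      have "eisenstein (z j) (nf_coeff \<omega> t)" using nf_eisenstein[OF Tx_T[OF \<omega>] t z(2)[OF j]] .
      then have "z j \<noteq> 0" "\<nu> (z j) = 1" using M.eisenstein_prime by auto
      then have "L = range (lin (z j))" using M.generated z(1)[OF j] by blast
      moreover have "\<sigma> ` L = range (\<lambda>a. lin (z j) a)"
        unfolding M.generated[OF x] image_image \<sigma>(4) by simp
      ultimately have "\<sigma> ` L = L" by simp
      then show ?thesis using inv[of \<sigma>] \<sigma> by (simp add: a K_embedding_def)
    qed
    define G where "G = (\<Sum>k<p. monom (\<iota> (a k)) k) + [:- y:]"
    have G: "poly G u = lin u a - y" for u by (simp add: G_def lin_def poly_sum poly_monom)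
    have "degree G < p" unfolding G_def
      using p_pos by (intro degree_add_less degree_sum_less) (auto intro: le_less_trans[OF degree_monom_le])
    have "G = 0"
    proof (rule ccontr)
      assume nz: "G \<noteq> 0"
      have "card (z ` {..<p}) \<le> card {u. poly G u = 0}"
        using root poly_roots_finite[OF nz] by (intro card_mono) (auto simp: G)
      also have "\<dots> \<le> degree G" by (rule card_poly_roots_bound[OF nz])
      finally show False using card_image[OF z_inj] \<open>degree G < p\<close> by simp
    qed
    then have "coeff G 0 = 0" by simp
    moreover have "coeff G 0 = \<iota> (a 0) - y"
    proof -
      have "(\<Sum>k<p. coeff (monom (\<iota> (a k)) k) 0) = (\<Sum>k<p. if k = 0 then \<iota> (a 0) else 0)"
        by (intro sum.cong) auto
      then show ?thesis using p_pos by (simp add: G_def coeff_sum)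
    qed
    ultimately have "y = \<iota> (a 0)" by simp
    then show ?thesis by simp
  qed
  show ?thesis unfolding galois_ext_def
  proof (intro equalityI subsetI)
    fix y assume "y \<in> {x \<in> L. \<forall>\<sigma>. K_embedding \<iota> L \<sigma> \<and> \<sigma> ` L = L \<longrightarrow> \<sigma> x = x}"
    then show "y \<in> range \<iota>" using fixed by blast
  next
    fix y assume "y \<in> range \<iota>"
    then show "y \<in> {x \<in> L. \<forall>\<sigma>. K_embedding \<iota> L \<sigma> \<and> \<sigma> ` L = L \<longrightarrow> \<sigma> x = x}"
      using M.iota_L by (auto simp: K_embedding_def)
  qed
qed

text \<open>A nontrivial automorphism makes y / \<pi>^(b + 1) a unit of L itself. Its residue c lies
  in the residue field of K, and c^(p - 1) = w.\<close>

lemma power_if_galois: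
  assumes L: "L \<in> E" and mb: "m = (p - 1) * b" and gal: "galois_ext \<iota> L" and w: "inv_rel L w"
  shows "w \<in> powers (p - 1)"
proof -
  obtain \<nu> where M: "tot_ram v p \<iota> \<nu> L" by (rule ramified_extE[OF L])
  interpret M: tot_ram v p \<iota> \<nu> L by (rule M)
  obtain \<pi> a where a: "eis_data L \<pi> a" "same_lead v w (lead_coef a)" and wT: "w \<in> Tx"
    using w by (auto simp: inv_rel_def)
  note \<pi> = eis_data_prime[OF M a(1)]
  have "\<pi> \<notin> range \<iota>"
  proof
    assume "\<pi> \<in> range \<iota>"
    then obtain x where x: "\<pi> = \<iota> x" by auto
    then have "x \<noteq> 0" using \<pi> by auto
    then have "real p * v x + real 0 = real p * 0 + real 1" using \<pi>(3) x M.val_iota by simp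
    then show False
      using M.mod_p_unique[of "v x" 0 0 1] val_in_Ints[OF \<open>x \<noteq> 0\<close>] p_gt_1 by simp
  qed
  then obtain \<sigma> where \<sigma>: "K_embedding \<iota> L \<sigma>" "\<sigma> ` L = L" "\<sigma> \<pi> \<noteq> \<pi>"
    using gal \<pi>(1) unfolding galois_ext_def by blast
  note eis = M.K_embedding_eisenstein[OF \<sigma>(1) \<pi>(1,4)]
  note lead = conjugate_lead[OF M a(1) wT a(2) eis \<sigma>(3)]
  define y where "y = \<sigma> \<pi> - \<pi>"
  have "real m / (real p - 1) = real b" using mb p_gt_1 by (simp add: of_nat_diff)
  then have y: "y \<noteq> 0" "\<nu> y = real (b + 1)" "y \<in> L"
    using lead(2) \<sigma> \<pi>(1) subfield_diff[OF M.subfield] by (auto simp: y_def)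
  have "y / \<pi> ^ (b + 1) \<in> L" "y / \<pi> ^ (b + 1) \<noteq> 0" "\<nu> (y / \<pi> ^ (b + 1)) = 0"
    using y \<pi> by (auto simp: M.val_divide M.val_power simp del: power_Suc
        intro!: subfield_divide[OF M.subfield] subfield_power[OF M.subfield])
  then obtain c where c: "c \<in> Tx" "same_lead \<nu> (y / \<pi> ^ (b + 1)) (\<iota> c)" by (rule M.same_lead_residue)
  have "m + p - 1 = (b + 1) * (p - 1)" using mb p_pos by (cases p) (simp_all add: algebra_simps)
  then have pw: "\<pi> ^ (m + p - 1) = (\<pi> ^ (b + 1)) ^ (p - 1)" by (metis power_mult)
  have "same_lead \<nu> (y ^ (p - 1) / (\<pi> ^ (b + 1)) ^ (p - 1)) (\<iota> w * \<pi> ^ (m + p - 1) / (\<pi> ^ (b + 1)) ^ (p - 1))"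
    using lead(1) \<pi> unfolding y_def by (intro M.same_lead_divide M.same_lead_refl) auto
  then have "same_lead \<nu> ((y / \<pi> ^ (b + 1)) ^ (p - 1)) (\<iota> w)"
    using \<pi>(2) unfolding pw by (simp add: power_divide)
  then have "same_lead \<nu> (\<iota> (c ^ (p - 1))) (\<iota> w)"
    unfolding iota_power
    by (rule M.same_lead_trans[OF M.same_lead_sym[OF M.same_lead_power[OF c(2)]]])
  then have "c ^ (p - 1) = w" using c wT by (intro M.Tx_same_lead Tx_power)
  then show ?thesis using c(1) by (auto simp: powers_def)
qed

end

section \<open>Extension of the valuation\<close>

definition is_subring :: "'a::field set \<Rightarrow> bool" where
  "is_subring R \<longleftrightarrow> 1 \<in> R \<and> (\<forall>x\<in>R. \<forall>y\<in>R. x + y \<in> R \<and> x * y \<in> R) \<and> (\<forall>x\<in>R. - x \<in> R)"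

lemma subringD:
  assumes "is_subring R"
  shows subring_1: "1 \<in> R"
    and subring_add: "x \<in> R \<Longrightarrow> y \<in> R \<Longrightarrow> x + y \<in> R"
    and subring_mult: "x \<in> R \<Longrightarrow> y \<in> R \<Longrightarrow> x * y \<in> R"
    and subring_minus: "x \<in> R \<Longrightarrow> - x \<in> R"
  using assms by (auto simp: is_subring_def)

lemma subring_0: "is_subring R \<Longrightarrow> 0 \<in> R"
  using subring_add[of R 1 "- 1"] subring_1[of R] subring_minus[of R 1] by simp

lemma subring_diff: "is_subring R \<Longrightarrow> x \<in> R \<Longrightarrow> y \<in> R \<Longrightarrow> x - y \<in> R"
  using subring_add[of R x "- y"] subring_minus[of R y] by simp

lemma subring_power: "is_subring R \<Longrightarrow> x \<in> R \<Longrightarrow> x ^ n \<in> R"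
  by (induction n) (auto intro: subring_1 subring_mult)

lemma subring_sum: "is_subring R \<Longrightarrow> (\<And>i. i \<in> A \<Longrightarrow> f i \<in> R) \<Longrightarrow> sum f A \<in> R"
  by (induction A rule: infinite_finite_induct) (auto intro: subring_0 subring_add)

text \<open>
  A subring maximal among those that do not contain \<open>inverse u\<close> is a valuation ring.
\<close>

locale maximal_subring =
  fixes R :: "'a::field set" and u :: 'a
  assumes subring: "is_subring R" and u: "u \<in> R" "u \<noteq> 0" "inverse u \<notin> R"
    and maximal: "\<And>R'. is_subring R' \<Longrightarrow> R \<subseteq> R' \<Longrightarrow> inverse u \<notin> R' \<Longrightarrow> R' = R"
begin

lemma no_inverse: "r \<in> R \<Longrightarrow> u * r \<noteq> 1"
  using u inverse_unique by metis

text \<open>If s = 1 - u r were not invertible in R, the larger ring R[1/s] would contain 1/u by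
  maximality. Then some power of s is a multiple of u in R; but it is also congruent to 1 modulo u
  R, so u would be invertible in R.\<close>

lemma jacobson: assumes "r \<in> R" shows "inverse (1 - u * r) \<in> R"
proof (rule ccontr)
  define s where "s = 1 - u * r"
  assume "inverse (1 - u * r) \<notin> R"
  then have s: "inverse s \<notin> R" by (simp add: s_def)
  have sR: "s \<in> R" using assms u subring unfolding s_def by (auto intro: subring_diff subring_1 subring_mult)
  have s0: "s \<noteq> 0" using no_inverse[OF assms] by (auto simp: s_def)
  define R' where "R' = {a / s ^ k | a k. a \<in> R}"
  have "is_subring R'" unfolding is_subring_def
  proof (intro conjI ballI)
    show "1 \<in> R'" unfolding R'_def using subring_1[OF subring] by (auto intro!: exI[of _ 1] exI[of _ "0::nat"])
    fix x assume "x \<in> R'"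
    then obtain a k where x: "x = a / s ^ k" "a \<in> R" by (auto simp: R'_def)
    show "- x \<in> R'" unfolding R'_def using x subring_minus[OF subring]
      by (intro CollectI exI[of _ "- a"] exI[of _ k]) auto
    fix y assume "y \<in> R'"
    then obtain b l where y: "y = b / s ^ l" "b \<in> R" by (auto simp: R'_def)
    have "x + y = (a * s ^ l + b * s ^ k) / s ^ (k + l)" using s0 by (simp add: x y field_simps power_add)
    moreover have "a * s ^ l + b * s ^ k \<in> R"
      using x y sR subring by (intro subring_add subring_mult subring_power)
    ultimately show "x + y \<in> R'" unfolding R'_def by blast
    have "x * y = (a * b) / s ^ (k + l)" by (simp add: x y power_add)
    then show "x * y \<in> R'" unfolding R'_def using x y subring_mult[OF subring] by blast
  qed
  moreover have "R \<subseteq> R'"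
  proof
    fix x assume "x \<in> R"
    then show "x \<in> R'" unfolding R'_def by (intro CollectI exI[of _ x] exI[of _ 0]) simp
  qed
  moreover have "inverse s \<in> R'" unfolding R'_def
    using subring_1[OF subring] by (intro CollectI exI[of _ 1] exI[of _ 1]) (simp add: inverse_eq_divide)
  ultimately have "inverse u \<in> R'" using maximal[of R'] s by blast
  then obtain a k where a: "inverse u = a / s ^ k" "a \<in> R" by (auto simp: R'_def)
  have "\<exists>r'\<in>R. s ^ k = 1 - u * r'" for k
  proof (induction k)
    case 0
    show ?case using subring_0[OF subring] by (intro bexI[of _ 0]) auto
  next
    case (Suc k)
    then obtain r' where r': "r' \<in> R" "s ^ k = 1 - u * r'" by blast
    have "s ^ Suc k = s - u * (s * r')" by (simp add: r'(2) algebra_simps)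
    also have "\<dots> = 1 - u * (r + s * r')" by (subst s_def) (simp add: algebra_simps)
    finally have "s ^ Suc k = 1 - u * (r + s * r')" .
    then show ?case using r' assms sR subring by (intro bexI[of _ "r + s * r'"]) (auto intro: subring_add subring_mult)
  qed
  then obtain r' where r': "r' \<in> R" "s ^ k = 1 - u * r'" by blast
  have "s ^ k = u * a" using a(1) u(2) s0 by (simp add: field_simps)
  then have "u * (a + r') = 1" using r' by (simp add: algebra_simps)
  then show False using no_inverse a r' subring_add[OF subring] by blast
qed

text \<open>The inverse of u is a polynomial in z of degree at most n over R.\<close>

definition dep :: "'a \<Rightarrow> nat \<Rightarrow> bool" where
  "dep z n \<longleftrightarrow> (\<exists>a. (\<forall>i. a i \<in> R) \<and> 1 = u * (\<Sum>i\<le>n. a i * z ^ i))"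

lemma dep_mono: assumes "dep z n" "n \<le> n'" shows "dep z n'"
proof -
  obtain a where a: "\<forall>i. a i \<in> R" "1 = u * (\<Sum>i\<le>n. a i * z ^ i)" using assms by (auto simp: dep_def)
  have "(\<Sum>i\<le>n'. (if i \<le> n then a i else 0) * z ^ i) = (\<Sum>i\<in>{..n}. (if i \<le> n then a i else 0) * z ^ i)"
    using assms by (intro sum.mono_neutral_right) auto
  also have "\<dots> = (\<Sum>i\<le>n. a i * z ^ i)" by (intro sum.cong) auto
  finally show ?thesis
    unfolding dep_def using a subring_0[OF subring] by (intro exI[of _ "\<lambda>i. if i \<le> n then a i else 0"]) auto
qed

lemma not_dep_0: "\<not> dep z 0"
  using no_inverse by (auto simp: dep_def)

text \<open>The relation for 1/x, multiplied by x^(n + 1), expresses x^(n + 1) through lower powers,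
  since 1 - u b_0 is invertible in R. Substituting this in the relation for x lowers its
  degree.\<close>

lemma dep_reduce:
  assumes "dep x (Suc n)" "dep (inverse x) (Suc n)" "x \<noteq> 0"
  shows "dep x n"
proof -
  obtain a where a: "\<And>i. a i \<in> R" "1 = u * (\<Sum>i\<le>Suc n. a i * x ^ i)" using assms(1) by (auto simp: dep_def)
  obtain b where b: "\<And>i. b i \<in> R" "1 = u * (\<Sum>i\<le>Suc n. b i * inverse x ^ i)" using assms(2) by (auto simp: dep_def)
  define e where "e = inverse (1 - u * b 0)"
  have e: "e \<in> R" "1 - u * b 0 \<noteq> 0" using jacobson[OF b(1)] no_inverse[OF b(1)[of 0]] by (auto simp: e_def)
  have "x ^ Suc n = u * (\<Sum>i\<le>Suc n. b i * inverse x ^ i) * x ^ Suc n" using b(2) by simp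
  also have "\<dots> = u * (\<Sum>i\<le>Suc n. b i * (inverse x ^ i * x ^ Suc n))"
    by (simp only: sum_distrib_left sum_distrib_right mult.assoc)
  also have "(\<Sum>i\<le>Suc n. b i * (inverse x ^ i * x ^ Suc n)) = (\<Sum>i\<le>Suc n. b i * x ^ (Suc n - i))"
  proof (intro sum.cong refl)
    fix i assume "i \<in> {..Suc n}"
    then have "x ^ Suc n = x ^ i * x ^ (Suc n - i)" by (simp flip: power_add)
    then show "b i * (inverse x ^ i * x ^ Suc n) = b i * x ^ (Suc n - i)"
      using assms(3) by (simp add: power_inverse)
  qed
  also have "\<dots> = (\<Sum>i\<le>Suc n. b (Suc n - i) * x ^ i)"
    by (rule sum.reindex_bij_witness[of _ "\<lambda>i. Suc n - i" "\<lambda>i. Suc n - i"]) auto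
  also have "\<dots> = (\<Sum>i\<le>n. b (Suc n - i) * x ^ i) + b 0 * x ^ Suc n" by simp
  finally have eq: "x ^ Suc n = u * ((\<Sum>i\<le>n. b (Suc n - i) * x ^ i) + b 0 * x ^ Suc n)" .
  have "(1 - u * c) * X = u * S" if "X = u * (S + c * X)" for X S c :: 'a
    using that by algebra
  from this[OF eq] have eq': "(1 - u * b 0) * x ^ Suc n = u * (\<Sum>i\<le>n. b (Suc n - i) * x ^ i)" .
  have "x ^ Suc n = e * ((1 - u * b 0) * x ^ Suc n)" using e(2) by (simp add: e_def)
  then have xn: "x ^ Suc n = e * u * (\<Sum>i\<le>n. b (Suc n - i) * x ^ i)"
    unfolding eq' by (simp only: mult.assoc)
  have "1 = u * ((\<Sum>i\<le>n. a i * x ^ i) + a (Suc n) * x ^ Suc n)" using a(2) by simp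
  also have "\<dots> = u * (\<Sum>i\<le>n. (a i + a (Suc n) * (e * u * b (Suc n - i))) * x ^ i)"
    unfolding xn by (simp add: sum.distrib sum_distrib_left algebra_simps)
  finally show ?thesis
    unfolding dep_def using a(1) b(1) e(1) u(1) subring
    by (intro exI[of _ "\<lambda>i. a i + a (Suc n) * (e * u * b (Suc n - i))"])
      (auto intro!: subring_add[OF subring] subring_mult[OF subring])
qed

text \<open>By maximality the strictly larger ring R[x] contains the inverse of u.\<close>

lemma dep_if_not_mem: assumes "x \<notin> R" shows "\<exists>n. dep x n"
proof -
  define R' where "R' = {poly P x | P. \<forall>i. coeff P i \<in> R}"
  have "is_subring R'" unfolding is_subring_def
  proof (intro conjI ballI)
    show "1 \<in> R'" unfolding R'_def
      using subring_1[OF subring] subring_0[OF subring] by (intro CollectI exI[of _ 1]) (auto simp: coeff_1)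
    fix y assume "y \<in> R'"
    then obtain P where P: "y = poly P x" "\<forall>i. coeff P i \<in> R" by (auto simp: R'_def)
    show "- y \<in> R'" unfolding R'_def using P subring_minus[OF subring]
      by (intro CollectI exI[of _ "- P"]) auto
    fix z assume "z \<in> R'"
    then obtain Q where Q: "z = poly Q x" "\<forall>i. coeff Q i \<in> R" by (auto simp: R'_def)
    show "y + z \<in> R'" unfolding R'_def using P Q subring_add[OF subring]
      by (intro CollectI exI[of _ "P + Q"]) auto
    show "y * z \<in> R'" unfolding R'_def using P Q subring
      by (intro CollectI exI[of _ "P * Q"]) (auto simp: coeff_mult intro!: subring_sum subring_mult)
  qed
  moreover have "R \<subseteq> R'"
  proof
    fix y assume "y \<in> R"
    then show "y \<in> R'" unfolding R'_def using subring_0[OF subring]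
      by (intro CollectI exI[of _ "[:y:]"]) (auto simp: coeff_pCons split: nat.split)
  qed
  moreover have "x \<in> R'" unfolding R'_def using subring_0[OF subring] subring_1[OF subring]
    by (intro CollectI exI[of _ "[:0, 1:]"]) (auto simp: coeff_pCons split: nat.split)
  ultimately have "inverse u \<in> R'" using maximal[of R'] assms by blast
  then obtain P where P: "inverse u = poly P x" "\<forall>i. coeff P i \<in> R" by (auto simp: R'_def)
  then have "1 = u * (\<Sum>i\<le>degree P. coeff P i * x ^ i)"
    using u(2) unfolding poly_altdef[symmetric] P(1)[symmetric] by simp
  then show ?thesis using P(2) unfolding dep_def by blast
qed

text \<open>Otherwise take relations of least degree for x and for 1/x. The one of smaller degree,
  padded with zeros, serves to reduce the other, against minimality.\<close>

lemma valuation_ring: assumes "x \<noteq> 0" shows "x \<in> R \<or> inverse x \<in> R"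
proof (rule ccontr)
  assume "\<not> (x \<in> R \<or> inverse x \<in> R)"
  then have ex: "\<exists>n. dep x n" "\<exists>n. dep (inverse x) n" using dep_if_not_mem by auto
  define n where "n = (LEAST n. dep x n)"
  define k where "k = (LEAST n. dep (inverse x) n)"
  have n: "dep x n" "\<And>i. i < n \<Longrightarrow> \<not> dep x i" using LeastI_ex[OF ex(1)] not_less_Least by (auto simp: n_def)
  have k: "dep (inverse x) k" "\<And>i. i < k \<Longrightarrow> \<not> dep (inverse x) i"
    using LeastI_ex[OF ex(2)] not_less_Least by (auto simp: k_def)
  obtain n' k' where nk: "n = Suc n'" "k = Suc k'" using n(1) k(1) not_dep_0 by (metis not0_implies_Suc)
  show False
  proof (cases "k \<le> n")
    case True
    then have "dep x n'" using dep_reduce[of x n'] n(1) dep_mono[OF k(1)] nk assms by simp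
    then show False using n(2) nk by simp
  next
    case False
    then have "dep (inverse x) k'"
      using dep_reduce[of "inverse x" k'] k(1) dep_mono[OF n(1)] nk assms by simp
    then show False using k(2) nk by simp
  qed
qed

text \<open>Equality in the value group of R, the nonzero elements modulo units of R.\<close>

definition equi :: "'a \<Rightarrow> 'a \<Rightarrow> bool" where
  "equi x y \<longleftrightarrow> x \<noteq> 0 \<and> y \<noteq> 0 \<and> x / y \<in> R \<and> y / x \<in> R"

lemma equi_sym: "equi x y \<Longrightarrow> equi y x"
  by (auto simp: equi_def)

lemma equi_mult: "equi x y \<Longrightarrow> equi z w \<Longrightarrow> equi (x * z) (y * w)"
  using subring_mult[OF subring, of "x / y" "z / w"] subring_mult[OF subring, of "y / x" "w / z"]
  by (auto simp: equi_def)

lemma equi_power: "equi x y \<Longrightarrow> equi (x ^ n) (y ^ n)"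
  by (induction n) (auto intro: equi_mult simp: equi_def[of 1] subring_1[OF subring])

lemma equi_refl: "x \<noteq> 0 \<Longrightarrow> equi x x"
  by (simp add: equi_def subring_1[OF subring])

lemma equi_trans: "equi x y \<Longrightarrow> equi y z \<Longrightarrow> equi x z"
  using subring_mult[OF subring, of "x / y" "y / z"] subring_mult[OF subring, of "z / y" "y / x"]
  by (auto simp: equi_def)

lemma nonunit_sum:
  assumes "finite A" "\<And>i. i \<in> A \<Longrightarrow> f i \<in> R \<and> \<not> equi (f i) 1"
  shows "sum f A \<in> R \<and> \<not> equi (sum f A) 1"
  using assms
proof (induction A rule: finite_induct)
  case empty
  then show ?case by (simp add: equi_def subring_0[OF subring])
next
  case (insert i A)
  define x where "x = f i"
  define y where "y = sum f A"
  have xy: "x \<in> R" "\<not> equi x 1" "y \<in> R" "\<not> equi y 1" using insert by (auto simp: x_def y_def)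
  have "\<not> equi (x + y) 1"
  proof
    assume s: "equi (x + y) 1"
    have *: False if "a \<in> R" "\<not> equi a 1" "b / a \<in> R" "equi (a + b) 1" "a \<noteq> 0" for a b
    proof -
      have "1 + b / a \<in> R" using that by (intro subring_add[OF subring] subring_1[OF subring])
      moreover have "inverse (a + b) \<in> R" using that(4) by (simp add: equi_def inverse_eq_divide)
      ultimately have "(1 + b / a) * inverse (a + b) \<in> R" by (rule subring_mult[OF subring])
      moreover have "(1 + b / a) * inverse (a + b) = 1 / a"
      proof -
        have "1 + b / a = (a + b) / a" using that(5) by (simp add: field_simps)
        then show ?thesis using that(4) by (simp add: equi_def)
      qed
      ultimately show False using that by (simp add: equi_def)
    qed
    show False
    proof (cases "x = 0 \<or> y = 0")
      case True
      then show False using s xy by auto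
    next
      case False
      then have "y / x \<in> R \<or> x / y \<in> R" using valuation_ring[of "y / x"] by auto
      then show False using *[of x y] *[of y x] xy s False by (auto simp: add.commute)
    qed
  qed
  then show ?case using insert xy by (auto simp: x_def y_def intro: subring_add[OF subring])
qed

text \<open>In a vanishing sum the least value is attained twice: after division by a term of least
  value, the other quotients lie in R and add up to - 1. As sums of nonunits are nonunits, one of
  them is a unit.\<close>

lemma equi_terms:
  assumes "finite A" "sum f A = 0" "i0 \<in> A" "f i0 \<noteq> 0"
  shows "\<exists>i\<in>A. \<exists>j\<in>A. i \<noteq> j \<and> equi (f i) (f j)"
proof -
  define B where "B = {i \<in> A. f i \<noteq> 0}"
  have B: "finite B" "B \<noteq> {}" using assms by (auto simp: B_def)
  have "\<exists>i\<in>B. \<forall>j\<in>B. f j / f i \<in> R"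
    using B
  proof (induction B rule: finite_ne_induct)
    case (singleton i)
    then show ?case using subring_1[OF subring] subring_0[OF subring] by (cases "f i = 0") auto
  next
    case (insert k B)
    then obtain i where i: "i \<in> B" "\<forall>j\<in>B. f j / f i \<in> R" by blast
    show ?case
    proof (cases "f k / f i \<in> R")
      case True
      then show ?thesis using i by (intro bexI[of _ i]) auto
    next
      case False
      then have nz: "f k \<noteq> 0" "f i \<noteq> 0" using subring_0[OF subring] by auto
      then have ik: "f i / f k \<in> R" using valuation_ring[of "f k / f i"] False by auto
      have "f j / f k \<in> R" if "j \<in> B" for j
        using subring_mult[OF subring bspec[OF i(2) that] ik] nz by simp
      then show ?thesis using nz subring_1[OF subring] by (intro bexI[of _ k]) auto
    qed
  qed
  then obtain i where i: "i \<in> B" "\<forall>j\<in>B. f j / f i \<in> R" by blast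
  have fi: "f i \<noteq> 0" "i \<in> A" using i by (auto simp: B_def)
  have Aj: "f j / f i \<in> R" if "j \<in> A" for j
    using i that subring_0[OF subring] by (cases "f j = 0") (auto simp: B_def)
  have "\<exists>j\<in>A - {i}. equi (f j / f i) 1"
  proof (rule ccontr)
    assume "\<not> ?thesis"
    then have "\<not> equi (\<Sum>j\<in>A - {i}. f j / f i) 1"
      using nonunit_sum[of "A - {i}" "\<lambda>j. f j / f i"] Aj assms(1) by blast
    moreover have "(\<Sum>j\<in>A - {i}. f j / f i) = - 1"
    proof -
      have "f i + sum f (A - {i}) = 0" using assms(1,2) fi by (simp flip: sum.remove)
      then have "sum f (A - {i}) = - f i" by (simp add: eq_neg_iff_add_eq_0 add.commute)
      then show ?thesis using fi by (simp flip: sum_divide_distrib)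
    qed
    ultimately show False using subring_1[OF subring] subring_minus[OF subring] by (simp add: equi_def)
  qed
  then obtain j where j: "j \<in> A" "j \<noteq> i" "equi (f j / f i) 1" by blast
  then have "equi (f j / f i * f i) (1 * f i)" using fi by (intro equi_mult equi_refl)
  then have "equi (f j) (f i)" using fi by simp
  then show ?thesis using j fi by blast
qed

end

context char_p_extension
begin

lemma algebraic: "\<exists>f. f \<noteq> 0 \<and> poly (map_poly \<iota> f) x = 0"
  using sep_closure unfolding separable_closure_def by (metis irreducible_def)

lemma poly_map_altdef: "poly (map_poly \<iota> f) x = (\<Sum>i\<le>degree f. \<iota> (coeff f i) * x ^ i)"
proof -
  have "degree (map_poly \<iota> f) = degree f" by (rule degree_map_poly) simp
  then show ?thesis by (simp add: poly_altdef coeff_map_poly)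
qed

lemma maximal_subring_exists:
  assumes t: "t \<noteq> 0" "v t = 1"
  obtains R where "maximal_subring R (\<iota> t)" "\<And>x. vge v 0 x \<Longrightarrow> \<iota> x \<in> R"
proof -
  define O0 where "O0 = \<iota> ` {x. vge v 0 x}"
  define A where "A = {R. is_subring R \<and> O0 \<subseteq> R \<and> inverse (\<iota> t) \<notin> R}"
  have "is_subring O0"
    unfolding is_subring_def O0_def
    using vge_add[of 0] vge_mult_0 by (auto simp flip: iota_add iota_mult iota_minus intro!: image_eqI[of 1 _ 1] imageI simp: vge_def[of v 0 1])
  moreover have "inverse (\<iota> t) \<notin> O0"
  proof
    assume "inverse (\<iota> t) \<in> O0"
    then obtain x where "vge v 0 x" "inverse (\<iota> t) = \<iota> x" by (auto simp: O0_def)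
    then show False using t val_inverse[OF t(1)] by (auto simp: vge_def simp flip: iota_inverse)
  qed
  ultimately have "O0 \<in> A" by (simp add: A_def)
  have "\<exists>M\<in>A. \<forall>X\<in>A. M \<subseteq> X \<longrightarrow> X = M"
  proof (rule subset_Zorn_nonempty)
    show "A \<noteq> {}" using \<open>O0 \<in> A\<close> by auto
    fix C assume C: "C \<noteq> {}" "subset.chain A C"
    then have CA: "\<And>R. R \<in> C \<Longrightarrow> R \<in> A" and tot: "\<And>R S. R \<in> C \<Longrightarrow> S \<in> C \<Longrightarrow> R \<subseteq> S \<or> S \<subseteq> R"
      by (auto simp: subset.chain_def subset_chain_def)
    have "is_subring (\<Union>C)"
      unfolding is_subring_def
    proof (intro conjI ballI)
      show "1 \<in> \<Union>C" using C(1) CA subring_1 by (fastforce simp: A_def)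
      fix x assume "x \<in> \<Union>C"
      then obtain R where R: "R \<in> C" "x \<in> R" by blast
      have sR: "is_subring R" using CA[OF R(1)] by (simp add: A_def)
      show "- x \<in> \<Union>C" using R subring_minus[OF sR] by blast
      fix y assume "y \<in> \<Union>C"
      then obtain S where S: "S \<in> C" "y \<in> S" by blast
      have sS: "is_subring S" using CA[OF S(1)] by (simp add: A_def)
      obtain Q where Q: "Q \<in> C" "x \<in> Q" "y \<in> Q" using tot[OF R(1) S(1)] R S by blast
      have "is_subring Q" using CA[OF Q(1)] by (simp add: A_def)
      then show "x + y \<in> \<Union>C" "x * y \<in> \<Union>C" using Q subring_add subring_mult by blast+
    qed
    moreover have "O0 \<subseteq> \<Union>C" "inverse (\<iota> t) \<notin> \<Union>C" using C(1) CA by (auto simp: A_def)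
    ultimately show "\<Union>C \<in> A" by (simp add: A_def)
  qed
  then obtain R where R: "R \<in> A" "\<And>X. X \<in> A \<Longrightarrow> R \<subseteq> X \<Longrightarrow> X = R" by blast
  show ?thesis
  proof (rule that)
    show in_R: "\<iota> x \<in> R" if "vge v 0 x" for x using R(1) that by (auto simp: A_def O0_def)
    show "maximal_subring R (\<iota> t)"
      using R in_R[of t] t by unfold_locales (auto simp: A_def vge_def)
  qed
qed

text \<open>A nonzero z is algebraic over K, so two terms of its equation are equivalent by
  \<open>equi_terms\<close>. Hence some power z^n with n > 0 is equivalent to an element c of K, and
  the value of z has to be v(c)/n, times the scale p. That R meets K in the valuation ring makes
  this independent of n and c.\<close>

lemma extension_of_valuation:
  obtains \<nu> where "scaled_extension v p \<iota> \<nu>"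
proof -
  obtain t where t: "t \<noteq> 0" "v t = 1" using uniformizer_exists by blast
  obtain R where "maximal_subring R (\<iota> t)" and R: "\<And>x. vge v 0 x \<Longrightarrow> \<iota> x \<in> R"
    using maximal_subring_exists[OF t] by blast
  then interpret R: maximal_subring R "\<iota> t" by simp
  have R': "vge v 0 x" if "\<iota> x \<in> R" for x
  proof (rule ccontr)
    assume "\<not> vge v 0 x"
    then have x: "x \<noteq> 0" "v x < 0" by (auto simp: vge_def)
    obtain k where "v x = of_int k" using val_in_Ints[OF x(1)] by (auto elim: Ints_cases)
    then have "v x \<le> - 1" using x by simp
    \<comment> \<open>Values on K are integers, so 1/x is divisible by t in the valuation ring;
      multiplying by x would put 1/t into R.\<close>
    then have "vge v 0 (inverse t * inverse x)" using x t by (simp add: vge_def val_mult val_inverse)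
    then have "\<iota> x * \<iota> (inverse t * inverse x) \<in> R" using that R by (intro subring_mult[OF R.subring])
    moreover have "\<iota> x * \<iota> (inverse t * inverse x) = inverse (\<iota> t)"
      using x by (simp add: iota_mult iota_inverse)
    ultimately show False using R.u by simp
  qed
  have equi_iota: "v x = v y" if "R.equi (\<iota> x) (\<iota> y)" for x y
  proof -
    have nz: "x \<noteq> 0" "y \<noteq> 0" using that by (auto simp: R.equi_def)
    have "vge v 0 (x / y)" "vge v 0 (y / x)"
      using that R' by (auto simp: R.equi_def simp flip: iota_divide)
    then show ?thesis using nz by (simp add: vge_def val_divide)
  qed
  define rel where "rel z r \<longleftrightarrow> (\<exists>n c. n > 0 \<and> c \<noteq> 0 \<and> R.equi (z ^ n) (\<iota> c) \<and> r = real p * v c / real n)" for z r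
  have ex: "\<exists>r. rel z r" if z: "z \<noteq> 0" for z
  proof -
    obtain f where f: "f \<noteq> 0" "poly (map_poly \<iota> f) z = 0" using algebraic by blast
    have "(\<Sum>i\<le>degree f. \<iota> (coeff f i) * z ^ i) = 0" using f(2) by (simp add: poly_map_altdef)
    moreover have "\<iota> (coeff f (degree f)) * z ^ degree f \<noteq> 0" using f(1) z by simp
    ultimately obtain i j where ij: "i \<noteq> j" "R.equi (\<iota> (coeff f i) * z ^ i) (\<iota> (coeff f j) * z ^ j)"
      using R.equi_terms[of "{..degree f}" "\<lambda>i. \<iota> (coeff f i) * z ^ i" "degree f"] by auto
    have main: "\<exists>r. rel z r" if ij: "i < j" "R.equi (a * z ^ i) (b * z ^ j)" "a = \<iota> a'" "b = \<iota> b'" for i j a b a' b'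
    proof -
      have nz: "a \<noteq> 0" "b \<noteq> 0" using ij(2) by (auto simp: R.equi_def)
      have "R.equi (b * z ^ j * (inverse b * inverse (z ^ i))) (a * z ^ i * (inverse b * inverse (z ^ i)))"
        using nz z by (intro R.equi_mult[OF R.equi_sym[OF ij(2)]] R.equi_refl) auto
      moreover have "b * z ^ j * (inverse b * inverse (z ^ i)) = z ^ (j - i)"
        using nz z ij(1) by (simp add: power_diff field_simps)
      moreover have "a * z ^ i * (inverse b * inverse (z ^ i)) = \<iota> (a' / b')"
        using nz z ij by (simp add: iota_divide field_simps)
      ultimately have "R.equi (z ^ (j - i)) (\<iota> (a' / b'))" by simp
      moreover have "a' / b' \<noteq> 0" using nz ij by auto
      ultimately show ?thesis using ij(1) unfolding rel_def by (metis zero_less_diff)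
    qed
    then show ?thesis using ij R.equi_sym by (metis nat_neq_iff)
  qed
  have uniq: "r = r'" if rel: "rel z r" "rel z r'" for z r r'
  proof -
    obtain n c where c: "n > 0" "c \<noteq> 0" "R.equi (z ^ n) (\<iota> c)" "r = real p * v c / real n" using rel(1) by (auto simp: rel_def)
    obtain k d where d: "k > 0" "d \<noteq> 0" "R.equi (z ^ k) (\<iota> d)" "r' = real p * v d / real k" using rel(2) by (auto simp: rel_def)
    have "R.equi (z ^ (n * k)) (\<iota> (c ^ k))" "R.equi (z ^ (n * k)) (\<iota> (d ^ n))"
      using R.equi_power[OF c(3), of k] R.equi_power[OF d(3), of n]
      by (simp_all add: iota_power mult.commute flip: power_mult)
    then have "R.equi (\<iota> (c ^ k)) (\<iota> (d ^ n))" using R.equi_sym R.equi_trans by blast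
    then have "real k * v c = real n * v d" using equi_iota[of "c ^ k" "d ^ n"] c d by (simp add: val_power)
    then have "real p * v c * real k = real p * v d * real n" by (simp add: mult_ac)
    then show ?thesis using c(1) d(1) unfolding c(4) d(4) by (subst frac_eq_eq) auto
  qed
  define w where "w z = (SOME r. rel z r)" for z
  have w: "rel z (w z)" if "z \<noteq> 0" for z unfolding w_def by (rule someI_ex[OF ex[OF that]])
  have w_eq: "w z = r" if "rel z r" for z r using uniq[OF w that] that by (force simp: rel_def R.equi_def)
  have w_mult: "w (x * y) = w x + w y" if xy: "x \<noteq> 0" "y \<noteq> 0" for x y
  proof (rule w_eq)
    obtain n c where c: "n > 0" "c \<noteq> 0" "R.equi (x ^ n) (\<iota> c)" "w x = real p * v c / real n" using w[OF xy(1)] by (auto simp: rel_def)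
    obtain k d where d: "k > 0" "d \<noteq> 0" "R.equi (y ^ k) (\<iota> d)" "w y = real p * v d / real k" using w[OF xy(2)] by (auto simp: rel_def)
    have "R.equi ((x ^ n) ^ k * (y ^ k) ^ n) (\<iota> c ^ k * \<iota> d ^ n)"
      using c d by (intro R.equi_mult R.equi_power)
    then have "R.equi ((x * y) ^ (n * k)) (\<iota> (c ^ k * d ^ n))"
      by (simp add: iota_mult iota_power power_mult_distrib mult.commute flip: power_mult)
    moreover have "w x + w y = real p * v (c ^ k * d ^ n) / real (n * k)"
      using c d by (simp add: val_mult val_power field_simps)
    ultimately show "rel (x * y) (w x + w y)"
      unfolding rel_def using c d by (intro exI[of _ "n * k"] exI[of _ "c ^ k * d ^ n"]) auto
  qed
  have w_nonneg: "w z \<ge> 0" if z: "z \<in> R" "z \<noteq> 0" for z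
  proof -
    obtain n c where c: "n > 0" "c \<noteq> 0" "R.equi (z ^ n) (\<iota> c)" "w z = real p * v c / real n" using w[OF z(2)] by (auto simp: rel_def)
    have "\<iota> c / z ^ n * z ^ n \<in> R"
      using c(3) z by (intro subring_mult[OF R.subring] subring_power[OF R.subring]) (auto simp: R.equi_def)
    then have "\<iota> c \<in> R" using z by simp
    then have "v c \<ge> 0" using R'[of c] c(2) by (simp add: vge_def)
    then show ?thesis using c by simp
  qed
  have w_add: "min (w x) (w y) \<le> w (x + y)" if xy: "x \<noteq> 0" "y \<noteq> 0" "x + y \<noteq> 0" for x y
  proof -
    have *: "w b \<le> w (a + b)" if "a / b \<in> R" "b \<noteq> 0" "a + b \<noteq> 0" for a b
    proof -
      have eq: "a + b = (1 + a / b) * b" using that by (simp add: field_simps)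
      then have nz: "1 + a / b \<noteq> 0" using that by auto
      have "1 + a / b \<in> R" using that by (intro subring_add[OF R.subring] subring_1[OF R.subring])
      then have "w (1 + a / b) \<ge> 0" using nz by (rule w_nonneg)
      then show ?thesis using w_mult[OF nz that(2)] eq by simp
    qed
    have "x / y \<in> R \<or> y / x \<in> R" using R.valuation_ring[of "x / y"] xy by auto
    then show ?thesis using *[of x y] *[of y x] xy by (auto simp: add.commute)
  qed
  have "w (\<iota> x) = real p * v x" if "x \<noteq> 0" for x
    using that R.equi_refl[of "\<iota> x"] by (intro w_eq) (auto simp: rel_def intro!: exI[of _ 1] exI[of _ x])
  then have "scaled_extension v p \<iota> w"
    using w_mult w_add by unfold_locales (auto simp: is_valuation_def)
  then show ?thesis by (rule that)
qed

end

section \<open>Counting the classes\<close>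

lemma quotient_kernel_bij:
  assumes "r = {(x, y). x \<in> A \<and> y \<in> A \<and> f x = f y}"
  shows "bij_betw (\<lambda>C. f (SOME x. x \<in> C)) (A // r) (f ` A)"
proof -
  have r: "r `` {x} = {y \<in> A. f x = f y}" if "x \<in> A" for x using that by (auto simp: assms)
  have some: "(SOME y. y \<in> r `` {x}) \<in> A \<and> f (SOME y. y \<in> r `` {x}) = f x" if "x \<in> A" for x
  proof -
    have "x \<in> r `` {x}" using that by (simp add: r)
    then have "(SOME y. y \<in> r `` {x}) \<in> r `` {x}" by (rule someI)
    then show ?thesis by (simp add: r[OF that])
  qed
  show ?thesis unfolding bij_betw_def
  proof
    show "inj_on (\<lambda>C. f (SOME x. x \<in> C)) (A // r)"
    proof (rule inj_onI)
      fix C D assume "C \<in> A // r" "D \<in> A // r" and eq: "f (SOME x. x \<in> C) = f (SOME x. x \<in> D)"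
      then obtain x y where xy: "x \<in> A" "C = r `` {x}" "y \<in> A" "D = r `` {y}" by (auto elim!: quotientE)
      then have "f x = f y" using eq some by simp
      then show "C = D" using xy by (simp add: r)
    qed
    have "A // r = (\<lambda>x. r `` {x}) ` A" by (auto simp: quotient_def)
    then have "(\<lambda>C. f (SOME x. x \<in> C)) ` (A // r) = (\<lambda>x. f (SOME y. y \<in> r `` {x})) ` A"
      by (simp only: image_image)
    also have "\<dots> = f ` A" using some by (intro image_cong) auto
    finally show "(\<lambda>C. f (SOME x. x \<in> C)) ` (A // r) = f ` A" .
  qed
qed

section \<open>Existence of extensions with a given invariant\<close>

context scaled_extension
begin

lemma poly_in_lin:
  assumes eis: "eisenstein \<pi> a"
  shows "poly (map_poly \<iota> g) \<pi> \<in> range (lin \<pi>)"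
proof -
  define F where "F = eisenstein_poly a"
  have evF: "poly (map_poly \<iota> F) \<pi> = 0"
    using eis by (simp add: F_def poly_eisenstein_poly iota_hom eisenstein_def lin_def)
  have "poly (map_poly \<iota> g) \<pi> = poly (map_poly \<iota> (F * (g div F) + g mod F)) \<pi>" by simp
  also have "\<dots> = poly (map_poly \<iota> (g mod F)) \<pi>"
    by (simp only: poly_map_add poly_map_mult iota_hom evF) simp
  also have "\<dots> = lin \<pi> (coeff (g mod F))"
    unfolding F_def lin_def by (rule poly_mod_eisenstein_poly(2)[OF iota_hom])
  finally show ?thesis by simp
qed

lemma lin_subfield:
  assumes eis: "eisenstein \<pi> a"
  shows "is_subfield (range (lin \<pi>))" "range \<iota> \<subseteq> range (lin \<pi>)" "\<pi> \<in> range (lin \<pi>)"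
proof -
  let ?L = "range (lin \<pi>)"
  have rep: "\<exists>g. x = poly (map_poly \<iota> g) \<pi>" if x: "x \<in> ?L" for x
  proof -
    obtain b where "x = lin \<pi> b" using x by auto
    then have "x = poly (map_poly \<iota> (\<Sum>j<p. monom (b j) j)) \<pi>" by (simp add: lin_poly[OF iota_hom] lin_def)
    then show ?thesis ..
  qed
  note mem = poly_in_lin[OF eis]
  have add: "x + y \<in> ?L" and mult: "x * y \<in> ?L" if xy: "x \<in> ?L" "y \<in> ?L" for x y
  proof -
    obtain f g where "x = poly (map_poly \<iota> f) \<pi>" "y = poly (map_poly \<iota> g) \<pi>" using rep xy by metis
    then have "x + y = poly (map_poly \<iota> (f + g)) \<pi>" "x * y = poly (map_poly \<iota> (f * g)) \<pi>"
      by (simp_all add: poly_map_add poly_map_mult iota_hom)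
    then show "x + y \<in> ?L" "x * y \<in> ?L" using mem by simp_all
  qed
  have const: "\<iota> c \<in> ?L" for c using mem[of "monom c 0"] by (simp add: poly_map_monom)
  show "range \<iota> \<subseteq> ?L" using const by auto
  show "\<pi> \<in> ?L" using mem[of "monom 1 1"] by (simp add: poly_map_monom)
  have poly_mem: "poly (map_poly \<iota> g) x \<in> ?L" if "x \<in> ?L" for g x
    by (induction g) (use that const add mult const[of 0] in \<open>auto simp: map_poly_pCons\<close>)
  have minus: "- x \<in> ?L" if "x \<in> ?L" for x
    using mult[OF const[of "- 1"] that] by (simp add: iota_minus)
  have inv: "inverse x \<in> ?L" if x: "x \<in> ?L" "x \<noteq> 0" for x
  proof -
    \<comment> \<open>Dividing an equation of x by a power of x makes its constant term c nonzero,
      and then 1/x = - h(x)/c.\<close>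
    have "\<exists>c h. c \<noteq> 0 \<and> \<iota> c + x * poly (map_poly \<iota> h) x = 0" if "f \<noteq> 0" "poly (map_poly \<iota> f) x = 0" for f
      using that
    proof (induction f)
      case (pCons c f)
      show ?case
      proof (cases "c = 0")
        case True
        then show ?thesis using pCons x by (auto simp: map_poly_pCons)
      next
        case False
        then show ?thesis using pCons by (auto simp: map_poly_pCons)
      qed
    qed simp
    then obtain c h where c: "c \<noteq> 0" "\<iota> c + x * poly (map_poly \<iota> h) x = 0" using algebraic by blast
    define y where "y = poly (map_poly \<iota> h) x"
    have "x * (\<iota> (- inverse c) * y) = 1"
    proof -
      have "x * y = - \<iota> c" using c(2) by (simp add: y_def add_eq_0_iff)
      then have "\<iota> (- inverse c) * (x * y) = 1" using c(1) by (simp add: iota_minus iota_inverse)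
      then show ?thesis by (simp add: mult_ac)
    qed
    then have "inverse x = \<iota> (- inverse c) * y" by (rule inverse_unique)
    then show ?thesis
      using mult[OF const[of "- inverse c"] poly_mem[OF x(1), of h]] by (simp only: y_def)
  qed
  have "inverse x \<in> ?L" if "x \<in> ?L" for x
    using inv[OF that] const[of 0] by (cases "x = 0") auto
  then show "is_subfield ?L"
    using add mult minus const[of 0] const[of 1] by (simp add: is_subfield_def)
qed

lemma lin_tot_ram:
  assumes eis: "eisenstein \<pi> a"
  shows "tot_ram v p \<iota> \<nu> (range (lin \<pi>))"
proof -
  have \<pi>: "\<pi> \<noteq> 0" "\<nu> \<pi> = 1" using eisenstein_prime[OF eis] by auto
  show ?thesis
  proof unfold_locales
    show "is_subfield (range (lin \<pi>))" "range \<iota> \<subseteq> range (lin \<pi>)" by (rule lin_subfield[OF eis])+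
    show "\<exists>\<pi>'\<in>range (lin \<pi>). \<pi>' \<noteq> 0 \<and> \<nu> \<pi>' = 1" using \<pi> lin_subfield(3)[OF eis] by blast
    show "range (lin \<pi>) = range (lin \<pi>')" if "\<pi>' \<in> range (lin \<pi>)" "\<pi>' \<noteq> 0" "\<nu> \<pi>' = 1" for \<pi>'
      by (rule generated_by_prime[OF lin_subfield(1,2)[OF eis] ext_degree_lin[OF \<pi>] that])
    show "\<nu> x \<in> \<int>" if x: "x \<in> range (lin \<pi>)" "x \<noteq> 0" for x
    proof -
      obtain b where b: "x = lin \<pi> b" using x by auto
      have "\<exists>j<p. b j \<noteq> 0" using x b by (intro lin_nonzero[of \<pi>]) simp
      then obtain i where i: "b i \<noteq> 0" "same_lead \<nu> x (\<iota> (b i) * \<pi> ^ i)"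
        using lin_lead[where a = b, OF \<pi>] unfolding b by blast
      have "\<nu> x = real p * v (b i) + real i" using same_lead_val[OF i(2)] val_term[OF \<pi> i(1)] by simp
      then show ?thesis using val_in_Ints[OF i(1)] by simp
    qed
  qed
qed

end

context ramified_extensions
begin

text \<open>The extension is generated by a root x of the normal form polynomial G. Its derivative
  is a multiple of X^(ri - 1) and its constant term is not 0, so G is separable and has a root in
  K_s. The cofactor H of that root is separable of degree p - 1 > 0 and supplies a second root y, to
  which x can be mapped.\<close>

lemma extension_exists:
  assumes w: "w \<in> Tx"
  shows "\<exists>L\<in>E. inv_rel L w"
proof -
  obtain \<nu> where N: "scaled_extension v p \<iota> \<nu>" by (rule extension_of_valuation)
  interpret N: scaled_extension v p \<iota> \<nu> by (rule N)
  obtain t where t: "t \<noteq> 0" "v t = 1" using uniformizer_exists by blast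
  define \<omega> where "\<omega> = w / of_nat ri"
  have \<omega>: "\<omega> \<in> Tx" using w of_nat_ri by (simp add: \<omega>_def Tx_divide)
  define \<alpha> where "\<alpha> = \<iota> (\<omega> * t ^ rn)"
  have \<alpha>: "\<alpha> \<noteq> 0" using \<omega> t by (simp add: \<alpha>_def Tx_def)
  define G :: "'a poly" where "G = monom 1 p - monom \<alpha> ri - [:\<iota> t:]"
  have G_eval: "poly G x = nf_eval \<omega> t x" for x by (simp add: G_def poly_monom nf_eval_def \<alpha>_def)
  have degG: "degree G = p"
  proof -
    have "G = monom 1 p + (monom (- \<alpha>) ri + [:- \<iota> t:])" by (simp add: G_def minus_monom)
    moreover have "degree (monom (- \<alpha>) ri + [:- \<iota> t:]) < p"
      using ri_less p_pos by (intro degree_add_less le_less_trans[OF degree_monom_le]) auto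
    ultimately show ?thesis by (simp add: degree_add_eq_left degree_monom_eq)
  qed
  have "pderiv (monom 1 p :: 'a poly) = 0"
    using of_nat_CHAR[where ?'a = 'a] by (simp add: pderiv_monom char_p')
  then have G': "pderiv G = smult (- (of_nat ri * \<alpha>)) (monom 1 (ri - 1))"
    by (simp add: G_def pderiv_diff pderiv_monom pderiv_pCons smult_monom minus_monom)
  have sepG: "coprime G (pderiv G)"
  proof (rule coprimeI)
    \<comment> \<open>Such a d divides X^(ri - 1), hence X^p - \<alpha> X^ri, hence the difference
      of this and G, which is the nonzero constant t.\<close>
    fix d assume d: "d dvd G" "d dvd pderiv G"
    have "d dvd smult (- inverse (of_nat ri * \<alpha>)) (pderiv G)" using d(2) by (rule dvd_smult)
    also have "smult (- inverse (of_nat ri * \<alpha>)) (pderiv G) = monom 1 (ri - 1)"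
      unfolding G' smult_smult using \<alpha> of_nat_ri by (simp del: inverse_mult_distrib)
    finally have "d dvd monom 1 (ri - 1)" .
    then have X: "d dvd monom 1 (ri - 1) * (monom 1 (p - (ri - 1)) - monom \<alpha> 1)" by (rule dvd_mult2)
    have "monom 1 (ri - 1) * (monom 1 (p - (ri - 1)) - monom \<alpha> 1) = monom 1 p - monom \<alpha> ri"
      using ri_pos ri_less by (simp add: right_diff_distrib mult_monom)
    then have "d dvd (monom 1 p - monom \<alpha> ri) - G" using dvd_diff[OF X d(1)] by simp
    then have "d dvd [:\<iota> t:]" by (simp add: G_def)
    moreover have "is_unit [:\<iota> t:]" using t by (simp add: is_unit_const_poly_iff dvd_field_iff)
    ultimately show "is_unit d" by (rule dvd_unit_imp_unit)
  qed
  have root_ex: "\<exists>x. poly f x = 0" if "degree f > 0" "separable_poly f" for f :: "'a poly"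
    using sep_closure that by (simp add: separable_closure_def)
  obtain x where x: "poly G x = 0"
    using root_ex[of G] degG p_pos sepG by (auto simp: separable_poly_def)
  then obtain H where H: "G = [:- x, 1:] * H" by (auto simp: poly_eq_0_iff_dvd dvd_def)
  have "H \<noteq> 0" using degG p_pos H by auto
  then have degH: "degree H = p - 1" using degG unfolding H by (subst (asm) degree_mult_eq) auto
  have Gd: "pderiv G = [:- x, 1:] * pderiv H + H"
    unfolding H by (subst pderiv_mult) (simp add: pderiv_pCons)
  have "separable_poly H" unfolding separable_poly_def
  proof (rule coprimeI)
    fix d assume d: "d dvd H" "d dvd pderiv H"
    have "d dvd G" unfolding H using d(1) by (rule dvd_mult)
    moreover have "d dvd pderiv G" unfolding Gd by (intro dvd_add dvd_mult d)
    ultimately show "is_unit d" using sepG by (rule coprime_common_divisor[rotated])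
  qed
  then obtain y where y: "poly H y = 0" using root_ex[of H] degH p_gt_1 by auto
  have yx: "y \<noteq> x"
  proof
    assume "y = x"
    then have "[:- x, 1:] dvd H" using y by (simp add: poly_eq_0_iff_dvd)
    then have "[:- x, 1:] dvd G" "[:- x, 1:] dvd pderiv G"
      unfolding Gd unfolding H by (intro dvd_triv_left, intro dvd_add dvd_triv_left)
    then have "is_unit [:- x, 1:]" using sepG by (rule coprime_common_divisor[rotated])
    then show False by (simp add: is_unit_pCons_iff)
  qed
  have e: "nf_eval \<omega> t x = 0" "nf_eval \<omega> t y = 0" using x y H by (simp_all flip: G_eval)
  note eis = nf_eisenstein[OF Tx_T[OF \<omega>] t e(1)]
  define L where "L = range (lin x)"
  have M: "tot_ram v p \<iota> \<nu> L" unfolding L_def by (rule N.lin_tot_ram[OF eis])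
  have xL: "x \<in> L" unfolding L_def by (rule N.lin_subfield(3)[OF eis])
  have pr: "x \<noteq> 0" "\<nu> x = 1" using N.eisenstein_prime[OF eis] by auto
  obtain \<sigma> where \<sigma>: "field_hom_on L \<sigma>" "\<sigma> x = y" "\<And>a. \<sigma> (\<iota> a) = \<iota> (id a)"
    using nf_hom_extension[OF M Tx_T[OF \<omega>] t xL pr e(1), of id t y] e(2) by auto
  have "\<omega> * t ^ rn \<noteq> 0" "v (\<omega> * t ^ rn) = real rn"
    using \<omega> t T_val by (auto simp: Tx_def valuation.val_mult[OF valuation_v] valuation.val_power[OF valuation_v])
  then have data: "eis_data L x (nf_coeff \<omega> t)"
    using xL eis ri ri_pos m_eq_real valuation.val_minus[OF valuation_v]
    by (auto simp: eis_data_def nf_coeff_def)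
  have "lead_coef (nf_coeff \<omega> t) = w"
    using t ri_pos of_nat_ri by (simp add: lead_coef_def nf_coeff_def \<omega>_def)
  then have "inv_rel L w"
    using data w valuation.same_lead_refl[OF valuation_v Tx_nz[OF w]] unfolding inv_rel_def by metis
  moreover have "L \<in> E"
    using \<sigma> yx xL by (intro E_I[OF M data, of \<sigma>]) (auto simp: K_embedding_def)
  ultimately show ?thesis by blast
qed

definition inv_class :: "'a set \<Rightarrow> 'k set" where
  "inv_class L = {w. inv_rel L w}"

lemma inv_class_eq:
  assumes "L \<in> E" "inv_rel L w"
  shows "inv_class L = (*) w ` powers m"
proof (intro equalityI subsetI)
  fix w' assume "w' \<in> inv_class L"
  then have "\<exists>c\<in>Tx. w' = w * c ^ m" using inv_unique[OF assms(1) _ assms(2)] by (simp add: inv_class_def)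
  then show "w' \<in> (*) w ` powers m" by (auto simp: powers_def)
next
  fix w' assume "w' \<in> (*) w ` powers m"
  then show "w' \<in> inv_class L" using inv_scale[OF assms] by (auto simp: powers_def inv_class_def)
qed

lemma k_isomorphic_iff:
  assumes "L1 \<in> E" "L2 \<in> E"
  shows "k_isomorphic \<iota> v L1 L2 \<longleftrightarrow> inv_class L1 = inv_class L2"
proof
  assume iso: "k_isomorphic \<iota> v L1 L2"
  obtain w where w: "inv_rel L1 w" using inv_exists[OF assms(1)] by blast
  have "is_subfield L1" "range \<iota> \<subseteq> L1"
    using assms(1) by (auto simp: E_def ramified_exts_def subextension_def)
  then have "inv_rel L2 w" using k_iso_inv[OF _ _ iso w] by blast
  then show "inv_class L1 = inv_class L2" using inv_class_eq assms w by metis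
next
  assume eq: "inv_class L1 = inv_class L2"
  obtain w where w: "inv_rel L1 w" using inv_exists[OF assms(1)] by blast
  then have "inv_rel L2 w" using eq by (auto simp: inv_class_def)
  then show "k_isomorphic \<iota> v L1 L2" using inv_imp_k_isomorphic assms w by blast
qed

text \<open>A is the set of residues that occur in the family F, a union of cosets of the m-th
  powers. It is applied to all of E, to the Galois extensions and to the non-Galois ones.\<close>

lemma card_classes:
  assumes A: "A \<subseteq> Tx" "\<And>w c. w \<in> A \<Longrightarrow> c \<in> powers m \<Longrightarrow> w * c \<in> A"
    and F: "F \<subseteq> E" "\<And>L w. L \<in> E \<Longrightarrow> inv_rel L w \<Longrightarrow> L \<in> F \<longleftrightarrow> w \<in> A"
  shows "finite (k_iso_classes \<iota> v F)" "card (k_iso_classes \<iota> v F) * card (powers m) = card A"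
proof -
  have "inv_class ` F = (\<lambda>w. (*) w ` powers m) ` A"
  proof (intro equalityI subsetI)
    fix C assume "C \<in> inv_class ` F"
    then obtain L where L: "L \<in> F" "C = inv_class L" by blast
    then obtain w where w: "inv_rel L w" using inv_exists F by blast
    then have "w \<in> A" "C = (*) w ` powers m" using L F inv_class_eq[of L w] by blast+
    then show "C \<in> (\<lambda>w. (*) w ` powers m) ` A" by blast
  next
    fix C assume "C \<in> (\<lambda>w. (*) w ` powers m) ` A"
    then obtain w where w: "w \<in> A" "C = (*) w ` powers m" by blast
    then obtain L where L: "L \<in> E" "inv_rel L w" using extension_exists A by blast
    then have "L \<in> F" "C = inv_class L" using w F inv_class_eq by auto
    then show "C \<in> inv_class ` F" by blast
  qed
  moreover have "{(L1, L2). L1 \<in> F \<and> L2 \<in> F \<and> k_isomorphic \<iota> v L1 L2}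
      = {(x, y). x \<in> F \<and> y \<in> F \<and> inv_class x = inv_class y}"
    using k_isomorphic_iff F(1) by auto
  ultimately have bij: "bij_betw (\<lambda>C. inv_class (SOME x. x \<in> C)) (k_iso_classes \<iota> v F) ((\<lambda>w. (*) w ` powers m) ` A)"
    using quotient_kernel_bij[where A = F and f = inv_class, OF refl] by (simp add: k_iso_classes_def)
  have "finite A" using A finite_Tx finite_subset by blast
  then show "finite (k_iso_classes \<iota> v F)" using bij_betw_finite[OF bij] by simp
  show "card (k_iso_classes \<iota> v F) * card (powers m) = card A"
    using card_cosets[OF A] bij_betw_same_card[OF bij] by simp
qed

lemma card_powers_pos: "card (powers m) > 0"
  using card_powers[OF m_pos] card_Tx_pos by (metis mult_0 neq0_conv)

lemma card_all: "finite (k_iso_classes \<iota> v E)" "card (k_iso_classes \<iota> v E) = gcd (card Tx) m"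
proof -
  note * = card_classes[of Tx E]
  have Tx: "w * c \<in> Tx" if "w \<in> Tx" "c \<in> powers m" for w c
    using that powers_subset Tx_mult by blast
  have inv: "w \<in> Tx" if "inv_rel L w" for L w using that by (simp add: inv_rel_def)
  show "finite (k_iso_classes \<iota> v E)" by (rule *(1)) (use Tx inv in auto)
  have "card (k_iso_classes \<iota> v E) * card (powers m) = card Tx" by (rule *(2)) (use Tx inv in auto)
  also have "\<dots> = gcd (card Tx) m * card (powers m)" using card_powers[OF m_pos] by (simp add: mult.commute)
  finally show "card (k_iso_classes \<iota> v E) = gcd (card Tx) m" using card_powers_pos by simp
qed

lemma card_galois:
  assumes mb: "m = (p - 1) * b"
  defines "F \<equiv> {L \<in> E. galois_ext \<iota> L}" and "F' \<equiv> {L \<in> E. \<not> galois_ext \<iota> L}"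
  shows "finite (k_iso_classes \<iota> v F)" "card (k_iso_classes \<iota> v F) = gcd (card Tx div (p - 1)) b"
    and "finite (k_iso_classes \<iota> v F')" "card (k_iso_classes \<iota> v F') = (p - 2) * gcd (card Tx div (p - 1)) b"
proof -
  define g where "g = gcd (card Tx div (p - 1)) b"
  have p1: "p - 1 > 0" using p_gt_1 by simp
  obtain q' where q': "card Tx = (p - 1) * q'" using p_minus_1_dvd by blast
  then have g: "gcd (card Tx) m = (p - 1) * g"
    using p1 by (simp add: g_def mb gcd_mult_distrib_nat)
  have gcd1: "gcd (card Tx) (p - 1) = p - 1" using p_minus_1_dvd by (simp add: gcd_nat.absorb2)
  have Pm: "card (powers m) * ((p - 1) * g) = card Tx" using card_powers[OF m_pos] g by simp
  have P1: "card (powers (p - 1)) * (p - 1) = card Tx" using card_powers[OF p1] gcd1 by simp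
  have gal: "galois_ext \<iota> L \<longleftrightarrow> w \<in> powers (p - 1)" if L: "L \<in> E" "inv_rel L w" for L w
  proof
    show "w \<in> powers (p - 1)" if "galois_ext \<iota> L" by (rule power_if_galois[OF L(1) mb that L(2)])
    show "galois_ext \<iota> L" if "w \<in> powers (p - 1)"
      using galois_if_power[OF L(1) mb] that L(2) by (auto simp: powers_def)
  qed
  have sub: "powers m \<subseteq> powers (p - 1)"
  proof
    fix y assume "y \<in> powers m"
    then obtain x where x: "x \<in> Tx" "y = x ^ m" by (auto simp: powers_def)
    then have "y = (x ^ b) ^ (p - 1)" by (simp only: mb mult.commute[of "p - 1"] power_mult)
    then show "y \<in> powers (p - 1)" using x Tx_power unfolding powers_def by blast
  qed
  have closed: "w * c \<in> powers (p - 1)" "w / c \<in> powers (p - 1)"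
    if "w \<in> powers (p - 1)" "c \<in> powers (p - 1)" for w c
    using that by (auto simp: powers_def Tx_mult Tx_divide simp flip: power_mult_distrib power_divide intro!: imageI)
  note cF = card_classes[of "powers (p - 1)" F]
  show "finite (k_iso_classes \<iota> v F)"
    by (rule cF(1)) (use powers_subset closed sub gal in \<open>auto simp: F_def\<close>)
  have "card (k_iso_classes \<iota> v F) * card (powers m) = card (powers (p - 1))"
    by (rule cF(2)) (use powers_subset closed sub gal in \<open>auto simp: F_def\<close>)
  moreover have "card (powers (p - 1)) = g * card (powers m)"
  proof -
    have "(p - 1) * card (powers (p - 1)) = (p - 1) * (g * card (powers m))"
      using Pm P1 by (simp add: mult_ac)
    then show ?thesis using p1 by simp
  qed
  ultimately show "card (k_iso_classes \<iota> v F) = gcd (card Tx div (p - 1)) b"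
    using card_powers_pos by (simp add: g_def)
  note cF' = card_classes[of "Tx - powers (p - 1)" F']
  \<comment> \<open>The m-th powers form a subgroup of the (p - 1)-st powers, so multiplication by
    them preserves the complement of the latter.\<close>
  have closed': "w * c \<in> Tx - powers (p - 1)" if "w \<in> Tx - powers (p - 1)" "c \<in> powers m" for w c
  proof -
    have c: "c \<in> powers (p - 1)" "c \<in> Tx" using that sub powers_subset by blast+
    then have "w * c \<notin> powers (p - 1)" using closed(2)[of "w * c" c] that Tx_nz[OF c(2)] by auto
    then show ?thesis using that c Tx_mult by auto
  qed
  have invTx: "w \<in> Tx" if "inv_rel L w" for L w using that by (simp add: inv_rel_def)
  show "finite (k_iso_classes \<iota> v F')"
    by (rule cF'(1)) (use closed' gal invTx in \<open>auto simp: F'_def\<close>)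
  have "card (k_iso_classes \<iota> v F') * card (powers m) = card (Tx - powers (p - 1))"
    by (rule cF'(2)) (use closed' gal invTx in \<open>auto simp: F'_def\<close>)
  also have "\<dots> = card Tx - card (powers (p - 1))"
    using powers_subset finite_powers by (rule card_Diff_subset[rotated])
  \<comment> \<open>There are (p - 1) g cosets of the m-th powers in all, and g of them consist of
    (p - 1)-st powers; p - 2 is (p - 1) - 1.\<close>
  also have "\<dots> = (p - 2) * g * card (powers m)"
  proof -
    have "card Tx = (p - 1) * (g * card (powers m))" using Pm by (simp add: mult_ac)
    moreover obtain k where "p = Suc (Suc k)" using p_ge_2 by (metis add_2_eq_Suc le_Suc_ex)
    ultimately show ?thesis
      unfolding \<open>card (powers (p - 1)) = g * card (powers m)\<close> by (simp add: mult.assoc)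
  qed
  finally show "card (k_iso_classes \<iota> v F') = (p - 2) * gcd (card Tx div (p - 1)) b"
    using card_powers_pos by (simp add: g_def)
qed

end

theorem corollary1p2:
  fixes \<iota> :: "'k::field \<Rightarrow> 'a::field"
    and v :: "'k \<Rightarrow> real"
    and p q :: nat
    and b :: real
  assumes "prime p"
    and "local_field v"
    and "CHAR('k) = p"
    and "separable_closure \<iota>"
    and "finite (residue_field v)"
    and "card (residue_field v) = q"
    and "b \<in> {1 / (real p - 1) * real m | m :: nat. m > 0 \<and> \<not> p dvd m}"
  shows "finite (S_all \<iota> v p b) \<and>
         card (S_all \<iota> v p b) = gcd (q - 1) (nat \<lfloor>(real p - 1) * b\<rfloor>) \<and>
         (\<forall>n :: nat. n > 0 \<and> \<not> p dvd n \<and> b = real n \<longrightarrow>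
            finite (S_galois \<iota> v p b) \<and>
            card (S_galois \<iota> v p b) = gcd ((q - 1) div (p - 1)) n \<and>
            finite (S_nongalois \<iota> v p b) \<and>
            card (S_nongalois \<iota> v p b) = (p - 2) * gcd ((q - 1) div (p - 1)) n)"
proof -
  obtain m where m: "m > 0" "\<not> p dvd m" "b = 1 / (real p - 1) * real m" using assms(7) by blast
  interpret ramified_extensions v p \<iota> m
    using assms m by unfold_locales (auto simp: local_field_def)
  have b: "b = real m / (real p - 1)" using m by simp
  then have E: "ramified_exts \<iota> v p b = E" by (simp add: E_def)
  have q: "card Tx = q - 1" using assms(6) card_T by (simp add: card_Tx)
  have "(real p - 1) * b = real m" using b p_gt_1 by simp
  then have m': "nat \<lfloor>(real p - 1) * b\<rfloor> = m" by simp
  have "finite (S_galois \<iota> v p b) \<and>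
            card (S_galois \<iota> v p b) = gcd ((q - 1) div (p - 1)) n \<and>
            finite (S_nongalois \<iota> v p b) \<and>
            card (S_nongalois \<iota> v p b) = (p - 2) * gcd ((q - 1) div (p - 1)) n" if n: "b = real n" for n
  proof -
    have "real m = real ((p - 1) * n)" using \<open>(real p - 1) * b = real m\<close> n p_gt_1 by (simp add: of_nat_diff)
    then have "m = (p - 1) * n" by (simp only: of_nat_eq_iff)
    from card_galois[OF this] show ?thesis by (simp add: S_galois_def S_nongalois_def E q)
  qed
  then show ?thesis using card_all by (simp add: S_all_def E q m')
qed

end
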